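(* Let $X$ be a Banach space with norm $\|\cdot\|$, let $A:D(A)\subset X\to X$ be the infinitesimal generator of an analytic semigroup $\mathrm{e}^{tA}$ on $X$ ($D(A)$ not necessarily dense), let $0\le\alpha<1$ and let $X_\alpha$, with norm $\|\cdot\|_\alpha$, be an intermediate space as described in the context. Let $T>0$ and $g:[0,T]\to X$ satisfy, for some constant $B_2$, $$\|g(t)\|,\ \|g'(t)\|\leq B_2,\quad 0\leq t\leq T,\qquad \|g''(t)\|\leq B_2t^{-1},\quad 0<t\leq T.$$ Let $u_0\in X_\alpha$ and let $u$ be the mild solution of $u'=Au+g(t)$, $u(0)=u_0$, on $[0,T]$. Let $u_n$ be the numerical solution, with time step $\tau>0$, given by the $s$-stage exponential Runge--Kutta method $$u_{n+1}=\mathrm{e}^{\tau A}u_n+\tau\sum_{i=1}^s b_i(\tau A)g(t_{ni}),\qquad t_{ni}=t_n+c_i\tau,\quad t_n=n\tau,$$ starting from $u_0$, whose weights satisfy $\sum_{i=1}^s b_i(z)=\varphi_1(z)$ and $\sum_{i=1}^s b_i(z)c_i=\varphi_2(z)$. Then $$\|u_n-u(t_n)\|_\alpha\leq C\tau^{2-\alpha}(|\log\tau|+1)$$ uniformly in $0\leq t_n\leq T$, where the constant $C$ depends on $B_2$ and $T$ but is independent of $n$ and $\tau$.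
   Context: Analytic semigroups. A linear operator $A:D(A)\subset X\to X$ on a Banach space $X$ is sectorial (equivalently, is the infinitesimal generator of an analytic semigroup in the sense used here) if there are $\omega\in\mathbb{R}$, $\theta\in(\pi/2,\pi)$, $M>0$ such that the resolvent set of $A$ contains $\{\lambda\neq\omega:|\arg(\lambda-\omega)|<\theta\}$ and $\|(\lambda I-A)^{-1}\|\le M/|\lambda-\omega|$ there. The domain is not assumed dense. $\mathrm{e}^{tA}$ ($t\ge0$) is the analytic semigroup generated by $A$ (Dunford integral for $t>0$, $\mathrm{e}^{0A}=I$); it need not be strongly continuous at $t=0$. Interpolation spaces. For $0<\alpha<1$, $1\le p\le\infty$, $D_A(\alpha,p)=\{x\in X: v(t)=\|t^{1-\alpha-1/p}A\mathrm{e}^{tA}x\|\in L^p(0,1)\}$ with norm $\|x\|+\|v\|_{L^p(0,1)}$; also $D_A(0,p)=X$. For $0<\alpha<1$, $X_\alpha$ is any Banach space with continuous embeddings $D_A(\alpha,1)\subset X_\alpha\subset D_A(\alpha,\infty)$, with norm $\|\cdot\|_\alpha$; $X_0=X$. Functions $\varphi_k$. $\varphi_0(z)=\mathrm{e}^z$ and $\varphi_k(z)=\int_0^1\mathrm{e}^{(1-\xi)z}\frac{\xi^{k-1}}{(k-1)!}\,\mathrm{d}\xi$ for $k\ge1$; $\varphi_k(tA)$ is defined by the same formula with $\mathrm{e}^{(1-\xi)tA}$. Method. The nodes satisfy $c_i\in[0,1]$, $1\le i\le s$, and the weights $b_i(z)$ are linear combinations of the functions $\varphi_k(z)$. Mild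 solution of the linear problem: $u(t)=\mathrm{e}^{tA}u_0+\int_0^t\mathrm{e}^{(t-\xi)A}g(\xi)\,\mathrm{d}\xi$, $0\le t\le T$. *)

theory Defs
  imports "HOL-Probability.Essential_Supremum"
begin

section \<open>Complex Banach spaces\<close>

text \<open>The libraries only provide real normed spaces; a complex Banach space is a real one
  with a compatible multiplication by complex scalars.\<close>

class complex_banach = banach +
  fixes scaleC :: "complex \<Rightarrow> 'a \<Rightarrow> 'a" (infixr "*\<^sub>C" 75)
  assumes scaleC_add_right: "a *\<^sub>C (x + y) = a *\<^sub>C x + a *\<^sub>C y"
    and scaleC_add_left: "(a + b) *\<^sub>C x = a *\<^sub>C x + b *\<^sub>C x"
    and scaleC_scaleC: "a *\<^sub>C (b *\<^sub>C x) = (a * b) *\<^sub>C x"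
    and scaleC_of_real: "complex_of_real r *\<^sub>C x = r *\<^sub>R x"
    and norm_scaleC: "norm (a *\<^sub>C x) = cmod a * norm x"

instantiation complex :: complex_banach
begin

definition scaleC_complex :: "complex \<Rightarrow> complex \<Rightarrow> complex" where
  "scaleC_complex a x = a * x"

instance
  by standard
    (simp_all add: scaleC_complex_def algebra_simps norm_mult scaleR_conv_of_real)

end

definition complex_subspace :: "'a::complex_banach set \<Rightarrow> bool" where
  "complex_subspace S \<longleftrightarrow> 0 \<in> S \<and> (\<forall>x\<in>S. \<forall>y\<in>S. x + y \<in> S) \<and> (\<forall>a. \<forall>x\<in>S. a *\<^sub>C x \<in> S)"

section \<open>Sectorial operators and the semigroups they generate\<close>

text \<open>An unbounded operator is given by its domain \<open>D\<close> and a function \<open>A\<close> whose values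
  outside \<open>D\<close> are irrelevant.\<close>

definition linear_operator :: "'a::complex_banach set \<Rightarrow> ('a \<Rightarrow> 'a) \<Rightarrow> bool" where
  "linear_operator D A \<longleftrightarrow> complex_subspace D \<and>
     (\<forall>x\<in>D. \<forall>y\<in>D. A (x + y) = A x + A y) \<and> (\<forall>a. \<forall>x\<in>D. A (a *\<^sub>C x) = a *\<^sub>C A x)"

definition resolvent :: "'a::complex_banach set \<Rightarrow> ('a \<Rightarrow> 'a) \<Rightarrow> complex \<Rightarrow> 'a \<Rightarrow> 'a" where
  "resolvent D A \<mu> = inv_into D (\<lambda>x. \<mu> *\<^sub>C x - A x)"

definition resolvent_set :: "'a::complex_banach set \<Rightarrow> ('a \<Rightarrow> 'a) \<Rightarrow> complex set" where
  "resolvent_set D A =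
     {\<mu>. bij_betw (\<lambda>x. \<mu> *\<^sub>C x - A x) D UNIV \<and> bounded_linear (resolvent D A \<mu>)}"

definition sectorial_with ::
    "'a::complex_banach set \<Rightarrow> ('a \<Rightarrow> 'a) \<Rightarrow> real \<Rightarrow> real \<Rightarrow> real \<Rightarrow> bool" where
  "sectorial_with D A \<omega> \<theta> M \<longleftrightarrow>
     linear_operator D A \<and> pi / 2 < \<theta> \<and> \<theta> < pi \<and> 0 < M \<and>
     (\<forall>\<mu>. \<mu> \<noteq> complex_of_real \<omega> \<and> \<bar>Arg (\<mu> - complex_of_real \<omega>)\<bar> < \<theta> \<longrightarrow>
        \<mu> \<in> resolvent_set D A \<and>
        onorm (resolvent D A \<mu>) \<le> M / cmod (\<mu> - complex_of_real \<omega>))"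

definition sectorial :: "'a::complex_banach set \<Rightarrow> ('a \<Rightarrow> 'a) \<Rightarrow> bool" where
  "sectorial D A \<longleftrightarrow> (\<exists>\<omega> \<theta> M. sectorial_with D A \<omega> \<theta> M)"

text \<open>The Dunford integral
  \[ \frac{1}{2\pi i} \int_{\omega+\gamma_{r,\eta}} e^{t\mu} (\mu I - A)^{-1} x \,d\mu \]
  where \<open>\<gamma>\<close> comes from infinity along the ray of angle \<open>-\<eta>\<close>, follows the arc of radius \<open>r\<close>
  counterclockwise, and leaves along the ray of angle \<open>\<eta>\<close>.  The integrals are
  Henstock-Kurzweil integrals because the Bochner integral of the library is restricted to
  separable spaces.\<close>

definition dunford_integral ::
    "'a::complex_banach set \<Rightarrow> ('a \<Rightarrow> 'a) \<Rightarrow> real \<Rightarrow> real \<Rightarrow> real \<Rightarrow> real \<Rightarrow> 'a \<Rightarrow> 'a" where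
  "dunford_integral D A \<omega> r \<eta> t x =
     (let F = (\<lambda>\<mu>. exp (of_real t * \<mu>) *\<^sub>C resolvent D A \<mu> x);
          \<gamma> = (\<lambda>\<rho> v. of_real \<omega> + of_real \<rho> * cis v)
      in (1 / (2 * of_real pi * \<i>)) *\<^sub>C
           (- integral {r..} (\<lambda>\<rho>. cis (- \<eta>) *\<^sub>C F (\<gamma> \<rho> (- \<eta>)))
            + integral {- \<eta>..\<eta>} (\<lambda>v. (\<i> * of_real r * cis v) *\<^sub>C F (\<gamma> r v))
            + integral {r..} (\<lambda>\<rho>. cis \<eta> *\<^sub>C F (\<gamma> \<rho> \<eta>))))"

definition admissible_contour ::
    "'a::complex_banach set \<Rightarrow> ('a \<Rightarrow> 'a) \<Rightarrow> real \<times> real \<times> real \<Rightarrow> bool" where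
  "admissible_contour D A = (\<lambda>(\<omega>, r, \<eta>).
     \<exists>\<theta> M. sectorial_with D A \<omega> \<theta> M \<and> 0 < r \<and> pi / 2 < \<eta> \<and> \<eta> < \<theta>)"

text \<open>By Cauchy's theorem the Dunford integral is the same for all admissible contours, so
  the choice below is immaterial.\<close>

definition analytic_semigroup ::
    "'a::complex_banach set \<Rightarrow> ('a \<Rightarrow> 'a) \<Rightarrow> real \<Rightarrow> 'a \<Rightarrow> 'a" where
  "analytic_semigroup D A t x =
     (if t = 0 then x
      else (case (SOME p. admissible_contour D A p) of
              (\<omega>, r, \<eta>) \<Rightarrow> dunford_integral D A \<omega> r \<eta> t x))"

section \<open>Intermediate spaces\<close>

text \<open>\<open>L\<^sup>p(0,1)\<close> for \<open>1 \<le> p \<le> \<infinity>\<close>.  Note that the library's \<open>esssup\<close> is infinite on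
  non-measurable functions.\<close>

definition Lp01 :: "ennreal \<Rightarrow> (real \<Rightarrow> real) set" where
  "Lp01 p = {v. v \<in> borel_measurable (lebesgue_on {0<..<1}) \<and>
     (if p = \<infinity> then esssup (lebesgue_on {0<..<1}) (\<lambda>t. ereal \<bar>v t\<bar>) < \<infinity>
      else integrable (lebesgue_on {0<..<1}) (\<lambda>t. \<bar>v t\<bar> powr enn2real p))}"

definition Lp01_norm :: "ennreal \<Rightarrow> (real \<Rightarrow> real) \<Rightarrow> real" where
  "Lp01_norm p v =
     (if p = \<infinity> then real_of_ereal (esssup (lebesgue_on {0<..<1}) (\<lambda>t. ereal \<bar>v t\<bar>))
      else (integral\<^sup>L (lebesgue_on {0<..<1}) (\<lambda>t. \<bar>v t\<bar> powr enn2real p))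
             powr (1 / enn2real p))"

text \<open>In \<open>ennreal\<close>, \<open>1 / \<infinity> = 0\<close>.\<close>

definition interp_fun ::
    "'a::complex_banach set \<Rightarrow> ('a \<Rightarrow> 'a) \<Rightarrow> real \<Rightarrow> ennreal \<Rightarrow> 'a \<Rightarrow> real \<Rightarrow> real" where
  "interp_fun D A \<alpha> p x t =
     norm (t powr (1 - \<alpha> - enn2real (1 / p)) *\<^sub>R A (analytic_semigroup D A t x))"

definition interp_space ::
    "'a::complex_banach set \<Rightarrow> ('a \<Rightarrow> 'a) \<Rightarrow> real \<Rightarrow> ennreal \<Rightarrow> 'a set" where
  "interp_space D A \<alpha> p = {x. interp_fun D A \<alpha> p x \<in> Lp01 p}"

definition interp_norm ::
    "'a::complex_banach set \<Rightarrow> ('a \<Rightarrow> 'a) \<Rightarrow> real \<Rightarrow> ennreal \<Rightarrow> 'a \<Rightarrow> real" where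
  "interp_norm D A \<alpha> p x = norm x + Lp01_norm p (interp_fun D A \<alpha> p x)"

text \<open>\<open>Y\<close> is a linear subspace that is a Banach space for its own norm \<open>N\<close>.\<close>

definition banach_norm_on :: "'a::complex_banach set \<Rightarrow> ('a \<Rightarrow> real) \<Rightarrow> bool" where
  "banach_norm_on Y N \<longleftrightarrow>
     complex_subspace Y \<and>
     (\<forall>x\<in>Y. 0 \<le> N x \<and> (N x = 0 \<longleftrightarrow> x = 0)) \<and>
     (\<forall>x\<in>Y. \<forall>y\<in>Y. N (x + y) \<le> N x + N y) \<and>
     (\<forall>a. \<forall>x\<in>Y. N (a *\<^sub>C x) = cmod a * N x) \<and>
     (\<forall>f::nat \<Rightarrow> 'a. (\<forall>n. f n \<in> Y) \<and> (\<forall>e>0. \<exists>K. \<forall>m\<ge>K. \<forall>n\<ge>K. N (f m - f n) < e) \<longrightarrow>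
        (\<exists>l\<in>Y. (\<lambda>n. N (f n - l)) \<longlonglongrightarrow> 0))"

definition continuously_embedded ::
    "'a set \<Rightarrow> ('a \<Rightarrow> real) \<Rightarrow> 'a set \<Rightarrow> ('a \<Rightarrow> real) \<Rightarrow> bool" where
  "continuously_embedded Y N Z P \<longleftrightarrow> Y \<subseteq> Z \<and> (\<exists>K. \<forall>x\<in>Y. P x \<le> K * N x)"

definition intermediate_space ::
    "'a::complex_banach set \<Rightarrow> ('a \<Rightarrow> 'a) \<Rightarrow> real \<Rightarrow> 'a set \<Rightarrow> ('a \<Rightarrow> real) \<Rightarrow> bool" where
  "intermediate_space D A \<alpha> Y N \<longleftrightarrow>
     (if \<alpha> = 0 then Y = UNIV \<and> N = norm
      else banach_norm_on Y N \<and>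
        continuously_embedded (interp_space D A \<alpha> 1) (interp_norm D A \<alpha> 1) Y N \<and>
        continuously_embedded Y N (interp_space D A \<alpha> \<infinity>) (interp_norm D A \<alpha> \<infinity>))"

section \<open>Exponential Runge--Kutta methods\<close>

definition phi :: "nat \<Rightarrow> complex \<Rightarrow> complex" where
  "phi k z = (if k = 0 then exp z
     else integral {0..1} (\<lambda>\<xi>. exp (of_real (1 - \<xi>) * z) * of_real (\<xi> ^ (k - 1) / fact (k - 1))))"

text \<open>\<open>phi_op D A k t\<close> is \<open>\<phi>\<^sub>k(tA)\<close>.\<close>

definition phi_op ::
    "'a::complex_banach set \<Rightarrow> ('a \<Rightarrow> 'a) \<Rightarrow> nat \<Rightarrow> real \<Rightarrow> 'a \<Rightarrow> 'a" where
  "phi_op D A k t x = (if k = 0 then analytic_semigroup D A t x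
     else integral {0..1}
       (\<lambda>\<xi>. (\<xi> ^ (k - 1) / fact (k - 1)) *\<^sub>R analytic_semigroup D A ((1 - \<xi>) * t) x))"

text \<open>A weight \<open>b(z) = \<Sum>\<^sub>k \<beta>\<^sub>k \<phi>\<^sub>k(z)\<close> is given by the list of its coefficients \<open>\<beta>\<^sub>k\<close>.\<close>

definition weight :: "complex list \<Rightarrow> complex \<Rightarrow> complex" where
  "weight \<beta> z = (\<Sum>k<length \<beta>. \<beta> ! k * phi k z)"

definition weight_op ::
    "'a::complex_banach set \<Rightarrow> ('a \<Rightarrow> 'a) \<Rightarrow> complex list \<Rightarrow> real \<Rightarrow> 'a \<Rightarrow> 'a" where
  "weight_op D A \<beta> t x = (\<Sum>k<length \<beta>. (\<beta> ! k) *\<^sub>C phi_op D A k t x)"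

primrec exp_rk ::
    "'a::complex_banach set \<Rightarrow> ('a \<Rightarrow> 'a) \<Rightarrow> nat \<Rightarrow> (nat \<Rightarrow> real) \<Rightarrow> (nat \<Rightarrow> complex list) \<Rightarrow>
     (real \<Rightarrow> 'a) \<Rightarrow> 'a \<Rightarrow> real \<Rightarrow> nat \<Rightarrow> 'a" where
  "exp_rk D A s c b g u0 \<tau> 0 = u0"
| "exp_rk D A s c b g u0 \<tau> (Suc n) =
     analytic_semigroup D A \<tau> (exp_rk D A s c b g u0 \<tau> n)
     + \<tau> *\<^sub>R (\<Sum>i = 1..s. weight_op D A (b i) \<tau> (g (real n * \<tau> + c i * \<tau>)))"

definition mild_solution ::
    "'a::complex_banach set \<Rightarrow> ('a \<Rightarrow> 'a) \<Rightarrow> (real \<Rightarrow> 'a) \<Rightarrow> 'a \<Rightarrow> real \<Rightarrow> 'a" where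
  "mild_solution D A g u0 t =
     analytic_semigroup D A t u0
     + integral {0..t} (\<lambda>\<xi>. analytic_semigroup D A (t - \<xi>) (g \<xi>))"

end

theory Submission
  imports Defs
begin

text \<open>Substituting the mild solution into the scheme leaves the error recursion
  \<open>e\<^sub>n\<^sub>+\<^sub>1 = S(\<tau>) e\<^sub>n + \<delta>\<^sub>n\<close>.  The two conditions on the weights carry over from functions to
  operators because the \<open>\<phi>\<^sub>k\<close> are linearly independent, so the method integrates affine
  right-hand sides exactly, and \<open>\<delta>\<^sub>n\<close> only sees the Taylor remainder of \<open>g\<close>, which is
  \<open>O(\<tau> / max 1 n)\<close> on the \<open>n\<close>-th step.  As \<open>A S(t)\<close> is \<open>O(1 / t)\<close>, integration over one step gives
  \<open>A S(t) \<delta>\<^sub>n = O(ln (1 + \<tau> / t)) \<tau> / max 1 n\<close>, whose \<open>t\<^sup>-\<^sup>\<alpha>\<close>-weighted \<open>L\<^sup>1\<close> norm is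
  \<open>O(\<tau>\<^sup>2\<^sup>-\<^sup>\<alpha> / max 1 n)\<close>; the harmonic sum over the steps produces the logarithm.  The semigroup
  acts boundedly on this norm, so no smoothing by \<open>S(t)\<close> over several steps is needed.

  The analytic semigroup itself is obtained from the Dunford integral by real-variable means:
  changing the radius of the contour is a differentiation under the integral sign, the bound near
  \<open>t = 0\<close> uses the radius \<open>1 / t\<close>, and the semigroup law follows from uniqueness for
  \<open>u' = A u\<close>.\<close>

section \<open>Complex scalar multiplication\<close>

text \<open>The constant of the theorem is chosen before \<open>g\<close>, \<open>u0\<close>,
  \<open>\<tau>\<close> and \<open>n\<close>, so the operator bounds are uniform on bounded time
  intervals and the Taylor estimate is uniform in the step. The intermediate norm enters only once.
  Everything before that happens in \<open>X\<close>, with two bounds tied to a common number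
  \<open>E\<close>: \<open>norm x \<le> \<tau> * E\<close> and
  \<open>norm (A (S(t) x)) \<le> E * ln (1 + \<tau> / t)\<close>. This pair is additive in
  \<open>x\<close> and survives an application of the semigroup up to a constant, so it can be
  summed over all steps. For the total error \<open>E\<close> is \<open>\<tau>\<close> times the
  logarithmic factor, and passing to the intermediate norm supplies the remaining power
  \<open>1 - \<alpha>\<close> of \<open>\<tau>\<close>. Two obstacles shape the preparation. As
  \<open>D\<close> need not be dense, \<open>S(t) x\<close> may fail to converge to \<open>x\<close>
  as \<open>t\<close> tends to 0; integrands such as \<open>S(t - \<xi>) (g \<xi>)\<close> are then
  continuous on half-open intervals only. And \<open>g''\<close> may grow like \<open>1 / t\<close>,
  which is not integrable at 0, so the first step must be estimated from \<open>g'\<close>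
  alone.\<close>

lemma bounded_bilinear_scaleC: "bounded_bilinear (scaleC :: complex \<Rightarrow> 'a::complex_banach \<Rightarrow> 'a)"
proof
  fix a b :: complex and x y :: 'a and r :: real
  show "(a + b) *\<^sub>C x = a *\<^sub>C x + b *\<^sub>C x" by (rule scaleC_add_left)
  show "a *\<^sub>C (x + y) = a *\<^sub>C x + a *\<^sub>C y" by (rule scaleC_add_right)
  show "(r *\<^sub>R a) *\<^sub>C x = r *\<^sub>R a *\<^sub>C x"
    by (simp add: scaleR_conv_of_real flip: scaleC_scaleC scaleC_of_real)
  show "a *\<^sub>C r *\<^sub>R x = r *\<^sub>R a *\<^sub>C x"
    by (simp add: scaleC_scaleC mult.commute flip: scaleC_of_real)
  show "\<exists>K. \<forall>a (x::'a). norm (a *\<^sub>C x) \<le> norm a * norm x * K"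
    by (intro exI[of _ 1]) (simp add: norm_scaleC)
qed

lemmas bounded_linear_scaleC = bounded_bilinear.bounded_linear_right[OF bounded_bilinear_scaleC]
lemmas scaleC_zero_left [simp] = bounded_bilinear.zero_left[OF bounded_bilinear_scaleC]
lemmas scaleC_zero_right [simp] = bounded_bilinear.zero_right[OF bounded_bilinear_scaleC]
lemmas scaleC_minus_left = bounded_bilinear.minus_left[OF bounded_bilinear_scaleC]
lemmas scaleC_minus_right = bounded_bilinear.minus_right[OF bounded_bilinear_scaleC]
lemmas scaleC_diff_left = bounded_bilinear.diff_left[OF bounded_bilinear_scaleC]
lemmas scaleC_diff_right = bounded_bilinear.diff_right[OF bounded_bilinear_scaleC]
lemmas scaleC_sum_left = bounded_bilinear.sum_left[OF bounded_bilinear_scaleC]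
lemmas continuous_on_scaleC [continuous_intros] =
  bounded_bilinear.continuous_on[OF bounded_bilinear_scaleC]

lemma scaleC_one [simp]: "1 *\<^sub>C x = (x::'a::complex_banach)"
  using scaleC_of_real[of 1 x] by simp

lemma scaleC_scaleR_commute: "a *\<^sub>C (r *\<^sub>R x) = r *\<^sub>R (a *\<^sub>C (x::'a::complex_banach))"
  by (rule bounded_bilinear.scaleR_right[OF bounded_bilinear_scaleC])

lemma scaleC_eq_iff: "a \<noteq> 0 \<Longrightarrow> a *\<^sub>C x = y \<longleftrightarrow> x = inverse a *\<^sub>C (y::'a::complex_banach)"
  by (auto simp: scaleC_scaleC)

section \<open>Integrals of Banach space valued functions\<close>

text \<open>A quadratic remainder avoids interchanging a limit with an improper contour integral.
  The criterion serves contour integrals with a fixed integrand as well as the semigroup in operator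
  norm.\<close>

lemma has_vector_derivative_quadratic:
  fixes f :: "real \<Rightarrow> 'a::real_normed_vector"
  assumes "d > 0" and "\<And>h. \<bar>h\<bar> \<le> d \<Longrightarrow> norm (f (t + h) - f t - h *\<^sub>R f') \<le> K * h\<^sup>2"
  shows "(f has_vector_derivative f') (at t)"
  unfolding has_vector_derivative_def has_derivative_at
proof (intro conjI)
  show "bounded_linear (\<lambda>x. x *\<^sub>R f')" by (rule bounded_linear_scaleR_left)
  have "((\<lambda>h. \<bar>K\<bar> * \<bar>h\<bar>) \<longlongrightarrow> 0) (at (0::real))"
    by (auto intro!: tendsto_eq_intros)
  moreover have "eventually (\<lambda>h. norm (norm (f (t + h) - f t - h *\<^sub>R f') / norm h) \<le> \<bar>K\<bar> * \<bar>h\<bar>) (at 0)"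
    unfolding eventually_at
  proof (intro exI[of _ d] conjI ballI impI)
    fix h :: real assume h: "h \<noteq> 0 \<and> dist h 0 < d"
    then have "norm (f (t + h) - f t - h *\<^sub>R f') \<le> K * h\<^sup>2" by (intro assms(2)) auto
    also have "\<dots> \<le> \<bar>K\<bar> * h\<^sup>2" by (intro mult_right_mono) auto
    finally show "norm (norm (f (t + h) - f t - h *\<^sub>R f') / norm h) \<le> \<bar>K\<bar> * \<bar>h\<bar>"
      using h by (simp add: divide_le_eq power2_eq_square mult.assoc)
  qed (use assms in auto)
  ultimately show "(\<lambda>h. norm (f (t + h) - f t - h *\<^sub>R f') / norm h) \<midarrow>0\<rightarrow> 0"
    by (rule Lim_null_comparison[rotated])
qed

text \<open>The indefinite integral extends continuously to the right endpoint, so the strong form of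
  the fundamental theorem of calculus applies.\<close>

lemma integrable_bounded_continuous_left:
  fixes f :: "real \<Rightarrow> 'a::banach"
  assumes cont: "continuous_on {a..<b} f" and bd: "\<And>x. x \<in> {a..<b} \<Longrightarrow> norm (f x) \<le> K"
  shows "f integrable_on {a..b}"
proof (cases "a < b")
  case False
  then have "{a..b} = {} \<or> {a..b} = {a}" by auto
  then show ?thesis using integrable_on_empty[of f] integrable_on_refl[of f a] unfolding cbox_interval atLeastAtMost_singleton by metis
next
  case ab: True
  have K: "0 \<le> K" using order_trans[OF norm_ge_zero bd[of a]] ab by auto
  define F where "F x = integral {a..x} f" for x
  have int: "f integrable_on {x..y}" if "a \<le> x" "y < b" for x y
    by (rule integrable_continuous_interval, rule continuous_on_subset[OF cont]) (use that in auto)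
  have lip: "norm (F y - F x) \<le> K * (y - x)" if "a \<le> x" "x \<le> y" "y < b" for x y
  proof -
    have "F y - F x = integral {x..y} f"
      unfolding F_def using Henstock_Kurzweil_Integration.integral_combine[of a x y f] int that by (simp add: algebra_simps)
    also have "norm \<dots> \<le> K * (y - x)"
      by (rule integral_bound) (use that bd in \<open>auto intro: continuous_on_subset[OF cont]\<close>)
    finally show ?thesis .
  qed
  have lip': "norm (F y - F x) \<le> K * \<bar>y - x\<bar>" if "x \<in> {a..<b}" "y \<in> {a..<b}" for x y
    using lip[of x y] lip[of y x] that by (cases "x \<le> y") (auto simp: norm_minus_commute)
  have "uniformly_continuous_on {a..<b} F"
    unfolding uniformly_continuous_on_def
  proof (intro allI impI)
    fix e :: real assume e: "e > 0"
    show "\<exists>d>0. \<forall>x\<in>{a..<b}. \<forall>x'\<in>{a..<b}. dist x' x < d \<longrightarrow> dist (F x') (F x) < e"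
    proof (intro exI[of _ "e / (K + 1)"] conjI ballI impI)
      fix x x' assume x: "x \<in> {a..<b}" "x' \<in> {a..<b}" "dist x' x < e / (K + 1)"
      have "dist (F x') (F x) \<le> K * \<bar>x' - x\<bar>" using lip'[of x x'] x by (simp add: dist_norm)
      also have "\<dots> \<le> (K + 1) * \<bar>x' - x\<bar>" by (intro mult_right_mono) auto
      also have "\<dots> < e" using x K by (simp add: dist_real_def field_simps)
      finally show "dist (F x') (F x) < e" .
    qed (use e K in auto)
  qed
  then obtain G where G: "uniformly_continuous_on (closure {a..<b}) G" "\<And>x. x \<in> {a..<b} \<Longrightarrow> F x = G x"
    using uniformly_continuous_on_extension_on_closure by metis
  have "continuous_on {a..b} G"
    using uniformly_continuous_imp_continuous[OF G(1)] ab by simp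
  moreover have "(G has_vector_derivative f x) (at x)" if x: "x \<in> {a<..<b}" for x
  proof -
    obtain y where y: "x < y" "y < b" using x dense by auto
    have "continuous_on {a..y} f" by (rule continuous_on_subset[OF cont]) (use y in auto)
    then have "(F has_vector_derivative f x) (at x within {a..y})"
      unfolding F_def by (rule integral_has_vector_derivative) (use x y in auto)
    then have "(F has_vector_derivative f x) (at x within {a<..<y})"
      by (rule has_vector_derivative_within_subset) auto
    then have "(F has_vector_derivative f x) (at x)" using x y at_within_open[of x "{a<..<y}"] by simp
    then show ?thesis
      by (rule has_vector_derivative_transform_within_open[of _ _ _ "{a<..<b}"]) (use x G in auto)
  qed
  ultimately have "(f has_integral (G b - G a)) {a..b}"
    using ab by (intro fundamental_theorem_of_calculus_interior) auto
  then show ?thesis by blast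
qed

lemma tendsto_exp_decay:
  fixes c C :: real
  assumes c: "c > 0"
  shows "((\<lambda>x. C * exp (- c * x)) \<longlongrightarrow> 0) at_top"
proof -
  have "((\<lambda>x. exp (- (c * x))) \<longlongrightarrow> 0) at_top"
    by (rule filterlim_compose[OF exp_at_bot], rule filterlim_compose[OF filterlim_uminus_at_bot_at_top],
        rule filterlim_tendsto_pos_mult_at_top[OF tendsto_const c filterlim_ident])
  from tendsto_mult[OF tendsto_const[of C] this] show ?thesis by simp
qed

text \<open>The majorant has an explicit primitive, so the tail beyond \<open>x\<close> is at most
  \<open>C / c * exp (- c * x)\<close>. This makes the truncated integrals Cauchy; the bound for
  \<open>L\<close> is the tail estimate at \<open>x = r\<close>.\<close>

lemma has_integral_exp_decay:
  fixes f :: "real \<Rightarrow> 'a::banach"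
  assumes cont: "continuous_on {r..} f" and c: "c > 0"
    and bd: "\<And>x. x \<ge> r \<Longrightarrow> norm (f x) \<le> C * exp (- c * x)"
  obtains L where "(f has_integral L) {r..}" "((\<lambda>R. integral {r..R} f) \<longlongrightarrow> L) at_top"
    "norm L \<le> C / c * exp (- c * r)"
proof -
  have C: "0 \<le> C" using order_trans[OF norm_ge_zero bd[of r]] by (simp add: zero_le_mult_iff)
  define F where "F x = integral {r..x} f" for x
  have int: "f integrable_on {x..y}" if "r \<le> x" for x y
    by (rule integrable_continuous_interval, rule continuous_on_subset[OF cont]) (use that in auto)
  have inte: "((\<lambda>x. C * exp (- c * x)) has_integral (C / c * (exp (- c * x) - exp (- c * y)))) {x..y}"
    if "x \<le> y" for x y
  proof -
    have "((\<lambda>x. C * exp (- c * x)) has_integral (- C / c * exp (- c * y) - (- C / c * exp (- c * x)))) {x..y}"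
      by (rule fundamental_theorem_of_calculus[OF that], unfold has_real_derivative_iff_has_vector_derivative[symmetric])
         (use c in \<open>auto intro!: derivative_eq_intros\<close>)
    then show ?thesis by (simp add: algebra_simps)
  qed
  have diff: "norm (F y - F x) \<le> C / c * exp (- c * x)" if "r \<le> x" "x \<le> y" for x y
  proof -
    have "F y - F x = integral {x..y} f"
      unfolding F_def using Henstock_Kurzweil_Integration.integral_combine[of r x y f] int that by (simp add: algebra_simps)
    also have "norm \<dots> \<le> integral {x..y} (\<lambda>x. C * exp (- c * x))"
      by (rule integral_norm_bound_integral) (use that bd int has_integral_integrable[OF inte] in auto)
    also have "\<dots> = C / c * (exp (- c * x) - exp (- c * y))"
      using integral_unique[OF inte[OF that(2)]] by simp
    also have "\<dots> \<le> C / c * exp (- c * x)" using C c by (intro mult_left_mono) auto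
    finally show ?thesis .
  qed
  note lim0 = tendsto_exp_decay[OF c, of "C / c"]
  have "cauchy_filter (filtermap F at_top)"
    unfolding cauchy_filter_metric_filtermap
  proof (intro allI impI)
    fix e :: real assume e: "e > 0"
    have "eventually (\<lambda>x. C / c * exp (- c * x) < e / 2 \<and> x \<ge> r) at_top"
      using order_tendstoD(2)[OF lim0, of "e/2"] e eventually_ge_at_top by (auto intro: eventually_conj)
    then obtain N where N: "\<And>x. x \<ge> N \<Longrightarrow> C / c * exp (- c * x) < e / 2 \<and> x \<ge> r"
      by (auto simp: eventually_at_top_linorder)
    show "\<exists>P. eventually P at_top \<and> (\<forall>x y. P x \<and> P y \<longrightarrow> dist (F x) (F y) < e)"
    proof (intro exI[of _ "\<lambda>x. x \<ge> N"] conjI allI impI eventually_ge_at_top)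
      fix x y assume "N \<le> x \<and> N \<le> y"
      then have "dist (F x) (F N) < e / 2" "dist (F y) (F N) < e / 2"
        using diff[of N x] diff[of N y] N[of N] unfolding dist_norm by linarith+
      then show "dist (F x) (F y) < e" by (metis dist_triangle_half_l dist_commute)
    qed
  qed
  then obtain L where L: "(F \<longlongrightarrow> L) at_top"
    using cauchy_filter_complete_converges[of "filtermap F at_top" UNIV]
    by (auto simp: filterlim_def complete_UNIV filtermap_bot_iff)
  have tail: "norm (L - F x) \<le> C / c * exp (- c * x)" if "x \<ge> r" for x
  proof (rule tendsto_upperbound)
    show "((\<lambda>y. norm (F y - F x)) \<longlongrightarrow> norm (L - F x)) at_top" by (intro tendsto_intros L)
    show "eventually (\<lambda>y. norm (F y - F x) \<le> C / c * exp (- c * x)) at_top"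
      using eventually_ge_at_top[of x] by eventually_elim (use diff that in auto)
  qed auto
  have "(f has_integral L) {r..}"
    unfolding has_integral_alt'
  proof (intro conjI allI impI)
    have I: "((\<lambda>x. if x \<in> {r..} then f x else 0) has_integral (integral {max a r..b} f)) (cbox a b)" for a b :: real
    proof -
      have "{r..} \<inter> cbox a b = {max a r..b}" by auto
      then have "(f has_integral (integral {max a r..b} f)) ({r..} \<inter> cbox a b)"
        by (metis int integrable_integral max.cobounded2)
      then show ?thesis by (subst has_integral_restrict_Int)
    qed
    show "(\<lambda>x. if x \<in> {r..} then f x else 0) integrable_on cbox a b" for a b using has_integral_integrable[OF I] .
    fix e :: real assume e: "e > 0"
    have "eventually (\<lambda>x. C / c * exp (- c * x) < e \<and> x \<ge> r) at_top"
      using order_tendstoD(2)[OF lim0, of "e"] e eventually_ge_at_top by (auto intro: eventually_conj)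
    then obtain N where N: "\<And>x. x \<ge> N \<Longrightarrow> C / c * exp (- c * x) < e \<and> x \<ge> r"
      by (auto simp: eventually_at_top_linorder)
    show "\<exists>B>0. \<forall>a b. ball 0 B \<subseteq> cbox a b \<longrightarrow>
            norm (integral (cbox a b) (\<lambda>x. if x \<in> {r..} then f x else 0) - L) < e"
    \<comment> \<open>A ball of this radius contains \<open>\<bar>N\<bar> + \<bar>r\<bar>\<close>
      and its negative, so every box around it starts left of \<open>r\<close> and ends beyond both
      \<open>N\<close> and \<open>r\<close>.\<close>
    proof (intro exI[of _ "\<bar>N\<bar> + \<bar>r\<bar> + 1"] conjI allI impI)
      fix a b :: real assume ab: "ball 0 (\<bar>N\<bar> + \<bar>r\<bar> + 1) \<subseteq> cbox a b"
      have "\<bar>N\<bar> + \<bar>r\<bar> \<in> ball 0 (\<bar>N\<bar> + \<bar>r\<bar> + 1)" "- \<bar>N\<bar> - \<bar>r\<bar> \<in> ball 0 (\<bar>N\<bar> + \<bar>r\<bar> + 1)" by auto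
      then have "a \<le> r" "N \<le> b" "r \<le> b" using ab by (force simp del: mem_ball)+
      then show "norm (integral (cbox a b) (\<lambda>x. if x \<in> {r..} then f x else 0) - L) < e"
        using I[of a b] tail[of b] N[of b] by (auto simp: F_def integral_unique max_def norm_minus_commute
          split: if_splits)
    qed auto
  qed
  moreover have "norm L \<le> C / c * exp (- c * r)" using tail[of r] by (simp add: F_def)
  ultimately show ?thesis using L that by (auto simp: F_def[abs_def])
qed

section \<open>Integrals along Hankel contours\<close>

text \<open>The contour of the Dunford integral translated to be centred at 0; the shift by
  \<open>\<omega>\<close> is put into \<open>exp_shift\<close> and \<open>res\<close>
  instead.\<close>

definition hankel_contour :: "real \<Rightarrow> real \<Rightarrow> complex set" where
  "hankel_contour r \<eta> =
     {of_real \<rho> * cis v |\<rho> v. r \<le> \<rho> \<and> \<bar>v\<bar> = \<eta>} \<union> {of_real r * cis v |v. \<bar>v\<bar> \<le> \<eta>}"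

definition hankel_arc :: "real \<Rightarrow> real \<Rightarrow> (complex \<Rightarrow> 'a::complex_banach) \<Rightarrow> 'a" where
  "hankel_arc r \<eta> F = integral {- \<eta>..\<eta>} (\<lambda>v. (\<i> * of_real r * cis v) *\<^sub>C F (of_real r * cis v))"

definition hankel_ray :: "real \<Rightarrow> real \<Rightarrow> (complex \<Rightarrow> 'a::complex_banach) \<Rightarrow> 'a" where
  "hankel_ray r \<eta> F = integral {r..} (\<lambda>\<rho>. cis \<eta> *\<^sub>C F (of_real \<rho> * cis \<eta>))"

definition hankel :: "real \<Rightarrow> real \<Rightarrow> (complex \<Rightarrow> 'a::complex_banach) \<Rightarrow> 'a" where
  "hankel r \<eta> F = (1 / (2 * of_real pi * \<i>)) *\<^sub>C
     (- hankel_ray r (- \<eta>) F + hankel_arc r \<eta> F + hankel_ray r \<eta> F)"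

text \<open>The rate \<open>c\<close> and the size \<open>C\<close> are kept as parameters because
  they determine the bound of the contour integral, in particular its behaviour for small
  times.\<close>

definition hankel_decay :: "real \<Rightarrow> real \<Rightarrow> real \<Rightarrow> real \<Rightarrow> (complex \<Rightarrow> 'a::complex_banach) \<Rightarrow> bool" where
  "hankel_decay r \<eta> c C F \<longleftrightarrow> 0 < c \<and> continuous_on (hankel_contour r \<eta>) F \<and>
     (\<forall>z\<in>hankel_contour r \<eta>. norm (F z) \<le> C * exp (- c * cmod z))"

text \<open>The rays of the contours lie on the boundary of this set, which is why derivatives are
  taken within it.\<close>

definition closed_sector :: "real \<Rightarrow> complex set" where
  "closed_sector \<eta> = {of_real \<rho> * cis v |\<rho> v. 0 < \<rho> \<and> \<bar>v\<bar> \<le> \<eta>}"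

section \<open>Estimates and linearity of contour integrals\<close>

lemma hankel_contour_subset: "0 < r \<Longrightarrow> hankel_contour r \<eta> \<subseteq> closed_sector \<eta>"
  unfolding hankel_contour_def closed_sector_def by force

lemma hankel_contour_rayI: "r \<le> \<rho> \<Longrightarrow> \<bar>v\<bar> = \<eta> \<Longrightarrow> of_real \<rho> * cis v \<in> hankel_contour r \<eta>"
  and hankel_contour_arcI: "\<bar>v\<bar> \<le> \<eta> \<Longrightarrow> of_real r * cis v \<in> hankel_contour r \<eta>"
  unfolding hankel_contour_def by blast+

lemma closed_sectorI: "0 < \<rho> \<Longrightarrow> \<bar>v\<bar> \<le> \<eta> \<Longrightarrow> of_real \<rho> * cis v \<in> closed_sector \<eta>"
  unfolding closed_sector_def by blast

lemma closed_sector_nonzero: "z \<in> closed_sector \<eta> \<Longrightarrow> z \<noteq> 0"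
  by (auto simp: closed_sector_def)

lemma hankel_contour_norm_ge: "0 < r \<Longrightarrow> z \<in> hankel_contour r \<eta> \<Longrightarrow> r \<le> cmod z"
  by (auto simp: hankel_contour_def norm_mult)

lemma continuous_on_ray:
  assumes "continuous_on (hankel_contour r \<eta>) F" "\<bar>v\<bar> = \<eta>"
  shows "continuous_on {r..} (\<lambda>\<rho>. cis v *\<^sub>C F (of_real \<rho> * cis v))"
  by (intro continuous_intros continuous_on_compose2[OF assms(1)])
     (use assms in \<open>auto intro: hankel_contour_rayI\<close>)

lemma continuous_on_arc:
  assumes "continuous_on (hankel_contour r \<eta>) F"
  shows "continuous_on {-\<eta>..\<eta>} (\<lambda>v. (\<i> * of_real r * cis v) *\<^sub>C F (of_real r * cis v))"
  by (intro continuous_intros continuous_on_compose2[OF assms(1)])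
     (auto intro!: hankel_contour_arcI)

lemma hankel_ray_has_integral:
  assumes "hankel_decay r \<eta> c C F" "0 < r" "\<bar>v\<bar> = \<eta>"
  shows "((\<lambda>\<rho>. cis v *\<^sub>C F (of_real \<rho> * cis v)) has_integral hankel_ray r v F) {r..}"
    and "norm (hankel_ray r v F) \<le> C / c * exp (- c * r)"
proof -
  have "norm (cis v *\<^sub>C F (of_real \<rho> * cis v)) \<le> C * exp (- c * \<rho>)" if "r \<le> \<rho>" for \<rho>
  proof -
    have "of_real \<rho> * cis v \<in> hankel_contour r \<eta>" using that assms by (intro hankel_contour_rayI)
    then have "norm (F (of_real \<rho> * cis v)) \<le> C * exp (- c * cmod (of_real \<rho> * cis v))"
      using assms unfolding hankel_decay_def by blast
    then show ?thesis using that assms by (simp add: norm_scaleC norm_mult)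
  qed
  moreover have "continuous_on {r..} (\<lambda>\<rho>. cis v *\<^sub>C F (of_real \<rho> * cis v))"
    using assms by (intro continuous_on_ray) (auto simp: hankel_decay_def)
  ultimately obtain L where "((\<lambda>\<rho>. cis v *\<^sub>C F (of_real \<rho> * cis v)) has_integral L) {r..}"
    "norm L \<le> C / c * exp (- c * r)"
    using has_integral_exp_decay[of r "\<lambda>\<rho>. cis v *\<^sub>C F (of_real \<rho> * cis v)" c C] assms
    by (metis hankel_decay_def)
  moreover from this have "hankel_ray r v F = L" by (simp add: hankel_ray_def integral_unique)
  ultimately show "((\<lambda>\<rho>. cis v *\<^sub>C F (of_real \<rho> * cis v)) has_integral hankel_ray r v F) {r..}"
    and "norm (hankel_ray r v F) \<le> C / c * exp (- c * r)" by auto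
qed

lemma hankel_arc_has_integral:
  assumes "continuous_on (hankel_contour r \<eta>) F"
  shows "((\<lambda>v. (\<i> * of_real r * cis v) *\<^sub>C F (of_real r * cis v)) has_integral hankel_arc r \<eta> F) {-\<eta>..\<eta>}"
  unfolding hankel_arc_def
  by (intro integrable_integral integrable_continuous_interval continuous_on_arc assms)

text \<open>Each ray contributes at most \<open>C / c\<close> and the arc at most
  \<open>2 * r * \<eta> * C\<close>; the prefactor \<open>1 / (2 * pi)\<close> absorbs the constants
  because \<open>\<eta> < pi\<close>.\<close>

lemma norm_hankel_le:
  assumes F: "hankel_decay r \<eta> c C F" and r: "0 < r" and \<eta>: "0 < \<eta>" "\<eta> < pi"
  shows "norm (hankel r \<eta> F) \<le> C * (1 / c + r)"
proof -
  have c: "c > 0" using F by (auto simp: hankel_decay_def)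
  have "of_real r * cis 0 \<in> hankel_contour r \<eta>" using \<eta> by (intro hankel_contour_arcI) auto
  then have "norm (F (of_real r * cis 0)) \<le> C * exp (- c * cmod (of_real r * cis 0))"
    using F unfolding hankel_decay_def by blast
  from order_trans[OF norm_ge_zero this] have C: "0 \<le> C" by (simp add: zero_le_mult_iff)
  have e: "C / c * exp (- c * r) \<le> C / c"
    using c r C mult_left_mono[of "exp (- c * r)" 1 "C / c"] by simp
  have "norm (hankel_arc r \<eta> F) \<le> (r * C) * (\<eta> - - \<eta>)"
    unfolding hankel_arc_def
  proof (rule integral_bound)
    show "continuous_on {-\<eta>..\<eta>} (\<lambda>v. (\<i> * of_real r * cis v) *\<^sub>C F (of_real r * cis v))"
      using F by (intro continuous_on_arc) (auto simp: hankel_decay_def)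
    fix v assume v: "v \<in> {-\<eta>..\<eta>}"
    then have "of_real r * cis v \<in> hankel_contour r \<eta>" by (intro hankel_contour_arcI) auto
    then have "norm (F (of_real r * cis v)) \<le> C * exp (- c * cmod (of_real r * cis v))"
      using F unfolding hankel_decay_def by blast
    also have "\<dots> \<le> C * 1" using C c r by (intro mult_left_mono) (auto simp: norm_mult)
    finally show "norm ((\<i> * of_real r * cis v) *\<^sub>C F (of_real r * cis v)) \<le> r * C"
      using r by (simp add: norm_scaleC norm_mult)
  qed (use \<eta> in auto)
  moreover have "norm (hankel_ray r (- \<eta>) F) \<le> C / c" "norm (hankel_ray r \<eta> F) \<le> C / c"
    using hankel_ray_has_integral(2)[OF F r, of \<eta>] hankel_ray_has_integral(2)[OF F r, of "-\<eta>"] e \<eta> by auto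
  ultimately have "norm (- hankel_ray r (- \<eta>) F + hankel_arc r \<eta> F + hankel_ray r \<eta> F) \<le> C / c + 2 * r * C * \<eta> + C / c"
    by (intro order_trans[OF norm_triangle_ineq] add_mono) auto
  also have "\<dots> \<le> 2 * pi * (C * (1 / c + r))"
  proof -
    have "C / c * 1 \<le> C / c * pi" using C c pi_ge_two by (intro mult_left_mono) auto
    moreover have "(2 * r * C) * \<eta> \<le> (2 * r * C) * pi" using C r \<eta> by (intro mult_left_mono) auto
    moreover have "C / c \<le> C / c * pi" using C c pi_ge_two mult_left_mono[of 1 pi "C / c"] by simp
    ultimately have "C / c + 2 * r * C * \<eta> + C / c \<le> C / c * pi + (2 * r * C) * pi + C / c * pi"
      by linarith
    also have "\<dots> = 2 * pi * (C * (1 / c + r))" by (simp add: algebra_simps)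
    finally show ?thesis .
  qed
  finally have "norm (- hankel_ray r (- \<eta>) F + hankel_arc r \<eta> F + hankel_ray r \<eta> F) / (2 * pi) \<le> C * (1 / c + r)"
    by (simp add: divide_le_eq mult.commute)
  then show ?thesis
    by (simp add: hankel_def norm_scaleC norm_divide norm_mult)
qed

text \<open>Used to pull scalars and, above all, resolvents through the contour integral; the
  unbounded operator itself is handled through its resolvent.\<close>

lemma hankel_bounded_linear:
  assumes F: "hankel_decay r \<eta> c C F" and r: "0 < r" and \<eta>: "0 < \<eta>"
    and L: "bounded_linear L" and LC: "\<And>a x. L (a *\<^sub>C x) = a *\<^sub>C L x"
  shows "L (hankel r \<eta> F) = hankel r \<eta> (\<lambda>z. L (F z))"
proof -
  have ray: "L (hankel_ray r v F) = hankel_ray r v (\<lambda>z. L (F z))" if "\<bar>v\<bar> = \<eta>" for v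
    using has_integral_linear[OF hankel_ray_has_integral(1)[OF F r that] L]
    by (simp add: hankel_ray_def[of _ _ "\<lambda>z. L (F z)"] o_def LC integral_unique)
  have arc: "L (hankel_arc r \<eta> F) = hankel_arc r \<eta> (\<lambda>z. L (F z))"
    using has_integral_linear[OF hankel_arc_has_integral[of r \<eta> F] L] F
    by (simp add: hankel_arc_def[of _ _ "\<lambda>z. L (F z)"] o_def LC integral_unique hankel_decay_def)
  interpret L: bounded_linear L by (rule L)
  show ?thesis using \<eta> by (simp add: hankel_def LC L.add L.diff linear_neg[OF L.linear] ray arc)
qed

lemma hankel_add:
  assumes F: "hankel_decay r \<eta> c C F" "hankel_decay r \<eta> c' C' G" and r: "0 < r" and \<eta>: "0 < \<eta>"
  shows "hankel r \<eta> (\<lambda>z. F z + G z) = hankel r \<eta> F + hankel r \<eta> G"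
proof -
  have ray: "hankel_ray r v (\<lambda>z. F z + G z) = hankel_ray r v F + hankel_ray r v G" if "\<bar>v\<bar> = \<eta>" for v
    using has_integral_add[OF hankel_ray_has_integral(1)[OF F(1) r that] hankel_ray_has_integral(1)[OF F(2) r that]]
    by (simp add: hankel_ray_def[of _ _ "\<lambda>z. F z + G z"] integral_unique scaleC_add_right)
  have arc: "hankel_arc r \<eta> (\<lambda>z. F z + G z) = hankel_arc r \<eta> F + hankel_arc r \<eta> G"
    using has_integral_add[OF hankel_arc_has_integral[of r \<eta> F] hankel_arc_has_integral[of r \<eta> G]] F
    by (simp add: hankel_arc_def[of _ _ "\<lambda>z. F z + G z"] integral_unique hankel_decay_def scaleC_add_right)
  show ?thesis using \<eta>
    by (simp add: hankel_def ray arc algebra_simps flip: scaleC_add_right)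
qed

lemma hankel_scaleC:
  assumes F: "hankel_decay r \<eta> c C F" and r: "0 < r" and \<eta>: "0 < \<eta>"
  shows "hankel r \<eta> (\<lambda>z. a *\<^sub>C F z) = a *\<^sub>C hankel r \<eta> F"
  by (rule hankel_bounded_linear[OF assms bounded_linear_scaleC, symmetric])
     (simp add: scaleC_scaleC mult.commute)

lemma hankel_decay_add:
  assumes "hankel_decay r \<eta> c C F" "hankel_decay r \<eta> c C' G"
  shows "hankel_decay r \<eta> c (C + C') (\<lambda>z. F z + G z)"
  using assms unfolding hankel_decay_def
  by (auto intro!: continuous_intros norm_triangle_le add_mono simp: algebra_simps)

lemma hankel_cong:
  assumes "\<And>z. z \<in> hankel_contour r \<eta> \<Longrightarrow> F z = G z" "0 < \<eta>"
  shows "hankel r \<eta> F = hankel r \<eta> G"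
proof -
  have ray: "hankel_ray r v F = hankel_ray r v G" if "\<bar>v\<bar> = \<eta>" for v
    unfolding hankel_ray_def
    by (intro integral_cong arg_cong2[of _ _ _ _ scaleC] refl assms) (use that in \<open>auto intro: hankel_contour_rayI\<close>)
  have arc: "hankel_arc r \<eta> F = hankel_arc r \<eta> G"
    unfolding hankel_arc_def
    by (intro integral_cong arg_cong2[of _ _ _ _ scaleC] refl assms) (auto intro!: hankel_contour_arcI)
  show ?thesis unfolding hankel_def using assms by (simp add: ray arc)
qed

text \<open>With \<open>\<gamma>(\<rho>,v) = \<rho> e\<^sup>i\<^sup>v\<close> one has
  \<open>\<partial>\<^sub>\<rho> (i \<rho> e\<^sup>i\<^sup>v F(\<gamma>)) = \<partial>\<^sub>v (e\<^sup>i\<^sup>v F(\<gamma>))\<close>; this is Cauchy's theorem in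
  polar coordinates.\<close>

lemma hankel_arc_has_vector_derivative:
  assumes F: "\<And>z. z \<in> closed_sector \<eta> \<Longrightarrow>
      (F has_derivative (\<lambda>h. h *\<^sub>C F' z)) (at z within closed_sector \<eta>)"
    and F': "continuous_on (closed_sector \<eta>) F'" and r: "0 < r" and \<eta>: "0 < \<eta>"
  shows "((\<lambda>r. hankel_arc r \<eta> F) has_vector_derivative
     (cis \<eta> *\<^sub>C F (of_real r * cis \<eta>) - cis (- \<eta>) *\<^sub>C F (of_real r * cis (- \<eta>)))) (at r within {0<..})"
proof -
  define fx where "fx \<rho> v = (\<i> * cis v) *\<^sub>C F (of_real \<rho> * cis v)
      + (\<i> * of_real \<rho> * cis v * cis v) *\<^sub>C F' (of_real \<rho> * cis v)" for \<rho> v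
  have contF: "continuous_on (closed_sector \<eta>) F"
    by (rule has_derivative_continuous_on[OF F])
  have chain: "((\<lambda>x. F (g x)) has_vector_derivative g' *\<^sub>C F' (g x)) (at x within U)"
    if "(g has_vector_derivative g') (at x within U)" "g ` U \<subseteq> closed_sector \<eta>" "x \<in> U" for g g' x U
  proof -
    have "(F has_derivative (\<lambda>h. h *\<^sub>C F' (g x))) (at (g x) within g ` U)"
      by (rule has_derivative_subset[OF F]) (use that in auto)
    from has_derivative_in_compose[OF that(1)[unfolded has_vector_derivative_def] this]
    show ?thesis unfolding has_vector_derivative_def
      by (simp add: bounded_bilinear.scaleR_left[OF bounded_bilinear_scaleC])
  qed
  have cis': "(cis has_vector_derivative \<i> * cis v) (at v within U)" for v U
    unfolding has_vector_derivative_def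
    using has_derivative_cis[of "\<lambda>x. x" "\<lambda>x. x" v U, OF has_derivative_ident] by (simp add: mult.assoc)
  have "((\<lambda>r. integral (cbox (-\<eta>) \<eta>) (\<lambda>v. (\<i> * of_real r * cis v) *\<^sub>C F (of_real r * cis v)))
     has_vector_derivative integral (cbox (-\<eta>) \<eta>) (fx r)) (at r within {0<..})"
  proof (rule leibniz_rule_vector_derivative)
    fix \<rho> v :: real assume *: "\<rho> \<in> {0<..}" "v \<in> cbox (-\<eta>) \<eta>"
    have "((\<lambda>\<rho>. of_real \<rho> * cis v) has_vector_derivative cis v) (at \<rho> within {0<..})"
      by (auto intro!: derivative_eq_intros simp: has_vector_derivative_def scaleR_conv_of_real)
    then have 1: "((\<lambda>\<rho>. F (of_real \<rho> * cis v)) has_vector_derivative cis v *\<^sub>C F' (of_real \<rho> * cis v)) (at \<rho> within {0<..})"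
      by (rule chain) (use * in \<open>force simp: closed_sector_def\<close>)+
    have 2: "((\<lambda>\<rho>. \<i> * of_real \<rho> * cis v) has_vector_derivative \<i> * cis v) (at \<rho> within {0<..})"
      by (auto intro!: derivative_eq_intros simp: has_vector_derivative_def scaleR_conv_of_real)
    show "((\<lambda>\<rho>. (\<i> * of_real \<rho> * cis v) *\<^sub>C F (of_real \<rho> * cis v)) has_vector_derivative fx \<rho> v) (at \<rho> within {0<..})"
      using bounded_bilinear.has_vector_derivative[OF bounded_bilinear_scaleC 2 1]
      by (simp add: fx_def scaleC_scaleC add.commute)
  next
    fix \<rho> :: real assume "\<rho> \<in> {0<..}"
    then show "(\<lambda>v. (\<i> * of_real \<rho> * cis v) *\<^sub>C F (of_real \<rho> * cis v)) integrable_on cbox (-\<eta>) \<eta>"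
      using continuous_on_arc[OF continuous_on_subset[OF contF hankel_contour_subset]]
      by (intro integrable_continuous) auto
  next
    show "continuous_on ({0<..} \<times> cbox (-\<eta>) \<eta>) (\<lambda>(\<rho>, v). fx \<rho> v)"
      unfolding fx_def split_beta
      by (intro continuous_intros continuous_on_compose2[OF contF] continuous_on_compose2[OF F'])
         (auto intro!: closed_sectorI)
  qed (use r in auto)
  moreover have "(fx r has_integral
      (cis \<eta> *\<^sub>C F (of_real r * cis \<eta>) - cis (- \<eta>) *\<^sub>C F (of_real r * cis (- \<eta>)))) {-\<eta>..\<eta>}"
  proof (rule fundamental_theorem_of_calculus)
    fix v assume v: "v \<in> {-\<eta>..\<eta>}"
    have "((\<lambda>v. of_real r * cis v) has_vector_derivative of_real r * (\<i> * cis v)) (at v within {-\<eta>..\<eta>})"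
      by (rule has_vector_derivative_mult_right[OF cis'])
    then have 1: "((\<lambda>v. F (of_real r * cis v)) has_vector_derivative (of_real r * (\<i> * cis v)) *\<^sub>C F' (of_real r * cis v))
        (at v within {-\<eta>..\<eta>})"
      by (rule chain) (use v r in \<open>auto intro!: closed_sectorI\<close>)
    show "((\<lambda>v. cis v *\<^sub>C F (of_real r * cis v)) has_vector_derivative fx r v) (at v within {-\<eta>..\<eta>})"
      using bounded_bilinear.has_vector_derivative[OF bounded_bilinear_scaleC cis' 1]
      by (simp add: fx_def scaleC_scaleC add.commute mult_ac)
  qed (use \<eta> in auto)
  ultimately show ?thesis by (simp add: hankel_arc_def integral_unique)
qed

text \<open>Enlarging the radius removes the piece over \<open>{r..R}\<close> from both rays;
  integrating the derivative of the arc over \<open>{r..R}\<close> returns exactly these two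
  pieces.\<close>

lemma hankel_radius_mono:
  assumes F: "\<And>z. z \<in> closed_sector \<eta> \<Longrightarrow>
      (F has_derivative (\<lambda>h. h *\<^sub>C F' z)) (at z within closed_sector \<eta>)"
    and F': "continuous_on (closed_sector \<eta>) F'" and r: "0 < r" "r \<le> R" and \<eta>: "0 < \<eta>"
    and dec: "hankel_decay r \<eta> c C F" "hankel_decay R \<eta> c' C' F"
  shows "hankel r \<eta> F = hankel R \<eta> F"
proof -
  have contF: "continuous_on (closed_sector \<eta>) F"
    by (rule has_derivative_continuous_on[OF F])
  define q where "q v \<rho> = cis v *\<^sub>C F (of_real \<rho> * cis v)" for v \<rho>
  have ray: "hankel_ray r v F = integral {r..R} (q v) + hankel_ray R v F"
    and int: "q v integrable_on {r..R}" if v: "\<bar>v\<bar> = \<eta>" for v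
  proof -
    have "continuous_on {r..} (q v)"
      unfolding q_def using dec(1) v by (intro continuous_on_ray) (auto simp: hankel_decay_def)
    then show int: "q v integrable_on {r..R}"
      by (intro integrable_continuous_interval) (auto elim: continuous_on_subset)
    have "(q v has_integral (integral {r..R} (q v) + hankel_ray R v F)) ({r..R} \<union> {R..})"
      unfolding q_def[abs_def]
      by (intro has_integral_Un integrable_integral int[unfolded q_def[abs_def]]
          hankel_ray_has_integral(1)[OF dec(2) _ v])
         (use r in auto)
    moreover have "{r..R} \<union> {R..} = {r..}" using r by auto
    ultimately show "hankel_ray r v F = integral {r..R} (q v) + hankel_ray R v F"
      by (simp add: hankel_ray_def[of r] q_def[abs_def] integral_unique)
  qed
  have "((\<lambda>\<rho>. q \<eta> \<rho> - q (- \<eta>) \<rho>) has_integral (hankel_arc R \<eta> F - hankel_arc r \<eta> F)) {r..R}"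
  proof (rule fundamental_theorem_of_calculus[OF r(2)])
    fix \<rho> assume "\<rho> \<in> {r..R}"
    then show "((\<lambda>\<rho>. hankel_arc \<rho> \<eta> F) has_vector_derivative q \<eta> \<rho> - q (- \<eta>) \<rho>) (at \<rho> within {r..R})"
      unfolding q_def using r
      by (intro has_vector_derivative_within_subset[OF hankel_arc_has_vector_derivative[OF F F' _ \<eta>]]) auto
  qed
  moreover have "((\<lambda>\<rho>. q \<eta> \<rho> - q (- \<eta>) \<rho>) has_integral (integral {r..R} (q \<eta>) - integral {r..R} (q (- \<eta>)))) {r..R}"
    using \<eta> by (intro has_integral_diff integrable_integral int) auto
  ultimately have "hankel_arc R \<eta> F - hankel_arc r \<eta> F = integral {r..R} (q \<eta>) - integral {r..R} (q (- \<eta>))"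
    by (rule has_integral_unique)
  then have arc: "hankel_arc R \<eta> F = hankel_arc r \<eta> F + integral {r..R} (q \<eta>) - integral {r..R} (q (- \<eta>))"
    by (simp add: algebra_simps)
  show ?thesis unfolding hankel_def arc using ray[of \<eta>] ray[of "-\<eta>"] \<eta> by (simp add: algebra_simps)
qed

lemma hankel_radius:
  assumes "\<And>z. z \<in> closed_sector \<eta> \<Longrightarrow>
      (F has_derivative (\<lambda>h. h *\<^sub>C F' z)) (at z within closed_sector \<eta>)"
    and "continuous_on (closed_sector \<eta>) F'" and "0 < r" "0 < R" and "0 < \<eta>"
    and dec: "hankel_decay r \<eta> c C F" "hankel_decay R \<eta> c' C' F"
  shows "hankel r \<eta> F = hankel R \<eta> F"
proof (cases "r \<le> R")
  case True then show ?thesis by (intro hankel_radius_mono[OF assms(1,2,3) _ assms(5) dec]) auto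
next
  case False then show ?thesis
    by (intro hankel_radius_mono[OF assms(1,2,4) _ assms(5) dec(2,1), symmetric]) auto
qed

lemma hankel_contour_Re_le:
  assumes "z \<in> hankel_contour r \<eta>" "0 < r" "pi / 2 < \<eta>" "\<eta> < pi"
  shows "Re z \<le> 2 * r + cos \<eta> * cmod z"
proof -
  have c: "cos \<eta> \<le> 0" "-1 \<le> cos \<eta>" using cos_monotone_0_pi[of "pi/2" \<eta>] assms by auto
  consider \<rho> v where "z = of_real \<rho> * cis v" "r \<le> \<rho>" "v = \<eta> \<or> v = - \<eta>" | v where "z = of_real r * cis v"
    using assms(1) by (auto simp: hankel_contour_def abs_eq_iff' split: if_splits)
  then show ?thesis
  proof cases
    case 1 then show ?thesis using assms by (auto simp: norm_mult)
  next
    case 2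
    have "r * cos v \<le> r * 1" "r * (- 1) \<le> r * cos \<eta>" using assms c by (intro mult_left_mono; auto)+
    moreover have "Re z = r * cos v" "cmod z = r" using 2 assms by (auto simp: norm_mult)
    ultimately show ?thesis by (simp add: mult.commute)
  qed
qed

text \<open>The rate \<open>- cos \<eta> * t\<close> degenerates as \<open>t\<close> tends to 0,
  which is the origin of every factor \<open>1 / t\<close> in the bounds below.\<close>

lemma hankel_decay_exp:
  assumes G: "continuous_on (hankel_contour r \<eta>) G" "\<And>z. z \<in> hankel_contour r \<eta> \<Longrightarrow> norm (G z) \<le> K"
    and r: "0 < r" and \<eta>: "pi / 2 < \<eta>" "\<eta> < pi" and t: "0 < t"
  shows "hankel_decay r \<eta> (- cos \<eta> * t) (K * exp (t * (\<omega> + 2 * r)))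
     (\<lambda>z. exp (of_real t * (of_real \<omega> + z)) *\<^sub>C G z)"
  unfolding hankel_decay_def
proof (intro conjI ballI)
  have "cos \<eta> < 0" using cos_monotone_0_pi[of "pi/2" \<eta>] \<eta> by auto
  then show "0 < - cos \<eta> * t" using t by (simp add: mult_neg_pos)
  show "continuous_on (hankel_contour r \<eta>) (\<lambda>z. exp (of_real t * (of_real \<omega> + z)) *\<^sub>C G z)"
    by (intro continuous_intros G)
  fix z assume z: "z \<in> hankel_contour r \<eta>"
  have "norm (exp (of_real t * (of_real \<omega> + z)) *\<^sub>C G z) = exp (t * (\<omega> + Re z)) * norm (G z)"
    by (simp add: norm_scaleC)
  also have "\<dots> \<le> exp (t * (\<omega> + (2 * r + cos \<eta> * cmod z))) * K"
    using z G(2)[OF z] hankel_contour_Re_le[OF z r \<eta>] t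
    by (intro mult_mono) auto
  also have "\<dots> = K * exp (t * (\<omega> + 2 * r)) * exp (- (- cos \<eta> * t) * cmod z)"
    by (simp add: algebra_simps flip: exp_add)
  finally show "norm (exp (of_real t * (of_real \<omega> + z)) *\<^sub>C G z) \<le> \<dots>" .
qed

text \<open>The mean value property of \<open>exp\<close> on circles. The derivative in
  \<open>w\<close> is the integral of \<open>p w\<close>, which vanishes: for
  \<open>w \<noteq> 0\<close> its primitive \<open>exp (w * cis v) / (\<i> * w)\<close> is periodic
  in \<open>v\<close>. So the integral is constant in \<open>w\<close> and can be read off at
  \<open>w = 0\<close>.\<close>

lemma has_integral_exp_cis:
  "((\<lambda>v. exp (of_real w * cis v)) has_integral of_real (2 * pi)) {-pi..pi}"
proof -
  define p where "p w v = cis v * exp (of_real w * cis v)" for w v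
  have cis': "(cis has_vector_derivative \<i> * cis v) (at v within U)" for v U
    unfolding has_vector_derivative_def
    using has_derivative_cis[of "\<lambda>x. x" "\<lambda>x. x" v U, OF has_derivative_ident] by (simp add: mult.assoc)
  have p0: "integral {-pi..pi} (p w) = 0" for w
  proof (cases "w = 0")
    case True
    have "((\<lambda>v. cis v) has_integral (- \<i> * cis pi - (- \<i> * cis (- pi)))) {-pi..pi}"
    proof (rule fundamental_theorem_of_calculus)
      show "((\<lambda>v. - \<i> * cis v) has_vector_derivative cis v) (at v within {-pi..pi})" for v
        using has_vector_derivative_mult_right[OF cis', of "- \<i>"] by simp
    qed auto
    moreover have "p 0 = cis" "cis (- pi) = - 1" by (auto simp: p_def complex_eq_iff)
    ultimately show ?thesis using True by (simp add: integral_unique)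
  next
    case False
    have "((\<lambda>v. (\<i> * of_real w) * p w v) has_integral (exp (of_real w * cis pi) - exp (of_real w * cis (- pi)))) {-pi..pi}"
    proof (rule fundamental_theorem_of_calculus)
      fix v
      have "((\<lambda>v. of_real w * cis v) has_vector_derivative of_real w * (\<i> * cis v)) (at v within {-pi..pi})"
        by (rule has_vector_derivative_mult_right[OF cis'])
      from field_vector_diff_chain_within[OF this, of exp "exp (of_real w * cis v)"]
      show "((\<lambda>v. exp (of_real w * cis v)) has_vector_derivative (\<i> * of_real w) * p w v) (at v within {-pi..pi})"
        by (simp add: o_def p_def DERIV_exp has_field_derivative_at_within mult_ac)
    qed auto
    moreover have "cis (- pi) = - 1" by (simp add: complex_eq_iff)
    ultimately have "((\<lambda>v. (\<i> * of_real w) * p w v) has_integral 0) {-pi..pi}" by simp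
    from integral_unique[OF this] show ?thesis using False by simp
  qed
  have cont: "continuous_on (U \<times> cbox (-pi) pi) (\<lambda>(w, v). p w v)" for U
    unfolding p_def split_beta by (intro continuous_intros)
  have int: "(\<lambda>v. exp (of_real w * cis v)) integrable_on cbox (-pi) pi" for w
    by (intro integrable_continuous continuous_intros)
  have "((\<lambda>w. integral (cbox (-pi) pi) (\<lambda>v. exp (of_real w * cis v))) has_vector_derivative
       integral (cbox (-pi) pi) (p w)) (at w within UNIV)" for w
  proof (rule leibniz_rule_vector_derivative[OF _ int cont])
    fix x t :: real
    have "((\<lambda>x. of_real x * cis t) has_vector_derivative cis t) (at x within UNIV)"
      by (auto intro!: derivative_eq_intros simp: has_vector_derivative_def scaleR_conv_of_real)
    from field_vector_diff_chain_within[OF this, of exp "exp (of_real x * cis t)"]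
    show "((\<lambda>w. exp (of_real w * cis t)) has_vector_derivative p x t) (at x within UNIV)"
      by (simp add: o_def p_def DERIV_exp has_field_derivative_at_within)
  qed auto
  then have "((\<lambda>w. integral (cbox (-pi) pi) (\<lambda>v. exp (of_real w * cis v))) has_vector_derivative 0)
      (at w within UNIV)" for w
    using p0 by simp
  then obtain k where k: "\<And>w. integral (cbox (-pi) pi) (\<lambda>v. exp (of_real w * cis v)) = k"
    using has_vector_derivative_zero_constant[of UNIV] by (metis UNIV_I convex_UNIV)
  have "k = of_real (2 * pi)" using k[of 0] by (simp add: scaleR_conv_of_real)
  then show ?thesis using k[of w] integrable_integral[OF int[of w]] by simp
qed

text \<open>Enlarging the radius pushes the contour to a full circle of radius \<open>R \<rightarrow> \<infinity>\<close>, up to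
  pieces in the half plane where the exponential decays.\<close>

lemma hankel_exp_inverse:
  fixes y :: "'a::complex_banach"
  assumes r: "0 < r" and \<eta>: "pi / 2 < \<eta>" "\<eta> < pi" and t: "0 < t"
  shows "hankel r \<eta> (\<lambda>z. exp (of_real t * (of_real \<omega> + z)) *\<^sub>C ((1 / z) *\<^sub>C y)) = exp (t * \<omega>) *\<^sub>R y"
proof -
  define f where "f z = exp (of_real t * (of_real \<omega> + z)) / z" for z :: complex
  define f' where "f' z = (of_real t * exp (of_real t * (of_real \<omega> + z)) * z - exp (of_real t * (of_real \<omega> + z))) / (z * z)"
    for z :: complex
  define F where "F z = f z *\<^sub>C y" for z
  define \<kappa> where "\<kappa> = - cos \<eta> * t"
  have cosneg: "cos \<eta> < 0" using cos_monotone_0_pi[of "pi/2" \<eta>] \<eta> by auto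
  then have \<kappa>: "\<kappa> > 0" using t by (simp add: \<kappa>_def mult_neg_pos)
  have Feq: "F = (\<lambda>z. exp (of_real t * (of_real \<omega> + z)) *\<^sub>C ((1 / z) *\<^sub>C y))"
    by (simp add: F_def f_def scaleC_scaleC fun_eq_iff)
  have dec: "hankel_decay R \<eta> (- cos \<eta> * t) (norm y / R * exp (t * (\<omega> + 2 * R))) F" if "R > 0" for R
    unfolding Feq
  proof (rule hankel_decay_exp[OF _ _ that \<eta> t])
    show "continuous_on (hankel_contour R \<eta>) (\<lambda>z. (1 / z) *\<^sub>C y)"
      using hankel_contour_subset[OF that] closed_sector_nonzero by (intro continuous_intros) blast
    show "norm ((1 / z) *\<^sub>C y) \<le> norm y / R" if "z \<in> hankel_contour R \<eta>" for z
      using hankel_contour_norm_ge[OF \<open>R > 0\<close> that] \<open>R > 0\<close>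
      by (auto simp: norm_scaleC norm_divide intro!: frac_le)
  qed
  have deriv: "(F has_derivative (\<lambda>h. h *\<^sub>C (f' z *\<^sub>C y))) (at z within closed_sector \<eta>)"
    if "z \<in> closed_sector \<eta>" for z
  proof -
    have "(f has_field_derivative f' z) (at z within closed_sector \<eta>)"
      unfolding f_def f'_def using closed_sector_nonzero[OF that]
      by (auto intro!: derivative_eq_intros)
    then have "(f has_derivative (\<lambda>h. h * f' z)) (at z within closed_sector \<eta>)"
      by (simp add: has_field_derivative_def mult_commute_abs)
    from bounded_linear.has_derivative[OF bounded_bilinear.bounded_linear_left[OF bounded_bilinear_scaleC] this]
    show ?thesis unfolding F_def by (simp add: scaleC_scaleC)
  qed
  have contf': "continuous_on (closed_sector \<eta>) (\<lambda>z. f' z *\<^sub>C y)"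
    unfolding f'_def using closed_sector_nonzero by (intro continuous_intros) auto
  \<comment> \<open>The decay bound \<open>dec\<close> is useless as \<open>R\<close> grows, since
    it contains \<open>exp (2 * t * R)\<close>. On a ray \<open>Re z = cos \<eta> * \<rho>\<close>
    holds exactly, and \<open>norm y / r\<close> in place of \<open>norm y / R\<close> keeps the
    constant free of \<open>R\<close>.\<close>
  have ray: "norm (hankel_ray R v F) \<le> (norm y / r * exp (t * \<omega>)) / \<kappa> * exp (- \<kappa> * R)"
    if R: "R \<ge> r" and v: "\<bar>v\<bar> = \<eta>" for R v
  proof -
    have "norm (cis v *\<^sub>C F (of_real \<rho> * cis v)) \<le> (norm y / r * exp (t * \<omega>)) * exp (- \<kappa> * \<rho>)" if "\<rho> \<ge> R" for \<rho>
    proof -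
      have "cos v = cos \<eta>" using v by (metis cos_abs_real)
      then have "norm (cis v *\<^sub>C F (of_real \<rho> * cis v)) = exp (t * \<omega>) * exp (- \<kappa> * \<rho>) * (norm y / \<rho>)"
        using that R r by (simp add: norm_scaleC F_def f_def norm_divide norm_mult \<kappa>_def ring_distribs mult_ac flip: exp_add)
      also have "\<dots> \<le> exp (t * \<omega>) * exp (- \<kappa> * \<rho>) * (norm y / r)"
        using that R r by (intro mult_left_mono divide_left_mono) auto
      finally show ?thesis by (simp add: mult_ac)
    qed
    moreover have "continuous_on {R..} (\<lambda>\<rho>. cis v *\<^sub>C F (of_real \<rho> * cis v))"
      using dec[of R] R r v by (intro continuous_on_ray) (auto simp: hankel_decay_def)
    ultimately obtain L where "((\<lambda>\<rho>. cis v *\<^sub>C F (of_real \<rho> * cis v)) has_integral L) {R..}"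
      "norm L \<le> (norm y / r * exp (t * \<omega>)) / \<kappa> * exp (- \<kappa> * R)"
      using has_integral_exp_decay[of R _ \<kappa>] \<kappa> by metis
    then show ?thesis by (auto simp: hankel_ray_def integral_unique)
  qed
  have arc: "norm (hankel_arc R \<eta> F - (2 * of_real pi * \<i>) *\<^sub>C (exp (t * \<omega>) *\<^sub>R y))
      \<le> (2 * pi * exp (t * \<omega>) * norm y) * exp (- \<kappa> * R)" if R: "R \<ge> r" for R
  proof -
    \<comment> \<open>On the arc the factor \<open>1 / z\<close> cancels against
      \<open>dz = \<i> * z * dv\<close>, leaving \<open>e\<close> up to constants. Over the full
      circle \<open>e\<close> integrates to \<open>2 * pi\<close>; on the two missing arcs
      \<open>cos v \<le> cos \<eta> < 0\<close> makes it exponentially small in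
      \<open>R\<close>.\<close>
    define e where "e v = exp (of_real (t * R) * cis v)" for v
    have inte: "e integrable_on {a..b}" for a b
      unfolding e_def by (intro integrable_continuous_interval continuous_intros)
    have out: "norm (integral {a..b} e) \<le> pi / 2 * exp (- \<kappa> * R)"
      if ab: "(a, b) = (-pi, -\<eta>) \<or> (a, b) = (\<eta>, pi)" for a b
    proof -
      have "norm (integral {a..b} e) \<le> exp (- \<kappa> * R) * (b - a)"
      proof (rule integral_bound)
        show "continuous_on {a..b} e" unfolding e_def by (intro continuous_intros)
        fix v assume v: "v \<in> {a..b}"
        have "cos v \<le> cos \<eta>"
          using cos_monotone_0_pi_le[of \<eta> "\<bar>v\<bar>"] v ab \<eta> by (auto simp: abs_if split: if_splits)
        then have "t * R * cos v \<le> t * R * cos \<eta>" using R r t by (intro mult_left_mono) auto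
        then show "norm (e v) \<le> exp (- \<kappa> * R)" by (simp add: e_def \<kappa>_def mult_ac)
      qed (use ab \<eta> in auto)
      also have "\<dots> \<le> exp (- \<kappa> * R) * (pi / 2)" using ab \<eta> by (intro mult_left_mono) auto
      finally show ?thesis by (simp add: mult.commute)
    qed
    have eq: "(\<i> * of_real R * cis v) *\<^sub>C F (of_real R * cis v) = (\<i> * of_real (exp (t * \<omega>)) * e v) *\<^sub>C y" for v
    proof -
      have "\<i> * of_real R * cis v * f (of_real R * cis v) = \<i> * of_real (exp (t * \<omega>)) * e v"
        using R r by (simp add: f_def e_def exp_add ring_distribs mult_ac exp_of_real flip: of_real_mult)
      then show ?thesis by (simp only: F_def scaleC_scaleC)
    qed
    have "hankel_arc R \<eta> F = integral {-\<eta>..\<eta>} (\<lambda>v. (\<i> * of_real (exp (t * \<omega>)) * e v) *\<^sub>C y)"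
      by (simp only: hankel_arc_def eq)
    also have "\<dots> = (\<i> * of_real (exp (t * \<omega>)) * integral {-\<eta>..\<eta>} e) *\<^sub>C y"
      using integral_linear[OF inte bounded_linear_compose[OF
        bounded_bilinear.bounded_linear_left[OF bounded_bilinear_scaleC, of y]
        bounded_linear_mult_right[of "\<i> * of_real (exp (t * \<omega>))"]], of "-\<eta>" \<eta>]
      by (simp add: o_def)
    finally have a: "hankel_arc R \<eta> F = (\<i> * of_real (exp (t * \<omega>)) * integral {-\<eta>..\<eta>} e) *\<^sub>C y" .
    have "integral {-pi..-\<eta>} e + integral {-\<eta>..\<eta>} e + integral {\<eta>..pi} e = of_real (2 * pi)"
      using Henstock_Kurzweil_Integration.integral_combine[of "-pi" "-\<eta>" \<eta> e]
        Henstock_Kurzweil_Integration.integral_combine[of "-pi" \<eta> pi e] inte \<eta>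
        integral_unique[OF has_integral_exp_cis[of "t * R"]] by (simp add: e_def[abs_def])
    then have i: "integral {-\<eta>..\<eta>} e = of_real (2 * pi) - (integral {-pi..-\<eta>} e + integral {\<eta>..pi} e)"
      by (simp add: algebra_simps)
    have b: "(2 * of_real pi * \<i>) *\<^sub>C (exp (t * \<omega>) *\<^sub>R y) = (\<i> * of_real (exp (t * \<omega>)) * of_real (2 * pi)) *\<^sub>C y"
      by (simp add: scaleC_scaleC mult_ac flip: scaleC_of_real)
    have "norm (hankel_arc R \<eta> F - (2 * of_real pi * \<i>) *\<^sub>C (exp (t * \<omega>) *\<^sub>R y))
        = exp (t * \<omega>) * norm (integral {-pi..-\<eta>} e + integral {\<eta>..pi} e) * norm y"
      unfolding a b i by (simp add: norm_scaleC norm_mult right_diff_distrib flip: scaleC_diff_left)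
    also have "\<dots> \<le> exp (t * \<omega>) * (pi / 2 * exp (- \<kappa> * R) + pi / 2 * exp (- \<kappa> * R)) * norm y"
      using out by (intro mult_right_mono mult_left_mono norm_triangle_mono) auto
    also have "\<dots> \<le> (2 * pi * exp (t * \<omega>) * norm y) * exp (- \<kappa> * R)"
      by (simp add: mult_ac)
    finally show ?thesis .
  qed
  define K where "K = 2 * ((norm y / r * exp (t * \<omega>)) / \<kappa>) + 2 * pi * exp (t * \<omega>) * norm y"
  define N where "N = norm ((2 * of_real pi * \<i>) *\<^sub>C (hankel r \<eta> F - exp (t * \<omega>) *\<^sub>R y))"
  have bd: "N \<le> K * exp (- \<kappa> * R)" if R: "R \<ge> r" for R
  proof -
    have "hankel r \<eta> F = hankel R \<eta> F"
      using deriv contf' r R \<eta> dec[OF r] dec[of R] by (intro hankel_radius_mono) auto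
    then have eq: "(2 * of_real pi * \<i>) *\<^sub>C hankel r \<eta> F = - hankel_ray R (- \<eta>) F + hankel_arc R \<eta> F + hankel_ray R \<eta> F"
      by (simp add: hankel_def scaleC_scaleC)
    have "N = norm ((hankel_arc R \<eta> F - (2 * of_real pi * \<i>) *\<^sub>C (exp (t * \<omega>) *\<^sub>R y))
        + (hankel_ray R \<eta> F - hankel_ray R (- \<eta>) F))"
      unfolding N_def scaleC_diff_right eq by (simp add: algebra_simps)
    also have "\<dots> \<le> (2 * pi * exp (t * \<omega>) * norm y) * exp (- \<kappa> * R) +
       ((norm y / r * exp (t * \<omega>)) / \<kappa> * exp (- \<kappa> * R) + (norm y / r * exp (t * \<omega>)) / \<kappa> * exp (- \<kappa> * R))"
      using \<eta> pi_gt_zero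
      by (intro norm_triangle_mono[OF arc[OF R] order_trans[OF norm_triangle_ineq4 add_mono[OF ray[OF R] ray[OF R]]]])
        (auto simp: abs_of_pos)
    also have "\<dots> = K * exp (- \<kappa> * R)" by (simp add: K_def algebra_simps)
    finally show ?thesis .
  qed
  have "N \<le> 0"
    by (rule tendsto_lowerbound[OF tendsto_exp_decay[OF \<kappa>, of K]])
       (auto intro!: eventually_mono[OF eventually_ge_at_top[of r]] bd[simplified])
  then have "(2 * of_real pi * \<i>) *\<^sub>C (hankel r \<eta> F - exp (t * \<omega>) *\<^sub>R y) = 0"
    unfolding N_def by (simp only: norm_le_zero_iff)
  then have "hankel r \<eta> F - exp (t * \<omega>) *\<^sub>R y = 0"
    by (subst (asm) scaleC_eq_iff) auto
  then show ?thesis by (simp add: Feq)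
qed

section \<open>Exponential factors\<close>

definition exp_shift :: "real \<Rightarrow> real \<Rightarrow> complex \<Rightarrow> complex" where
  "exp_shift \<omega> t z = exp (of_real t * (of_real \<omega> + z))"

lemma continuous_on_exp_shift [continuous_intros]: "continuous_on S (exp_shift \<omega> t)"
  unfolding exp_shift_def by (intro continuous_intros)

lemma hankel_decay_mult:
  assumes "continuous_on (hankel_contour r \<eta>) f" "continuous_on (hankel_contour r \<eta>) G" "0 < c"
    and f: "\<And>z. z \<in> hankel_contour r \<eta> \<Longrightarrow> cmod (f z) \<le> C * exp (- c * cmod z)"
    and G: "\<And>z. z \<in> hankel_contour r \<eta> \<Longrightarrow> norm (G z) \<le> K"
  shows "hankel_decay r \<eta> c (C * K) (\<lambda>z. f z *\<^sub>C G z)"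
  unfolding hankel_decay_def
proof (intro conjI ballI continuous_intros assms)
  fix z assume z: "z \<in> hankel_contour r \<eta>"
  have "cmod (f z) * norm (G z) \<le> (C * exp (- c * cmod z)) * K"
    using f[OF z] G[OF z] order_trans[OF norm_ge_zero f[OF z]] by (intro mult_mono) auto
  then show "norm (f z *\<^sub>C G z) \<le> C * K * exp (- c * cmod z)"
    by (simp add: norm_scaleC mult_ac)
qed

lemma exp_shift_bound:
  assumes "z \<in> hankel_contour r \<eta>" "0 < r" "pi / 2 < \<eta>" "\<eta> < pi" "0 < t"
  shows "cmod (exp_shift \<omega> t z) \<le> exp (t * (\<omega> + 2 * r)) * exp (- (- cos \<eta> * t) * cmod z)"
proof -
  have "t * (\<omega> + Re z) \<le> t * (\<omega> + (2 * r + cos \<eta> * cmod z))"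
    using hankel_contour_Re_le[OF assms(1-4)] assms(5) by (intro mult_left_mono) auto
  then show ?thesis by (simp add: exp_shift_def algebra_simps flip: exp_add)
qed

lemma exp_shift_decay:
  assumes "continuous_on (hankel_contour r \<eta>) G" "\<And>z. z \<in> hankel_contour r \<eta> \<Longrightarrow> norm (G z) \<le> K"
    and "0 < r" "pi / 2 < \<eta>" "\<eta> < pi" "0 < t"
  shows "hankel_decay r \<eta> (- cos \<eta> * t) (exp (t * (\<omega> + 2 * r)) * K) (\<lambda>z. exp_shift \<omega> t z *\<^sub>C G z)"
  using hankel_decay_exp[OF assms] by (simp add: exp_shift_def mult.commute)

lemma norm_hankel_exp_shift_le:
  assumes "continuous_on (hankel_contour r \<eta>) G" "\<And>z. z \<in> hankel_contour r \<eta> \<Longrightarrow> norm (G z) \<le> K"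
    and "0 < r" "pi / 2 < \<eta>" "\<eta> < pi" "0 < t"
  shows "norm (hankel r \<eta> (\<lambda>z. exp_shift \<omega> t z *\<^sub>C G z)) \<le> exp (t * (\<omega> + 2 * r)) * K * (1 / (- cos \<eta> * t) + r)"
  by (rule norm_hankel_le[OF exp_shift_decay]) (use assms pi_gt_zero in auto)

text \<open>Differentiation in \<open>t\<close> brings down the factor \<open>\<omega> + z\<close>.
  Of the decay rate \<open>4 * a\<close>, one share \<open>a\<close> absorbs it by
  \<open>x \<le> exp x\<close>. Of the rest only \<open>a\<close> is claimed, to match the rate in
  \<open>exp_shift_taylor_bound\<close>.\<close>

lemma exp_shift_mult_bound:
  assumes "z \<in> hankel_contour r \<eta>" "0 < r" "pi / 2 < \<eta>" "\<eta> < pi" "0 < t" and a: "a = - cos \<eta> * t / 4"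
  shows "cmod (exp_shift \<omega> t z * (of_real \<omega> + z))
      \<le> (exp (t * (\<omega> + 2 * r) + a * \<bar>\<omega>\<bar>) / a) * exp (- a * cmod z)"
proof -
  have "cos \<eta> < 0" using cos_monotone_0_pi[of "pi/2" \<eta>] assms by auto
  then have a0: "a > 0" using assms by (simp add: mult_neg_pos)
  have k: "- cos \<eta> * t = 4 * a" by (simp add: a)
  have m: "cmod (of_real \<omega> + z) \<le> \<bar>\<omega>\<bar> + cmod z" by (metis norm_of_real norm_triangle_ineq real_norm_def)
  have "a * (\<bar>\<omega>\<bar> + cmod z) \<le> exp (a * (\<bar>\<omega>\<bar> + cmod z))"
    using exp_ge_add_one_self[of "a * (\<bar>\<omega>\<bar> + cmod z)"] by linarith
  then have "\<bar>\<omega>\<bar> + cmod z \<le> exp (a * (\<bar>\<omega>\<bar> + cmod z)) / a" using a0 by (simp add: field_simps)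
  then have "cmod (exp_shift \<omega> t z * (of_real \<omega> + z))
     \<le> (exp (t * (\<omega> + 2 * r)) * exp (- (- cos \<eta> * t) * cmod z)) * (exp (a * (\<bar>\<omega>\<bar> + cmod z)) / a)"
    unfolding norm_mult using exp_shift_bound[OF assms(1-5)] m by (intro mult_mono) auto
  also have "\<dots> = (exp (t * (\<omega> + 2 * r) + a * \<bar>\<omega>\<bar>) / a) * exp (- 3 * a * cmod z)"
    unfolding k by (simp add: algebra_simps flip: exp_add)
  also have "\<dots> \<le> (exp (t * (\<omega> + 2 * r) + a * \<bar>\<omega>\<bar>) / a) * exp (- a * cmod z)"
    using a0 by (intro mult_left_mono) auto
  finally show ?thesis .
qed

text \<open>After \<open>exp_shift \<omega> t z\<close> is factored out, what is left is the Taylor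
  remainder of \<open>exp (h * \<mu>)\<close>. Of the decay rate \<open>4 * a\<close>, one share
  pays for \<open>exp \<bar>Re (h * \<mu>)\<bar>\<close>, which is where
  \<open>\<bar>h\<bar> \<le> a\<close> enters, and one for the square of
  \<open>cmod \<mu>\<close>.\<close>

lemma exp_shift_taylor_bound:
  assumes z: "z \<in> hankel_contour r \<eta>" "0 < r" "pi / 2 < \<eta>" "\<eta> < pi" "0 < t"
    and a: "a = - cos \<eta> * t / 4" and h: "\<bar>h\<bar> \<le> a"
  shows "cmod (exp_shift \<omega> (t + h) z - exp_shift \<omega> t z - of_real h * (exp_shift \<omega> t z * (of_real \<omega> + z)))
      \<le> (h\<^sup>2 * (exp (t * (\<omega> + 2 * r) + 2 * a * \<bar>\<omega>\<bar>) * (2 / a\<^sup>2))) * exp (- a * cmod z)"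
proof -
  define \<mu> where "\<mu> = of_real \<omega> + z"
  define b where "b = a * (\<bar>\<omega>\<bar> + cmod z)"
  have "cos \<eta> < 0" using cos_monotone_0_pi[of "pi/2" \<eta>] assms by auto
  then have a0: "a > 0" using assms by (simp add: mult_neg_pos)
  have k: "- cos \<eta> * t = 4 * a" by (simp add: a)
  have m: "cmod \<mu> \<le> \<bar>\<omega>\<bar> + cmod z" unfolding \<mu>_def by (metis norm_of_real norm_triangle_ineq real_norm_def)
  have "\<bar>h\<bar> * cmod \<mu> \<le> b" unfolding b_def using h m by (intro mult_mono) auto
  then have re: "\<bar>Re (of_real h * \<mu>)\<bar> \<le> b"
    using abs_Re_le_cmod[of "of_real h * \<mu>"] by (simp add: norm_mult)
  have b0: "b \<ge> 0" unfolding b_def using a0 by simp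
  have "b\<^sup>2 / 2 \<le> exp b" using exp_lower_Taylor_quadratic[OF b0] b0 by linarith
  then have "a\<^sup>2 * (\<bar>\<omega>\<bar> + cmod z)\<^sup>2 \<le> 2 * exp b" by (simp add: b_def power_mult_distrib)
  then have "(\<bar>\<omega>\<bar> + cmod z)\<^sup>2 \<le> (2 / a\<^sup>2) * exp b" using a0 by (simp add: field_simps)
  moreover have "(cmod \<mu>)\<^sup>2 \<le> (\<bar>\<omega>\<bar> + cmod z)\<^sup>2" using m by (intro power_mono) auto
  ultimately have sq: "(cmod \<mu>)\<^sup>2 \<le> (2 / a\<^sup>2) * exp b" by linarith
  have "cmod (exp (of_real h * \<mu>) - 1 - of_real h * \<mu>) \<le> exp \<bar>Re (of_real h * \<mu>)\<bar> * (cmod (of_real h * \<mu>))\<^sup>2"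
    using Taylor_exp[of "of_real h * \<mu>" 1] by (simp add: power2_eq_square algebra_simps)
  also have "\<dots> \<le> exp b * (h\<^sup>2 * ((2 / a\<^sup>2) * exp b))"
  proof (intro mult_mono)
    show "(cmod (of_real h * \<mu>))\<^sup>2 \<le> h\<^sup>2 * ((2 / a\<^sup>2) * exp b)"
      using mult_left_mono[OF sq, of "h\<^sup>2"] by (simp add: norm_mult power_mult_distrib)
  qed (use re in auto)
  finally have t1: "cmod (exp (of_real h * \<mu>) - 1 - of_real h * \<mu>) \<le> exp b * (h\<^sup>2 * ((2 / a\<^sup>2) * exp b))" .
  have "exp_shift \<omega> (t + h) z - exp_shift \<omega> t z - of_real h * (exp_shift \<omega> t z * (of_real \<omega> + z))
     = exp_shift \<omega> t z * (exp (of_real h * \<mu>) - 1 - of_real h * \<mu>)"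
    unfolding exp_shift_def \<mu>_def[symmetric] by (simp add: exp_add ring_distribs mult_ac)
  then have "cmod (exp_shift \<omega> (t + h) z - exp_shift \<omega> t z - of_real h * (exp_shift \<omega> t z * (of_real \<omega> + z)))
     \<le> (exp (t * (\<omega> + 2 * r)) * exp (- (- cos \<eta> * t) * cmod z)) * (exp b * (h\<^sup>2 * ((2 / a\<^sup>2) * exp b)))"
    using mult_mono[OF exp_shift_bound[OF assms(1-5), of \<omega>] t1]
    by (simp only: norm_mult) simp
  also have "\<dots> = h\<^sup>2 * (2 / a\<^sup>2) * (exp (t * (\<omega> + 2 * r)) * exp (- (- cos \<eta> * t) * cmod z) * exp b * exp b)"
    by (simp add: mult_ac)
  also have "exp (t * (\<omega> + 2 * r)) * exp (- (- cos \<eta> * t) * cmod z) * exp b * exp b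
     = exp (t * (\<omega> + 2 * r) + 2 * a * \<bar>\<omega>\<bar>) * exp (- 2 * a * cmod z)"
    unfolding b_def k by (simp add: algebra_simps flip: exp_add)
  also have "h\<^sup>2 * (2 / a\<^sup>2) * (exp (t * (\<omega> + 2 * r) + 2 * a * \<bar>\<omega>\<bar>) * exp (- 2 * a * cmod z))
     \<le> h\<^sup>2 * (2 / a\<^sup>2) * (exp (t * (\<omega> + 2 * r) + 2 * a * \<bar>\<omega>\<bar>) * exp (- a * cmod z))"
    using a0 by (intro mult_left_mono) auto
  finally show ?thesis by (simp add: mult_ac)
qed

text \<open>\<open>d\<close> and \<open>C\<close> are fixed before \<open>G\<close>,
  \<open>K\<close> and \<open>h\<close>. This uniformity upgrades differentiability of single orbits
  to differentiability of the semigroup in operator norm.\<close>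

lemma hankel_exp_shift_taylor:
  assumes "0 < r" "pi / 2 < \<eta>" "\<eta> < pi" "0 < t"
  obtains d C where "0 < d" "\<And>(G :: complex \<Rightarrow> 'a::complex_banach) K h.
     continuous_on (hankel_contour r \<eta>) G \<Longrightarrow> (\<And>z. z \<in> hankel_contour r \<eta> \<Longrightarrow> norm (G z) \<le> K) \<Longrightarrow> \<bar>h\<bar> \<le> d \<Longrightarrow>
     norm (hankel r \<eta> (\<lambda>z. exp_shift \<omega> (t + h) z *\<^sub>C G z) - hankel r \<eta> (\<lambda>z. exp_shift \<omega> t z *\<^sub>C G z)
       - h *\<^sub>R hankel r \<eta> (\<lambda>z. exp_shift \<omega> t z *\<^sub>C ((of_real \<omega> + z) *\<^sub>C G z))) \<le> C * K * h\<^sup>2"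
proof -
  define a where "a = - cos \<eta> * t / 4"
  have "cos \<eta> < 0" using cos_monotone_0_pi[of "pi/2" \<eta>] assms by auto
  then have a0: "a > 0" using assms by (simp add: a_def mult_neg_pos)
  define c where "c = exp (t * (\<omega> + 2 * r) + 2 * a * \<bar>\<omega>\<bar>) * (2 / a\<^sup>2)"
  have \<eta>: "0 < \<eta>" using assms pi_gt_zero by linarith
  show thesis
  proof (rule that[OF a0])
    fix G :: "complex \<Rightarrow> 'a" and K h
    assume G: "continuous_on (hankel_contour r \<eta>) G" "\<And>z. z \<in> hankel_contour r \<eta> \<Longrightarrow> norm (G z) \<le> K" and h: "\<bar>h\<bar> \<le> a"
    let ?E = "\<lambda>z. exp_shift \<omega> t z *\<^sub>C G z"
    let ?M = "\<lambda>z. (exp_shift \<omega> t z * (of_real \<omega> + z)) *\<^sub>C G z"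
    let ?Q = "\<lambda>z. (exp_shift \<omega> (t + h) z - exp_shift \<omega> t z - of_real h * (exp_shift \<omega> t z * (of_real \<omega> + z))) *\<^sub>C G z"
    note E = exp_shift_decay[OF G assms, of \<omega>]
    have M: "hankel_decay r \<eta> a ((exp (t * (\<omega> + 2 * r) + a * \<bar>\<omega>\<bar>) / a) * K) ?M"
      by (rule hankel_decay_mult[OF _ G(1) a0 _ G(2)])
         (use exp_shift_mult_bound[OF _ assms a_def] in \<open>auto intro!: continuous_intros\<close>)
    have hM: "hankel_decay r \<eta> a ((\<bar>h\<bar> * (exp (t * (\<omega> + 2 * r) + a * \<bar>\<omega>\<bar>) / a)) * K) (\<lambda>z. (of_real h * (exp_shift \<omega> t z * (of_real \<omega> + z))) *\<^sub>C G z)"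
    proof (rule hankel_decay_mult[OF _ G(1) a0 _ G(2)])
      show "cmod (of_real h * (exp_shift \<omega> t z * (of_real \<omega> + z)))
        \<le> (\<bar>h\<bar> * (exp (t * (\<omega> + 2 * r) + a * \<bar>\<omega>\<bar>) / a)) * exp (- a * cmod z)" if "z \<in> hankel_contour r \<eta>" for z
        using mult_left_mono[OF exp_shift_mult_bound[OF that assms a_def, of \<omega>], of "\<bar>h\<bar>"]
        by (simp add: norm_mult mult.assoc)
    qed (auto intro!: continuous_intros)
    have Q: "hankel_decay r \<eta> a ((h\<^sup>2 * c) * K) ?Q"
      unfolding c_def
      by (rule hankel_decay_mult[OF _ G(1) a0 exp_shift_taylor_bound[OF _ assms a_def h] G(2)])
         (auto intro!: continuous_intros)
    have "(\<lambda>z. exp_shift \<omega> (t + h) z *\<^sub>C G z) = (\<lambda>z. ?E z + ((of_real h * (exp_shift \<omega> t z * (of_real \<omega> + z))) *\<^sub>C G z + ?Q z))"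
      by (simp add: fun_eq_iff scaleC_diff_left)
    then have "hankel r \<eta> (\<lambda>z. exp_shift \<omega> (t + h) z *\<^sub>C G z) = hankel r \<eta> ?E
       + (hankel r \<eta> (\<lambda>z. (of_real h * (exp_shift \<omega> t z * (of_real \<omega> + z))) *\<^sub>C G z) + hankel r \<eta> ?Q)"
      using hankel_add[OF E hankel_decay_add[OF hM Q] assms(1) \<eta>] hankel_add[OF hM Q assms(1) \<eta>] by simp
    also have "hankel r \<eta> (\<lambda>z. (of_real h * (exp_shift \<omega> t z * (of_real \<omega> + z))) *\<^sub>C G z) = h *\<^sub>R hankel r \<eta> ?M"
      using hankel_scaleC[OF M assms(1) \<eta>, of "of_real h"] by (simp add: scaleC_scaleC scaleC_of_real)
    finally have "hankel r \<eta> (\<lambda>z. exp_shift \<omega> (t + h) z *\<^sub>C G z) - hankel r \<eta> ?E - h *\<^sub>R hankel r \<eta> ?M = hankel r \<eta> ?Q"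
      by simp
    moreover have "norm (hankel r \<eta> ?Q) \<le> (h\<^sup>2 * c) * K * (1 / a + r)"
      by (rule norm_hankel_le[OF Q assms(1) \<eta> assms(3)])
    ultimately show "norm (hankel r \<eta> (\<lambda>z. exp_shift \<omega> (t + h) z *\<^sub>C G z) - hankel r \<eta> ?E
       - h *\<^sub>R hankel r \<eta> (\<lambda>z. exp_shift \<omega> t z *\<^sub>C ((of_real \<omega> + z) *\<^sub>C G z))) \<le> (c * (1 / a + r)) * K * h\<^sup>2"
      by (simp add: scaleC_scaleC mult_ac)
  qed
qed

lemma hankel_exp_shift_has_vector_derivative:
  assumes G: "continuous_on (hankel_contour r \<eta>) G" "\<And>z. z \<in> hankel_contour r \<eta> \<Longrightarrow> norm (G z) \<le> K"
    and "0 < r" "pi / 2 < \<eta>" "\<eta> < pi" "0 < t"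
  shows "((\<lambda>t. hankel r \<eta> (\<lambda>z. exp_shift \<omega> t z *\<^sub>C G z)) has_vector_derivative
      hankel r \<eta> (\<lambda>z. exp_shift \<omega> t z *\<^sub>C ((of_real \<omega> + z) *\<^sub>C G z))) (at t)"
proof -
  obtain d C where "0 < d" and *: "\<And>(G :: complex \<Rightarrow> 'a) K h.
     continuous_on (hankel_contour r \<eta>) G \<Longrightarrow> (\<And>z. z \<in> hankel_contour r \<eta> \<Longrightarrow> norm (G z) \<le> K) \<Longrightarrow> \<bar>h\<bar> \<le> d \<Longrightarrow>
     norm (hankel r \<eta> (\<lambda>z. exp_shift \<omega> (t + h) z *\<^sub>C G z) - hankel r \<eta> (\<lambda>z. exp_shift \<omega> t z *\<^sub>C G z)
       - h *\<^sub>R hankel r \<eta> (\<lambda>z. exp_shift \<omega> t z *\<^sub>C ((of_real \<omega> + z) *\<^sub>C G z))) \<le> C * K * h\<^sup>2"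
    using hankel_exp_shift_taylor[OF assms(3-6), of \<omega>, where 'a='a] by blast
  show ?thesis
    by (rule has_vector_derivative_quadratic[OF \<open>0 < d\<close> *[OF G]])
qed

lemma continuous_inverse_scaleC:
  assumes "0 < r"
  shows "continuous_on (hankel_contour r \<eta>) (\<lambda>z. (1 / z) *\<^sub>C y)"
    and "z \<in> hankel_contour r \<eta> \<Longrightarrow> norm ((1 / z) *\<^sub>C y) \<le> norm y / r"
proof -
  show "continuous_on (hankel_contour r \<eta>) (\<lambda>z. (1 / z) *\<^sub>C y)"
    using hankel_contour_subset[OF assms] closed_sector_nonzero by (intro continuous_intros) blast
  show "norm ((1 / z) *\<^sub>C y) \<le> norm y / r" if "z \<in> hankel_contour r \<eta>"
    using hankel_contour_norm_ge[OF assms that] assms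
    by (auto simp: norm_scaleC norm_divide intro!: frac_le)
qed

text \<open>Both sides of \<open>hankel_exp_inverse\<close> are differentiated in \<open>t\<close>.\<close>

lemma hankel_exp_const:
  assumes "0 < r" "pi / 2 < \<eta>" "\<eta> < pi" "0 < t"
  shows "hankel r \<eta> (\<lambda>z. exp_shift \<omega> t z *\<^sub>C y) = 0"
proof -
  note G = continuous_inverse_scaleC(1)[OF assms(1), of \<eta> y] continuous_inverse_scaleC(2)[OF assms(1), of _ \<eta> y]
  have \<eta>: "0 < \<eta>" using assms pi_gt_zero by linarith
  have "((\<lambda>t. hankel r \<eta> (\<lambda>z. exp_shift \<omega> t z *\<^sub>C ((1 / z) *\<^sub>C y))) has_vector_derivative
      hankel r \<eta> (\<lambda>z. exp_shift \<omega> t z *\<^sub>C ((of_real \<omega> + z) *\<^sub>C ((1 / z) *\<^sub>C y)))) (at t)"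
    by (rule hankel_exp_shift_has_vector_derivative[OF G assms])
  then have "((\<lambda>t. exp (t * \<omega>) *\<^sub>R y) has_vector_derivative
      hankel r \<eta> (\<lambda>z. exp_shift \<omega> t z *\<^sub>C ((of_real \<omega> + z) *\<^sub>C ((1 / z) *\<^sub>C y)))) (at t)"
    by (rule has_vector_derivative_transform_within_open[of _ _ _ "{0<..}"])
       (use assms in \<open>auto simp: exp_shift_def hankel_exp_inverse\<close>)
  moreover have "((\<lambda>t. exp (t * \<omega>) *\<^sub>R y) has_vector_derivative (\<omega> * exp (t * \<omega>)) *\<^sub>R y) (at t)"
    by (auto intro!: derivative_eq_intros has_vector_derivative_scaleR[THEN has_vector_derivative_eq_rhs]
        simp: has_real_derivative_iff_has_vector_derivative[symmetric])
  ultimately have 1: "hankel r \<eta> (\<lambda>z. exp_shift \<omega> t z *\<^sub>C ((of_real \<omega> + z) *\<^sub>C ((1 / z) *\<^sub>C y))) = (\<omega> * exp (t * \<omega>)) *\<^sub>R y"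
    by (rule vector_derivative_unique_at)
  have d1: "hankel_decay r \<eta> (- cos \<eta> * t) (exp (t * (\<omega> + 2 * r)) * (\<bar>\<omega>\<bar> * (norm y / r)))
      (\<lambda>z. exp_shift \<omega> t z *\<^sub>C (of_real \<omega> *\<^sub>C ((1 / z) *\<^sub>C y)))"
  proof (rule exp_shift_decay[OF _ _ assms])
    show "continuous_on (hankel_contour r \<eta>) (\<lambda>z. of_real \<omega> *\<^sub>C ((1 / z) *\<^sub>C y))" by (intro continuous_intros G)
    show "norm (of_real \<omega> *\<^sub>C ((1 / z) *\<^sub>C y)) \<le> \<bar>\<omega>\<bar> * (norm y / r)" if "z \<in> hankel_contour r \<eta>" for z
      using mult_left_mono[OF G(2)[OF that], of "\<bar>\<omega>\<bar>"] by (simp add: norm_scaleC)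
  qed
  have d2: "hankel_decay r \<eta> (- cos \<eta> * t) (exp (t * (\<omega> + 2 * r)) * norm y) (\<lambda>z. exp_shift \<omega> t z *\<^sub>C y)"
    by (rule exp_shift_decay[OF _ _ assms]) auto
  \<comment> \<open>As \<open>(\<omega> + z) / z = \<omega> / z + 1\<close>, the derivative consists
    of \<open>\<omega>\<close> times the known integral and the integral in question; the first
    already equals the whole, so the second vanishes.\<close>
  have "hankel r \<eta> (\<lambda>z. exp_shift \<omega> t z *\<^sub>C ((of_real \<omega> + z) *\<^sub>C ((1 / z) *\<^sub>C y)))
     = hankel r \<eta> (\<lambda>z. exp_shift \<omega> t z *\<^sub>C (of_real \<omega> *\<^sub>C ((1 / z) *\<^sub>C y)) + exp_shift \<omega> t z *\<^sub>C y)"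
  proof (rule hankel_cong[OF _ \<eta>])
    fix z assume "z \<in> hankel_contour r \<eta>"
    then have "z \<noteq> 0" using closed_sector_nonzero hankel_contour_subset[OF assms(1)] by blast
    then show "exp_shift \<omega> t z *\<^sub>C ((of_real \<omega> + z) *\<^sub>C ((1 / z) *\<^sub>C y))
       = exp_shift \<omega> t z *\<^sub>C (of_real \<omega> *\<^sub>C ((1 / z) *\<^sub>C y)) + exp_shift \<omega> t z *\<^sub>C y"
      by (simp add: scaleC_scaleC scaleC_add_left[symmetric] scaleC_add_right[symmetric] field_simps)
  qed
  also have "\<dots> = hankel r \<eta> (\<lambda>z. of_real \<omega> *\<^sub>C (exp_shift \<omega> t z *\<^sub>C ((1 / z) *\<^sub>C y))) + hankel r \<eta> (\<lambda>z. exp_shift \<omega> t z *\<^sub>C y)"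
    using hankel_add[OF d1 d2 assms(1) \<eta>] by (simp add: scaleC_scaleC mult_ac)
  also have "hankel r \<eta> (\<lambda>z. of_real \<omega> *\<^sub>C (exp_shift \<omega> t z *\<^sub>C ((1 / z) *\<^sub>C y))) = (\<omega> * exp (t * \<omega>)) *\<^sub>R y"
    using hankel_scaleC[OF exp_shift_decay[OF G assms] assms(1) \<eta>, of "of_real \<omega>" \<omega>]
      hankel_exp_inverse[OF assms, of \<omega> y] by (simp add: exp_shift_def scaleC_of_real)
  finally show ?thesis using 1 by simp
qed

section \<open>The semigroup generated by a sectorial operator\<close>

text \<open>The theory is developed for an arbitrary admissible contour;
  \<open>sectorial_choice\<close> later specialises it to the one selected in the definition of the
  semigroup.\<close>

locale sectorial_contour =
  fixes D :: "'a::complex_banach set" and A :: "'a \<Rightarrow> 'a" and \<omega> \<theta> M r \<eta> :: real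
  assumes sectorial: "sectorial_with D A \<omega> \<theta> M"
    and r: "0 < r" and \<eta>: "pi / 2 < \<eta>" and \<eta>_less: "\<eta> < \<theta>"
begin

lemma \<eta>_pi: "\<eta> < pi" and \<eta>_pos: "0 < \<eta>" and M_pos: "0 < M"
  using sectorial \<eta> \<eta>_less pi_gt_zero by (auto simp: sectorial_with_def)

lemma \<kappa>_pos: "0 < - cos \<eta>"
  using cos_monotone_0_pi[of "pi/2" \<eta>] \<eta> \<eta>_pi by auto

lemma D_scaleC: "x \<in> D \<Longrightarrow> a *\<^sub>C x \<in> D"
  and A_add: "x \<in> D \<Longrightarrow> y \<in> D \<Longrightarrow> A (x + y) = A x + A y" and A_scaleC: "x \<in> D \<Longrightarrow> A (a *\<^sub>C x) = a *\<^sub>C A x"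
  using sectorial by (auto simp: sectorial_with_def linear_operator_def complex_subspace_def)

section \<open>The resolvent on the sector\<close>

definition res :: "complex \<Rightarrow> 'a \<Rightarrow> 'a" where
  "res z = resolvent D A (of_real \<omega> + z)"

lemma sector_resolvent:
  assumes "z \<in> closed_sector \<eta>"
  shows "of_real \<omega> + z \<in> resolvent_set D A" "onorm (res z) \<le> M / cmod z"
proof -
  obtain \<rho> v where z: "z = of_real \<rho> * cis v" "0 < \<rho>" "\<bar>v\<bar> \<le> \<eta>"
    using assms by (auto simp: closed_sector_def)
  have "Arg z = v" using z \<eta>_pi by (intro Arg_unique[of \<rho>]) (auto simp: cis_conv_exp)
  then have *: "\<bar>Arg z\<bar> < \<theta>" "z \<noteq> 0" using z \<eta>_less by auto
  have "of_real \<omega> + z \<noteq> of_real \<omega> \<and> \<bar>Arg (of_real \<omega> + z - of_real \<omega>)\<bar> < \<theta>" using * by simp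
  then have "of_real \<omega> + z \<in> resolvent_set D A \<and> onorm (resolvent D A (of_real \<omega> + z)) \<le> M / cmod (of_real \<omega> + z - of_real \<omega>)"
    using sectorial unfolding sectorial_with_def by blast
  then show "of_real \<omega> + z \<in> resolvent_set D A" "onorm (res z) \<le> M / cmod z"
    by (auto simp: res_def)
qed

context
  fixes z assumes z: "z \<in> closed_sector \<eta>"
begin

lemma bounded_linear_res: "bounded_linear (res z)"
  using sector_resolvent(1)[OF z] by (simp add: res_def resolvent_set_def)

lemma norm_res_le: "norm (res z x) \<le> M / cmod z * norm x"
  by (rule order_trans[OF onorm[OF bounded_linear_res]])
     (intro mult_right_mono sector_resolvent(2)[OF z] norm_ge_zero)

lemma bij_res: "bij_betw (\<lambda>x. (of_real \<omega> + z) *\<^sub>C x - A x) D UNIV"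
  using sector_resolvent(1)[OF z] by (simp add: resolvent_set_def)

lemma res_in_D: "res z x \<in> D"
  unfolding res_def resolvent_def
  by (rule inv_into_into) (use bij_res in \<open>auto simp: bij_betw_def\<close>)

lemma A_res: "A (res z x) = (of_real \<omega> + z) *\<^sub>C res z x - x"
proof -
  have "(\<lambda>x. (of_real \<omega> + z) *\<^sub>C x - A x) (res z x) = x"
    unfolding res_def resolvent_def
    by (rule f_inv_into_f) (use bij_res in \<open>auto simp: bij_betw_def\<close>)
  then show ?thesis by (simp add: algebra_simps)
qed

lemma res_unique:
  assumes "y \<in> D" "(of_real \<omega> + z) *\<^sub>C y - A y = x"
  shows "res z x = y"
  unfolding res_def resolvent_def assms(2)[symmetric]
  by (rule inv_into_f_f) (use bij_res assms in \<open>auto simp: bij_betw_def\<close>)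

lemma res_scaleC: "res z (a *\<^sub>C x) = a *\<^sub>C res z x"
  by (rule res_unique)
     (auto intro!: D_scaleC res_in_D simp: A_scaleC res_in_D A_res scaleC_diff_right scaleC_scaleC mult.commute)

end

text \<open>\<open>res w x\<close> solves the resolvent equation at \<open>z\<close> with right-hand
  side \<open>x + (z - w) *\<^sub>C res w x\<close>.\<close>

lemma resolvent_identity:
  assumes z: "z \<in> closed_sector \<eta>" and w: "w \<in> closed_sector \<eta>"
  shows "res w x - res z x = (z - w) *\<^sub>C res z (res w x)"
proof -
  interpret z: bounded_linear "res z" by (rule bounded_linear_res[OF z])
  have "res z (x + (z - w) *\<^sub>C res w x) = res w x"
    by (rule res_unique[OF z res_in_D[OF w]]) (simp add: A_res[OF w] scaleC_add_left scaleC_diff_left)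
  then show ?thesis by (simp add: z.add res_scaleC[OF z] algebra_simps)
qed

lemma res_commute:
  assumes z: "z \<in> closed_sector \<eta>" and w: "w \<in> closed_sector \<eta>"
  shows "res z (res w x) = res w (res z x)"
proof (cases "z = w")
  case False
  have "(z - w) *\<^sub>C res w (res z x) = - ((w - z) *\<^sub>C res w (res z x))"
    by (simp flip: scaleC_minus_left)
  also have "\<dots> = (z - w) *\<^sub>C res z (res w x)"
    unfolding resolvent_identity[OF assms, symmetric] resolvent_identity[OF assms(2,1), symmetric] by simp
  finally have "(z - w) *\<^sub>C res z (res w x) = (z - w) *\<^sub>C res w (res z x)" ..
  then show ?thesis using False by (simp add: scaleC_eq_iff scaleC_scaleC)
qed simp

lemma continuous_on_res: "continuous_on (closed_sector \<eta>) (\<lambda>z. res z x)"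
  unfolding continuous_on_def
proof
  fix z assume z: "z \<in> closed_sector \<eta>"
  note nz = closed_sector_nonzero[OF z]
  have "((\<lambda>w. cmod (z - w) * (M / cmod z * (M / cmod w * norm x))) \<longlongrightarrow> cmod (z - z) * (M / cmod z * (M / cmod z * norm x)))
      (at z within closed_sector \<eta>)"
    using nz by (intro tendsto_intros) auto
  then have "((\<lambda>w. cmod (z - w) * (M / cmod z * (M / cmod w * norm x))) \<longlongrightarrow> 0) (at z within closed_sector \<eta>)" by simp
  moreover have "\<forall>\<^sub>F w in at z within closed_sector \<eta>. norm (res w x - res z x) \<le> cmod (z - w) * (M / cmod z * (M / cmod w * norm x))"
    unfolding eventually_at_filter
  proof (intro always_eventually allI impI)
    fix w assume "w \<in> closed_sector \<eta>"
    note w = this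
    have "norm (res z (res w x)) \<le> M / cmod z * (M / cmod w * norm x)"
      using M_pos by (intro order_trans[OF norm_res_le[OF z]] mult_left_mono norm_res_le[OF w]) auto
    then show "norm (res w x - res z x) \<le> cmod (z - w) * (M / cmod z * (M / cmod w * norm x))"
      unfolding resolvent_identity[OF z w] norm_scaleC by (intro mult_left_mono) auto
  qed
  ultimately show "((\<lambda>w. res w x) \<longlongrightarrow> res z x) (at z within closed_sector \<eta>)"
    by (rule LIM_zero_cancel[OF Lim_null_comparison[rotated]])
qed

text \<open>By the resolvent identity and commutation, the remainder divided by \<open>z - w\<close>
  is \<open>res w (res z x) - res z (res z x)\<close>. Hence continuity of the resolvent applied to
  the single vector \<open>res z x\<close> is enough.\<close>

lemma res_has_derivative:
  assumes z: "z \<in> closed_sector \<eta>"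
  shows "((\<lambda>z. res z x) has_derivative (\<lambda>h. h *\<^sub>C (- res z (res z x)))) (at z within closed_sector \<eta>)"
  unfolding has_derivative_within
proof
  show "bounded_linear (\<lambda>h. h *\<^sub>C (- res z (res z x)))"
    by (rule bounded_bilinear.bounded_linear_left[OF bounded_bilinear_scaleC])
  have "((\<lambda>w. res w (res z x) - res z (res z x)) \<longlongrightarrow> 0) (at z within closed_sector \<eta>)"
    using continuous_on_res[of "res z x"] z by (auto simp: continuous_on_def intro: LIM_zero)
  then show "((\<lambda>w. (1 / norm (w - z)) *\<^sub>R (res w x - (res z x + (w - z) *\<^sub>C (- res z (res z x))))) \<longlongrightarrow> 0) (at z within closed_sector \<eta>)"
  proof (rule Lim_null_comparison[OF _ tendsto_norm_zero, rotated])
    show "\<forall>\<^sub>F w in at z within closed_sector \<eta>. norm ((1 / norm (w - z)) *\<^sub>R (res w x - (res z x + (w - z) *\<^sub>C (- res z (res z x)))))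
       \<le> norm (res w (res z x) - res z (res z x))"
      unfolding eventually_at_filter
    proof (intro always_eventually allI impI)
      fix w assume w: "w \<noteq> z" "w \<in> closed_sector \<eta>"
      have "res w x - (res z x + (w - z) *\<^sub>C (- res z (res z x))) = (res w x - res z x) + (w - z) *\<^sub>C res z (res z x)"
        by (simp add: scaleC_minus_right)
      also have "res w x - res z x = (z - w) *\<^sub>C res w (res z x)"
        using resolvent_identity[OF z w(2), of x] res_commute[OF z w(2), of x] by simp
      also have "(z - w) *\<^sub>C res w (res z x) + (w - z) *\<^sub>C res z (res z x) = (z - w) *\<^sub>C (res w (res z x) - res z (res z x))"
        by (simp add: scaleC_diff_right scaleC_diff_left)
      finally show "norm ((1 / norm (w - z)) *\<^sub>R (res w x - (res z x + (w - z) *\<^sub>C (- res z (res z x)))))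
         \<le> norm (res w (res z x) - res z (res z x))"
        using w by (simp add: norm_scaleC norm_minus_commute)
    qed
  qed
qed

lemma continuous_on_res_res: "continuous_on (closed_sector \<eta>) (\<lambda>z. res z (res z x))"
  unfolding continuous_on_def
proof
  fix z assume z: "z \<in> closed_sector \<eta>"
  note nz = closed_sector_nonzero[OF z]
  have res_lim: "((\<lambda>w. res w y) \<longlongrightarrow> res z y) (at z within closed_sector \<eta>)" for y
    using continuous_on_res[of y] z by (auto simp: continuous_on_def)
  have "((\<lambda>w. M / cmod w * norm (res w x - res z x)) \<longlongrightarrow> M / cmod z * norm (res z x - res z x)) (at z within closed_sector \<eta>)"
    using nz by (intro tendsto_intros res_lim) auto
  then have "((\<lambda>w. M / cmod w * norm (res w x - res z x)) \<longlongrightarrow> 0) (at z within closed_sector \<eta>)" by simp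
  moreover have "\<forall>\<^sub>F w in at z within closed_sector \<eta>. norm (res w (res w x) - res w (res z x)) \<le> M / cmod w * norm (res w x - res z x)"
    unfolding eventually_at_filter
    using norm_res_le by (auto intro!: always_eventually simp flip: linear_diff[OF bounded_linear.linear[OF bounded_linear_res]])
  ultimately have "((\<lambda>w. res w (res w x) - res w (res z x)) \<longlongrightarrow> 0) (at z within closed_sector \<eta>)"
    by (rule Lim_null_comparison[rotated])
  from tendsto_add[OF this res_lim[of "res z x"]]
  show "((\<lambda>w. res w (res w x)) \<longlongrightarrow> res z (res z x)) (at z within closed_sector \<eta>)" by simp
qed

section \<open>Bounds for the Dunford integral\<close>

definition sg :: "real \<Rightarrow> 'a \<Rightarrow> 'a" where
  "sg t x = (if t = 0 then x else hankel r \<eta> (\<lambda>z. exp_shift \<omega> t z *\<^sub>C res z x))"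

text \<open>This is \<open>A (sg t x)\<close> for \<open>t > 0\<close>, as
  \<open>sg_in_D_A_sg\<close> shows. Taking \<open>A\<close> inside the integral from the start
  gives the norm bound and the continuity in \<open>t\<close> directly from contour
  estimates.\<close>

definition Asg :: "real \<Rightarrow> 'a \<Rightarrow> 'a" where
  "Asg t x = hankel r \<eta> (\<lambda>z. exp_shift \<omega> t z *\<^sub>C A (res z x))"

lemma contour_in_sector: "0 < R \<Longrightarrow> z \<in> hankel_contour R \<eta> \<Longrightarrow> z \<in> closed_sector \<eta>"
  using hankel_contour_subset by blast

lemma continuous_on_contour_res: "0 < R \<Longrightarrow> continuous_on (hankel_contour R \<eta>) (\<lambda>z. res z x)"
  using continuous_on_subset[OF continuous_on_res hankel_contour_subset] by blast

lemma norm_contour_res_le: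
  assumes "0 < R" "z \<in> hankel_contour R \<eta>"
  shows "norm (res z x) \<le> M / R * norm x"
proof -
  have "M / cmod z \<le> M / R" using hankel_contour_norm_ge[OF assms] assms M_pos by (intro frac_le) auto
  then show ?thesis
    by (intro order_trans[OF norm_res_le[OF contour_in_sector[OF assms]]] mult_right_mono) auto
qed

lemma res_decay:
  "0 < R \<Longrightarrow> 0 < t \<Longrightarrow> hankel_decay R \<eta> (- cos \<eta> * t) (exp (t * (\<omega> + 2 * R)) * (M / R * norm x)) (\<lambda>z. exp_shift \<omega> t z *\<^sub>C res z x)"
  by (intro exp_shift_decay continuous_on_contour_res norm_contour_res_le \<eta> \<eta>_pi)

lemma continuous_on_contour_A_res: "continuous_on (hankel_contour r \<eta>) (\<lambda>z. A (res z x))"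
proof -
  have "continuous_on (hankel_contour r \<eta>) (\<lambda>z. (of_real \<omega> + z) *\<^sub>C res z x - x)"
    by (intro continuous_intros continuous_on_contour_res r)
  then show ?thesis by (rule continuous_on_eq) (simp add: A_res[OF contour_in_sector[OF r]])
qed

text \<open>The summands bound the three parts of
  \<open>A (res z x) = \<omega> * res z x + z * res z x - x\<close>; in the middle one
  \<open>cmod z\<close> cancels against the resolvent estimate.\<close>

definition K_A :: real where "K_A = \<bar>\<omega>\<bar> * (M / r) + M + 1"

lemma norm_contour_A_res_le:
  assumes "z \<in> hankel_contour r \<eta>"
  shows "norm (A (res z x)) \<le> K_A * norm x"
proof -
  note z = contour_in_sector[OF r assms]
  have "norm (A (res z x)) \<le> norm (of_real \<omega> *\<^sub>C res z x) + norm (z *\<^sub>C res z x) + norm x"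
    unfolding A_res[OF z] scaleC_add_left by (intro order_trans[OF norm_triangle_ineq4] add_mono norm_triangle_ineq) auto
  also have "\<dots> \<le> \<bar>\<omega>\<bar> * (M / r * norm x) + cmod z * (M / cmod z * norm x) + norm x"
    unfolding norm_scaleC using norm_contour_res_le[OF r assms] norm_res_le[OF z]
    by (intro add_mono mult_mono) auto
  also have "\<dots> = K_A * norm x"
    using closed_sector_nonzero[OF z] by (simp add: K_A_def algebra_simps)
  finally show ?thesis .
qed

lemma A_res_decay:
  "0 < t \<Longrightarrow> hankel_decay r \<eta> (- cos \<eta> * t) (exp (t * (\<omega> + 2 * r)) * (K_A * norm x)) (\<lambda>z. exp_shift \<omega> t z *\<^sub>C A (res z x))"
  by (rule exp_shift_decay) (use r \<eta> \<eta>_pi in \<open>auto intro: continuous_on_contour_A_res norm_contour_A_res_le\<close>)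

text \<open>A fixed radius already gives the right rate, because \<open>A (res z x)\<close> is
  merely bounded on the contour and rays with decay rate \<open>- cos \<eta> * t\<close> contribute
  a multiple of \<open>1 / t\<close>.\<close>

lemma norm_Asg_le:
  assumes "0 < t" "t \<le> T"
  shows "norm (Asg t x) \<le> (exp (T * (\<bar>\<omega>\<bar> + 2 * r)) * K_A * (1 / - cos \<eta> + r * T)) / t * norm x"
proof -
  define k where "k = 1 / - cos \<eta>"
  have K: "0 \<le> K_A" using M_pos r by (simp add: K_A_def)
  have k: "0 < k" unfolding k_def using \<kappa>_pos by (intro divide_pos_pos) auto
  have "norm (Asg t x) \<le> exp (t * (\<omega> + 2 * r)) * (K_A * norm x) * (1 / (- cos \<eta> * t) + r)"
    unfolding Asg_def
    by (rule norm_hankel_exp_shift_le)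
       (use assms r \<eta> \<eta>_pi in \<open>auto intro: continuous_on_contour_A_res norm_contour_A_res_le\<close>)
  also have "\<dots> = exp (t * (\<omega> + 2 * r)) * ((K_A * norm x) * ((k + r * t) / t))"
    using assms \<kappa>_pos by (simp add: field_simps k_def)
  also have "\<dots> \<le> exp (T * (\<bar>\<omega>\<bar> + 2 * r)) * ((K_A * norm x) * ((k + r * T) / t))"
  proof (intro mult_mono mult_left_mono divide_right_mono add_mono order_refl)
    have "t * (\<omega> + 2 * r) \<le> t * (\<bar>\<omega>\<bar> + 2 * r)" using assms by (intro mult_left_mono) auto
    also have "\<dots> \<le> T * (\<bar>\<omega>\<bar> + 2 * r)" using assms r by (intro mult_right_mono) auto
    finally show "exp (t * (\<omega> + 2 * r)) \<le> exp (T * (\<bar>\<omega>\<bar> + 2 * r))" by simp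
  qed (use assms r K k in auto)
  finally show ?thesis by (simp add: mult_ac k_def)
qed

lemma sg_radius:
  assumes t: "0 < t" and R: "0 < R"
  shows "sg t x = hankel R \<eta> (\<lambda>z. exp_shift \<omega> t z *\<^sub>C res z x)"
proof -
  have "hankel r \<eta> (\<lambda>z. exp_shift \<omega> t z *\<^sub>C res z x) = hankel R \<eta> (\<lambda>z. exp_shift \<omega> t z *\<^sub>C res z x)"
  proof (rule hankel_radius[OF _ _ r R \<eta>_pos res_decay[OF r t] res_decay[OF R t]])
    show "continuous_on (closed_sector \<eta>) (\<lambda>z. (of_real t * exp_shift \<omega> t z) *\<^sub>C res z x + exp_shift \<omega> t z *\<^sub>C (- res z (res z x)))"
      by (intro continuous_intros continuous_on_res continuous_on_res_res)
    fix z assume z: "z \<in> closed_sector \<eta>"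
    have "(exp_shift \<omega> t has_field_derivative (of_real t * exp_shift \<omega> t z)) (at z within closed_sector \<eta>)"
      unfolding exp_shift_def by (auto intro!: derivative_eq_intros)
    then have "(exp_shift \<omega> t has_derivative (\<lambda>h. h * (of_real t * exp_shift \<omega> t z))) (at z within closed_sector \<eta>)"
      by (simp add: has_field_derivative_def mult_commute_abs)
    from bounded_bilinear.FDERIV[OF bounded_bilinear_scaleC this res_has_derivative[OF z, of x]]
    show "((\<lambda>z. exp_shift \<omega> t z *\<^sub>C res z x) has_derivative
       (\<lambda>h. h *\<^sub>C ((of_real t * exp_shift \<omega> t z) *\<^sub>C res z x + exp_shift \<omega> t z *\<^sub>C (- res z (res z x))))) (at z within closed_sector \<eta>)"
      by (simp add: scaleC_add_right scaleC_scaleC mult_ac add.commute)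
  qed
  then show ?thesis using t by (simp add: sg_def)
qed

text \<open>With radius \<open>1 / t\<close> the exponential stays bounded on the contour (the
  summand 2 in the exponent is \<open>2 * t * (1 / t)\<close>), and rays and arc both scale like
  \<open>1 / t\<close>.\<close>

lemma norm_hankel_inverse_radius_le:
  assumes "continuous_on (hankel_contour (1 / t) \<eta>) G" "\<And>z. z \<in> hankel_contour (1 / t) \<eta> \<Longrightarrow> norm (G z) \<le> K"
    and t: "0 < t" "t \<le> T" and K: "0 \<le> K"
  shows "norm (hankel (1 / t) \<eta> (\<lambda>z. exp_shift \<omega> t z *\<^sub>C G z)) \<le> (exp (T * \<bar>\<omega>\<bar> + 2) * (1 / - cos \<eta> + 1)) * (K / t)"
proof -
  have "norm (hankel (1 / t) \<eta> (\<lambda>z. exp_shift \<omega> t z *\<^sub>C G z)) \<le> exp (t * (\<omega> + 2 * (1 / t))) * K * (1 / (- cos \<eta> * t) + 1 / t)"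
    by (rule norm_hankel_exp_shift_le) (use assms \<eta> \<eta>_pi in auto)
  also have "t * (\<omega> + 2 * (1 / t)) = t * \<omega> + 2" using t by (simp add: field_simps)
  also have "exp (t * \<omega> + 2) * K * (1 / (- cos \<eta> * t) + 1 / t) = exp (t * \<omega> + 2) * ((1 / - cos \<eta> + 1) * (K / t))"
    using t \<kappa>_pos by (simp add: field_simps)
  also have "\<dots> \<le> exp (T * \<bar>\<omega>\<bar> + 2) * ((1 / - cos \<eta> + 1) * (K / t))"
  proof (intro mult_right_mono)
    have "t * \<omega> \<le> T * \<bar>\<omega>\<bar>" using t by (intro order_trans[OF mult_left_mono[OF abs_ge_self] mult_right_mono]) auto
    then show "exp (t * \<omega> + 2) \<le> exp (T * \<bar>\<omega>\<bar> + 2)" by simp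
  qed (use t K \<kappa>_pos in \<open>auto intro!: mult_nonneg_nonneg add_nonneg_nonneg divide_nonneg_nonneg\<close>)
  finally show ?thesis by (simp add: mult_ac)
qed

text \<open>The maximum with 1 covers the identity at time 0.\<close>

definition K_S :: "real \<Rightarrow> real" where "K_S T = max 1 (exp (T * \<bar>\<omega>\<bar> + 2) * (1 / - cos \<eta> + 1) * M)"

text \<open>At distance at least \<open>1 / t\<close> from the centre the resolvent is bounded by
  \<open>M * t\<close>, which cancels the factor \<open>1 / t\<close> from the contour.\<close>

lemma norm_sg_le:
  assumes t: "0 \<le> t" "t \<le> T"
  shows "norm (sg t x) \<le> K_S T * norm x"
proof (cases "t = 0")
  case True then show ?thesis using mult_right_mono[of 1 "K_S T" "norm x"] by (simp add: sg_def K_S_def)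
next
  case False
  with t have t0: "0 < t" by simp
  have "norm (sg t x) \<le> (exp (T * \<bar>\<omega>\<bar> + 2) * (1 / - cos \<eta> + 1)) * ((M / (1 / t) * norm x) / t)"
    unfolding sg_radius[OF t0, of "1 / t", OF divide_pos_pos[OF zero_less_one t0]]
    by (rule norm_hankel_inverse_radius_le[OF continuous_on_contour_res norm_contour_res_le])
       (use t t0 M_pos in auto)
  also have "\<dots> = (exp (T * \<bar>\<omega>\<bar> + 2) * (1 / - cos \<eta> + 1) * M) * norm x" using t0 by simp
  also have "\<dots> \<le> K_S T * norm x" unfolding K_S_def by (intro mult_right_mono) auto
  finally show ?thesis .
qed

section \<open>Linearity of the semigroup and its relation to the operator\<close>

lemma sg_add: "0 \<le> t \<Longrightarrow> sg t (x + y) = sg t x + sg t y"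
  and sg_scaleC: "0 \<le> t \<Longrightarrow> sg t (a *\<^sub>C x) = a *\<^sub>C sg t x"
proof -
  assume t: "0 \<le> t"
  show "sg t (x + y) = sg t x + sg t y"
  proof (cases "t = 0")
    case False
    then have t: "0 < t" using t by simp
    have "hankel r \<eta> (\<lambda>z. exp_shift \<omega> t z *\<^sub>C res z (x + y)) = hankel r \<eta> (\<lambda>z. exp_shift \<omega> t z *\<^sub>C res z x + exp_shift \<omega> t z *\<^sub>C res z y)"
      by (rule hankel_cong[OF _ \<eta>_pos])
         (simp add: contour_in_sector[OF r] linear_add[OF bounded_linear.linear[OF bounded_linear_res]] scaleC_add_right)
    then show ?thesis using hankel_add[OF res_decay[OF r t] res_decay[OF r t] r \<eta>_pos] t by (simp add: sg_def)
  qed (simp add: sg_def)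
  show "sg t (a *\<^sub>C x) = a *\<^sub>C sg t x"
  proof (cases "t = 0")
    case False
    then have t: "0 < t" using t by simp
    have "hankel r \<eta> (\<lambda>z. exp_shift \<omega> t z *\<^sub>C res z (a *\<^sub>C x)) = hankel r \<eta> (\<lambda>z. a *\<^sub>C (exp_shift \<omega> t z *\<^sub>C res z x))"
      by (rule hankel_cong[OF _ \<eta>_pos])
         (simp add: contour_in_sector[OF r] res_scaleC scaleC_scaleC mult.commute)
    then show ?thesis using hankel_scaleC[OF res_decay[OF r t] r \<eta>_pos] t by (simp add: sg_def)
  qed (simp add: sg_def)
qed

lemma bounded_linear_sg: "0 \<le> t \<Longrightarrow> bounded_linear (sg t)"
  by (rule bounded_linear_intro[of _ "K_S t"])
     (auto simp: sg_add sg_scaleC mult.commute[of "norm _"] norm_sg_le simp flip: scaleC_of_real)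

text \<open>Instead of closedness of \<open>A\<close>, one resolvent is used. With \<open>z0\<close>
  fixed, \<open>res z0\<close> maps the integral of \<open>(\<mu> - A) (res z x)\<close>, where
  \<open>\<mu> = \<omega> + z0\<close>, to \<open>sg t x\<close>. So \<open>sg t x\<close> lies in
  the range of \<open>res z0\<close>, which is contained in \<open>D\<close>, and
  \<open>A_res\<close> gives the value of \<open>A\<close> there.\<close>

lemma sg_in_D_A_sg:
  assumes t: "0 < t"
  shows "sg t x \<in> D \<and> A (sg t x) = Asg t x"
proof -
  define z0 where "z0 = of_real r * cis 0"
  have z0: "z0 \<in> closed_sector \<eta>" unfolding z0_def using r \<eta>_pos by (intro closed_sectorI) auto
  let ?\<mu> = "of_real \<omega> + z0"
  have d: "hankel_decay r \<eta> (- cos \<eta> * t) (exp (t * (\<omega> + 2 * r)) * ((cmod ?\<mu> * (M / r) + K_A) * norm x))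
      (\<lambda>z. exp_shift \<omega> t z *\<^sub>C (?\<mu> *\<^sub>C res z x - A (res z x)))"
  proof (rule exp_shift_decay[OF _ _ r \<eta> \<eta>_pi t])
    show "continuous_on (hankel_contour r \<eta>) (\<lambda>z. ?\<mu> *\<^sub>C res z x - A (res z x))"
      by (intro continuous_intros continuous_on_contour_res continuous_on_contour_A_res r)
    fix z assume z: "z \<in> hankel_contour r \<eta>"
    have "norm (?\<mu> *\<^sub>C res z x - A (res z x)) \<le> cmod ?\<mu> * (M / r * norm x) + K_A * norm x"
      using norm_contour_A_res_le[OF z] norm_contour_res_le[OF r z]
      by (intro order_trans[OF norm_triangle_ineq4] add_mono) (auto simp: norm_scaleC simp del: times_divide_eq_left intro!: mult_left_mono)
    then show "norm (?\<mu> *\<^sub>C res z x - A (res z x)) \<le> (cmod ?\<mu> * (M / r) + K_A) * norm x"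
      by (simp add: algebra_simps)
  qed
  have "?\<mu> *\<^sub>C sg t x = hankel r \<eta> (\<lambda>z. ?\<mu> *\<^sub>C (exp_shift \<omega> t z *\<^sub>C res z x))"
    using hankel_scaleC[OF res_decay[OF r t] r \<eta>_pos] t by (simp add: sg_def)
  also have "(\<lambda>z. ?\<mu> *\<^sub>C (exp_shift \<omega> t z *\<^sub>C res z x)) =
     (\<lambda>z. exp_shift \<omega> t z *\<^sub>C (?\<mu> *\<^sub>C res z x - A (res z x)) + exp_shift \<omega> t z *\<^sub>C A (res z x))"
    by (simp add: fun_eq_iff scaleC_scaleC scaleC_add_right[symmetric] mult.commute)
  finally have e: "?\<mu> *\<^sub>C sg t x - Asg t x = hankel r \<eta> (\<lambda>z. exp_shift \<omega> t z *\<^sub>C (?\<mu> *\<^sub>C res z x - A (res z x)))"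
    using hankel_add[OF d A_res_decay[OF t] r \<eta>_pos] by (simp add: Asg_def)
  have "res z0 (?\<mu> *\<^sub>C sg t x - Asg t x) = hankel r \<eta> (\<lambda>z. res z0 (exp_shift \<omega> t z *\<^sub>C (?\<mu> *\<^sub>C res z x - A (res z x))))"
    unfolding e by (rule hankel_bounded_linear[OF d r \<eta>_pos bounded_linear_res[OF z0] res_scaleC[OF z0]])
  also have "\<dots> = hankel r \<eta> (\<lambda>z. exp_shift \<omega> t z *\<^sub>C res z x)"
    by (rule hankel_cong[OF _ \<eta>_pos])
       (simp add: res_scaleC[OF z0] res_unique[OF z0 res_in_D[OF contour_in_sector[OF r]] refl])
  finally have eq: "sg t x = res z0 (?\<mu> *\<^sub>C sg t x - Asg t x)" using t by (simp add: sg_def)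
  have "A (sg t x) = ?\<mu> *\<^sub>C sg t x - (?\<mu> *\<^sub>C sg t x - Asg t x)"
    using A_res[OF z0, of "?\<mu> *\<^sub>C sg t x - Asg t x"] unfolding eq[symmetric] .
  then show ?thesis using res_in_D[OF z0, of "?\<mu> *\<^sub>C sg t x - Asg t x"] unfolding eq[symmetric] by simp
qed

lemmas sg_in_D = sg_in_D_A_sg[THEN conjunct1] and A_sg = sg_in_D_A_sg[THEN conjunct2]

lemma res_sg:
  assumes t: "0 < t" and z: "z \<in> closed_sector \<eta>"
  shows "res z (sg t x) = sg t (res z x)"
proof -
  have "res z (sg t x) = hankel r \<eta> (\<lambda>w. res z (exp_shift \<omega> t w *\<^sub>C res w x))"
    using hankel_bounded_linear[OF res_decay[OF r t] r \<eta>_pos bounded_linear_res[OF z] res_scaleC[OF z]] t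
    by (simp add: sg_def)
  also have "\<dots> = sg t (res z x)"
    using t by (auto simp: sg_def res_scaleC[OF z] res_commute[OF z contour_in_sector[OF r]] intro!: hankel_cong \<eta>_pos)
  finally show ?thesis .
qed

text \<open>Every \<open>y\<close> in \<open>D\<close> has the form \<open>res z x\<close>, so the
  claim reduces to the commutation of the semigroup with the resolvent.\<close>

lemma A_sg_commute:
  assumes t: "0 < t" and y: "y \<in> D"
  shows "A (sg t y) = sg t (A y)"
proof -
  define z where "z = of_real r * cis 0"
  have z: "z \<in> closed_sector \<eta>" unfolding z_def using r \<eta>_pos by (intro closed_sectorI) auto
  define x where "x = (of_real \<omega> + z) *\<^sub>C y - A y"
  interpret S: bounded_linear "sg t" by (rule bounded_linear_sg) (use t in simp)
  have y': "res z x = y" unfolding x_def by (rule res_unique[OF z y refl])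
  have "A (sg t y) = A (res z (sg t x))" by (simp add: res_sg[OF t z] y')
  also have "\<dots> = (of_real \<omega> + z) *\<^sub>C sg t y - sg t x" using A_res[OF z, of "sg t x"] by (simp add: res_sg[OF t z] y')
  also have "\<dots> = sg t (A y)" using t by (simp add: x_def S.diff sg_scaleC)
  finally show ?thesis .
qed

text \<open>For \<open>y\<close> in \<open>D\<close> one has
  \<open>res z y = y / z + res z w / z\<close> with \<open>w = A y - \<omega> * y\<close>. The first
  term integrates to \<open>exp (t * \<omega>) *\<^sub>R y\<close>. The second is of order
  \<open>t^2\<close> on the contour of radius \<open>1 / t\<close>, hence of order \<open>t\<close>
  after integration.\<close>

lemma sg_tendsto:
  assumes y: "y \<in> D"
  shows "((\<lambda>t. sg t y) \<longlongrightarrow> y) (at_right 0)"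
proof -
  define w where "w = A y - of_real \<omega> *\<^sub>C y"
  define C where "C = exp (1 * \<bar>\<omega>\<bar> + 2) * (1 / - cos \<eta> + 1) * (M * norm w)"
  have bd: "norm (sg t y - exp (t * \<omega>) *\<^sub>R y) \<le> C * t" if t: "0 < t" "t < 1" for t
  proof -
    have R: "0 < 1 / t" using t by simp
    have eq: "res z y = (1 / z) *\<^sub>C y + (1 / z) *\<^sub>C res z w" if "z \<in> hankel_contour (1 / t) \<eta>" for z
    proof -
      note z = contour_in_sector[OF R that]
      interpret bounded_linear "res z" by (rule bounded_linear_res[OF z])
      have "res z ((of_real \<omega> + z) *\<^sub>C y - A y) = y" by (rule res_unique[OF z y refl])
      then have "z *\<^sub>C res z y = y + res z w"
        unfolding w_def by (simp add: diff add res_scaleC[OF z] scaleC_add_left algebra_simps)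
      then show ?thesis using closed_sector_nonzero[OF z]
        by (simp add: scaleC_eq_iff inverse_eq_divide scaleC_add_right)
    qed
    note G1 = continuous_inverse_scaleC(1)[OF R, of \<eta> y] continuous_inverse_scaleC(2)[OF R, of _ \<eta> y]
    have G2: "continuous_on (hankel_contour (1 / t) \<eta>) (\<lambda>z. (1 / z) *\<^sub>C res z w)"
      using closed_sector_nonzero contour_in_sector[OF R] by (intro continuous_intros continuous_on_contour_res R) blast
    have G2': "norm ((1 / z) *\<^sub>C res z w) \<le> t\<^sup>2 * (M * norm w)" if "z \<in> hankel_contour (1 / t) \<eta>" for z
    proof -
      have "norm ((1 / z) *\<^sub>C res z w) \<le> (1 / cmod z) * (M / (1 / t) * norm w)"
        unfolding norm_scaleC using norm_contour_res_le[OF R that] by (simp add: norm_divide divide_right_mono)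
      also have "\<dots> \<le> (1 / (1 / t)) * (M / (1 / t) * norm w)"
        using hankel_contour_norm_ge[OF R that] R t M_pos
        by (intro mult_right_mono frac_le) auto
      finally show ?thesis by (simp add: power2_eq_square mult_ac)
    qed
    have "sg t y = hankel (1 / t) \<eta> (\<lambda>z. exp_shift \<omega> t z *\<^sub>C ((1 / z) *\<^sub>C y) + exp_shift \<omega> t z *\<^sub>C ((1 / z) *\<^sub>C res z w))"
      unfolding sg_radius[OF t(1) R] by (rule hankel_cong[OF _ \<eta>_pos]) (simp add: eq scaleC_add_right)
    also have "\<dots> = hankel (1 / t) \<eta> (\<lambda>z. exp_shift \<omega> t z *\<^sub>C ((1 / z) *\<^sub>C y)) + hankel (1 / t) \<eta> (\<lambda>z. exp_shift \<omega> t z *\<^sub>C ((1 / z) *\<^sub>C res z w))"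
      by (rule hankel_add[OF exp_shift_decay[OF G1 R \<eta> \<eta>_pi t(1)] exp_shift_decay[OF G2 G2' R \<eta> \<eta>_pi t(1)] R \<eta>_pos])
    also have "hankel (1 / t) \<eta> (\<lambda>z. exp_shift \<omega> t z *\<^sub>C ((1 / z) *\<^sub>C y)) = exp (t * \<omega>) *\<^sub>R y"
      unfolding exp_shift_def by (rule hankel_exp_inverse[OF R \<eta> \<eta>_pi t(1)])
    finally have "sg t y - exp (t * \<omega>) *\<^sub>R y = hankel (1 / t) \<eta> (\<lambda>z. exp_shift \<omega> t z *\<^sub>C ((1 / z) *\<^sub>C res z w))" by simp
    also have "norm \<dots> \<le> (exp (1 * \<bar>\<omega>\<bar> + 2) * (1 / - cos \<eta> + 1)) * ((t\<^sup>2 * (M * norm w)) / t)"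
      by (rule norm_hankel_inverse_radius_le[OF G2 G2']) (use t M_pos in auto)
    also have "\<dots> = C * t" using t by (simp add: C_def power2_eq_square)
    finally show ?thesis .
  qed
  have "((\<lambda>t. C * t) \<longlongrightarrow> C * 0) (at_right 0)" by (intro tendsto_intros)
  then have "((\<lambda>t. C * t) \<longlongrightarrow> 0) (at_right 0)" by simp
  then have "((\<lambda>t. sg t y - exp (t * \<omega>) *\<^sub>R y) \<longlongrightarrow> 0) (at_right 0)"
  proof (rule Lim_null_comparison[rotated])
    show "\<forall>\<^sub>F t in at_right 0. norm (sg t y - exp (t * \<omega>) *\<^sub>R y) \<le> C * t"
      unfolding eventually_at_right_field using bd by (intro exI[of _ 1]) auto
  qed
  moreover have "((\<lambda>t. exp (t * \<omega>) *\<^sub>R y) \<longlongrightarrow> exp (0 * \<omega>) *\<^sub>R y) (at_right 0)" by (intro tendsto_intros)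
  ultimately have "((\<lambda>t. sg t y - exp (t * \<omega>) *\<^sub>R y + exp (t * \<omega>) *\<^sub>R y) \<longlongrightarrow> 0 + exp (0 * \<omega>) *\<^sub>R y) (at_right 0)"
    by (rule tendsto_add)
  then show ?thesis by simp
qed

section \<open>Differentiability in time and the semigroup law\<close>

lemma bounded_linear_Asg:
  assumes t: "0 < t"
  shows "bounded_linear (Asg t)"
proof (rule bounded_linear_intro)
  interpret S: bounded_linear "sg t" by (rule bounded_linear_sg) (use t in simp)
  show "Asg t (x + y) = Asg t x + Asg t y" for x y
    unfolding A_sg[OF t, symmetric] S.add by (intro A_add sg_in_D t)
  show "Asg t (a *\<^sub>R x) = a *\<^sub>R Asg t x" for a x
    unfolding A_sg[OF t, symmetric] scaleC_of_real[symmetric]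
    using t by (simp add: sg_scaleC A_scaleC sg_in_D)
  show "norm (Asg t x) \<le> norm x * ((exp (t * (\<bar>\<omega>\<bar> + 2 * r)) * K_A * (1 / - cos \<eta> + r * t)) / t)" for x
    using norm_Asg_le[OF t order_refl, of x] by (simp only: mult.commute[of "norm x"])
qed

text \<open>The factors \<open>(\<omega> + z) * res z x\<close> and \<open>A (res z x)\<close>
  differ by the constant \<open>x\<close>, whose contour integral vanishes by
  \<open>hankel_exp_const\<close>.\<close>

lemma hankel_res_derivative:
  assumes t: "0 < t"
  shows "hankel r \<eta> (\<lambda>z. exp_shift \<omega> t z *\<^sub>C ((of_real \<omega> + z) *\<^sub>C res z x)) = Asg t x"
proof -
  have d: "hankel_decay r \<eta> (- cos \<eta> * t) (exp (t * (\<omega> + 2 * r)) * norm x) (\<lambda>z. exp_shift \<omega> t z *\<^sub>C x)"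
    by (rule exp_shift_decay[OF _ _ r \<eta> \<eta>_pi t]) auto
  have "hankel r \<eta> (\<lambda>z. exp_shift \<omega> t z *\<^sub>C ((of_real \<omega> + z) *\<^sub>C res z x))
     = hankel r \<eta> (\<lambda>z. exp_shift \<omega> t z *\<^sub>C A (res z x) + exp_shift \<omega> t z *\<^sub>C x)"
    by (rule hankel_cong[OF _ \<eta>_pos]) (simp add: A_res[OF contour_in_sector[OF r]] flip: scaleC_add_right)
  also have "\<dots> = Asg t x"
    using hankel_add[OF A_res_decay[OF t] d r \<eta>_pos] hankel_exp_const[OF r \<eta> \<eta>_pi t] by (simp add: Asg_def)
  finally show ?thesis .
qed

text \<open>The operator norm is needed for the product rule in
  \<open>S(u - \<sigma>) (S(\<sigma>) x)\<close>, and gives the continuity of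
  \<open>S(t - \<xi>) (q \<xi>)\<close> for \<open>\<xi> < t\<close> when \<open>q\<close> is
  continuous.\<close>

lemma Blinfun_sg_has_vector_derivative:
  assumes t: "0 < t"
  shows "((\<lambda>t. Blinfun (sg t)) has_vector_derivative Blinfun (Asg t)) (at t)"
proof -
  obtain d C where d: "0 < d" and *: "\<And>(G :: complex \<Rightarrow> 'a) K h.
     continuous_on (hankel_contour r \<eta>) G \<Longrightarrow> (\<And>z. z \<in> hankel_contour r \<eta> \<Longrightarrow> norm (G z) \<le> K) \<Longrightarrow> \<bar>h\<bar> \<le> d \<Longrightarrow>
     norm (hankel r \<eta> (\<lambda>z. exp_shift \<omega> (t + h) z *\<^sub>C G z) - hankel r \<eta> (\<lambda>z. exp_shift \<omega> t z *\<^sub>C G z)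
       - h *\<^sub>R hankel r \<eta> (\<lambda>z. exp_shift \<omega> t z *\<^sub>C ((of_real \<omega> + z) *\<^sub>C G z))) \<le> C * K * h\<^sup>2"
    using hankel_exp_shift_taylor[OF r \<eta> \<eta>_pi t, of \<omega>, where 'a='a] by blast
  show ?thesis
  proof (rule has_vector_derivative_quadratic)
    \<comment> \<open>The bound \<open>t / 2\<close> keeps \<open>t + h\<close> positive, where
      \<open>sg\<close> is given by the contour integral.\<close>
    show "0 < min d (t / 2)" using d t by simp
    fix h assume h: "\<bar>h\<bar> \<le> min d (t / 2)"
    then have th: "0 < t + h" using t by auto
    have bd: "norm (sg (t + h) x - sg t x - h *\<^sub>R Asg t x) \<le> (\<bar>C\<bar> * (M / r) * h\<^sup>2) * norm x" for x
    proof -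
      have "norm (sg (t + h) x - sg t x - h *\<^sub>R Asg t x) \<le> C * (M / r * norm x) * h\<^sup>2"
        using *[OF continuous_on_contour_res[OF r] norm_contour_res_le[OF r], of h x] h t th
        by (simp add: sg_def hankel_res_derivative)
      also have "\<dots> \<le> \<bar>C\<bar> * (M / r * norm x) * h\<^sup>2"
        using M_pos r by (intro mult_right_mono) auto
      finally show ?thesis by (simp add: mult_ac)
    qed
    show "norm (Blinfun (sg (t + h)) - Blinfun (sg t) - h *\<^sub>R Blinfun (Asg t)) \<le> (\<bar>C\<bar> * (M / r)) * h\<^sup>2"
    proof (rule norm_blinfun_bound)
      show "norm (blinfun_apply (Blinfun (sg (t + h)) - Blinfun (sg t) - h *\<^sub>R Blinfun (Asg t)) x) \<le> (\<bar>C\<bar> * (M / r)) * h\<^sup>2 * norm x" for x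
        using bd[of x] t th
        by (simp add: blinfun.diff_left blinfun.scaleR_left bounded_linear_Blinfun_apply bounded_linear_sg bounded_linear_Asg)
    qed (use M_pos r in auto)
  qed
qed

lemma blinfun_apply_sg: "0 \<le> t \<Longrightarrow> blinfun_apply (Blinfun (sg t)) x = sg t x"
  by (simp add: bounded_linear_Blinfun_apply bounded_linear_sg)

lemma sg_has_vector_derivative:
  assumes t: "0 < t"
  shows "((\<lambda>t. sg t x) has_vector_derivative Asg t x) (at t)"
proof -
  have "((\<lambda>t. blinfun_apply (Blinfun (sg t)) x) has_vector_derivative Asg t x) (at t)"
    using bounded_linear.has_vector_derivative[OF blinfun.bounded_linear_left Blinfun_sg_has_vector_derivative[OF t], of x]
    by (simp add: bounded_linear_Blinfun_apply bounded_linear_Asg t)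
  then show ?thesis
    by (rule has_vector_derivative_transform_within_open[of _ _ _ "{0<..}"]) (use t in \<open>auto simp: blinfun_apply_sg\<close>)
qed

lemma continuous_on_Blinfun_sg: "continuous_on {0<..} (\<lambda>t. Blinfun (sg t))"
  by (rule continuous_on_vector_derivative, rule has_vector_derivative_at_within,
      rule Blinfun_sg_has_vector_derivative) simp

lemma continuous_on_Asg: "continuous_on {0<..} (\<lambda>t. Asg t x)"
proof (rule continuous_on_vector_derivative)
  fix t :: real assume "t \<in> {0<..}"
  then show "((\<lambda>t. Asg t x) has_vector_derivative
      hankel r \<eta> (\<lambda>z. exp_shift \<omega> t z *\<^sub>C ((of_real \<omega> + z) *\<^sub>C A (res z x)))) (at t within {0<..})"
    unfolding Asg_def
    by (intro has_vector_derivative_at_within[OF hankel_exp_shift_has_vector_derivative[of _ _ _ "K_A * norm x"]]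
          continuous_on_contour_A_res norm_contour_A_res_le r \<eta> \<eta>_pi) auto
qed

text \<open>\<open>\<sigma> \<mapsto> S(u - \<sigma>) S(\<sigma>) x\<close> has derivative zero, and its value is found by letting
  \<open>\<sigma> \<rightarrow> u\<close>.\<close>

lemma sg_semigroup:
  assumes "0 \<le> a" "0 \<le> b"
  shows "sg a (sg b x) = sg (a + b) x"
proof (cases "a = 0 \<or> b = 0")
  case False
  with assms have ab: "0 < a" "0 < b" by auto
  define u where "u = a + b"
  define V where "V \<sigma> = sg (u - \<sigma>) (sg \<sigma> x)" for \<sigma>
  have "(V has_vector_derivative 0) (at \<sigma> within {0<..<u})" if \<sigma>: "\<sigma> \<in> {0<..<u}" for \<sigma>
  proof -
    have "((\<lambda>\<sigma>. u - \<sigma>) has_real_derivative (0 - 1)) (at \<sigma>)" by (intro derivative_intros)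
    then have d: "((\<lambda>\<sigma>. u - \<sigma>) has_vector_derivative - 1) (at \<sigma>)"
      by (simp add: has_real_derivative_iff_has_vector_derivative)
    have "((\<lambda>\<sigma>. Blinfun (sg (u - \<sigma>))) has_vector_derivative (- 1) *\<^sub>R Blinfun (Asg (u - \<sigma>))) (at \<sigma>)"
      using vector_diff_chain_at[OF d Blinfun_sg_has_vector_derivative[of "u - \<sigma>"]] \<sigma> by (simp add: o_def)
    from bounded_bilinear.has_vector_derivative[OF bounded_bilinear_blinfun_apply this sg_has_vector_derivative[of \<sigma> x]]
    have "((\<lambda>\<sigma>. blinfun_apply (Blinfun (sg (u - \<sigma>))) (sg \<sigma> x)) has_vector_derivative
        sg (u - \<sigma>) (Asg \<sigma> x) - Asg (u - \<sigma>) (sg \<sigma> x)) (at \<sigma>)"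
      using \<sigma> by (simp add: blinfun_apply_sg blinfun.minus_left bounded_linear_Blinfun_apply bounded_linear_Asg)
    moreover have "sg (u - \<sigma>) (Asg \<sigma> x) = Asg (u - \<sigma>) (sg \<sigma> x)"
      using \<sigma> A_sg_commute[of "u - \<sigma>" "sg \<sigma> x"] by (simp add: sg_in_D A_sg)
    ultimately have "((\<lambda>\<sigma>. blinfun_apply (Blinfun (sg (u - \<sigma>))) (sg \<sigma> x)) has_vector_derivative 0) (at \<sigma>)" by simp
    then have "(V has_vector_derivative 0) (at \<sigma>)"
      by (rule has_vector_derivative_transform_within_open[of _ _ _ "{0<..<u}"]) (use \<sigma> in \<open>auto simp: blinfun_apply_sg V_def\<close>)
    then show ?thesis by (rule has_vector_derivative_at_within)
  qed
  then obtain k where k: "\<And>\<sigma>. \<sigma> \<in> {0<..<u} \<Longrightarrow> V \<sigma> = k"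
    using has_vector_derivative_zero_constant[of "{0<..<u}" V] by auto
  have u: "0 < u" using ab by (simp add: u_def)
  \<comment> \<open>With \<open>\<sigma> = u - h\<close> the constant is
    \<open>k = sg h (sg (u - h) x)\<close>. Its distance to \<open>sg u x\<close> has two parts: one
    tends to 0 by continuity of the orbit at \<open>u > 0\<close> and the uniform bound, the other
    by \<open>sg_tendsto\<close>, since \<open>sg u x\<close> lies in \<open>D\<close>.\<close>
  have "((\<lambda>h. K_S u * norm (sg (u - h) x - sg u x) + norm (sg h (sg u x) - sg u x)) \<longlongrightarrow> K_S u * norm (sg (u - 0) x - sg u x) + norm (sg u x - sg u x)) (at_right 0)"
  proof (intro tendsto_intros sg_tendsto sg_in_D u)
    have "isCont (\<lambda>t. sg t x) u" using sg_has_vector_derivative[OF u] has_vector_derivative_continuous by blast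
    moreover have "((\<lambda>h. u - h) \<longlongrightarrow> u - 0) (at_right 0)" by (intro tendsto_intros)
    ultimately show "((\<lambda>h. sg (u - h) x) \<longlongrightarrow> sg (u - 0) x) (at_right 0)"
      using isCont_tendsto_compose[of u "\<lambda>t. sg t x" "\<lambda>h. u - h" "at_right 0"] by simp
  qed
  then have "((\<lambda>h. K_S u * norm (sg (u - h) x - sg u x) + norm (sg h (sg u x) - sg u x)) \<longlongrightarrow> 0) (at_right 0)" by simp
  moreover have "\<forall>\<^sub>F h in at_right 0. norm (k - sg u x) \<le> K_S u * norm (sg (u - h) x - sg u x) + norm (sg h (sg u x) - sg u x)"
    unfolding eventually_at_right_field
  proof (intro exI[of _ u] conjI allI impI u)
    fix h assume h: "0 < h" "h < u"
    interpret S: bounded_linear "sg h" by (rule bounded_linear_sg) (use h in simp)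
    have "k = sg h (sg (u - h) x)" using k[of "u - h"] h by (simp add: V_def)
    then have "k - sg u x = sg h (sg (u - h) x - sg u x) + (sg h (sg u x) - sg u x)" by (simp add: S.diff)
    also have "norm \<dots> \<le> K_S u * norm (sg (u - h) x - sg u x) + norm (sg h (sg u x) - sg u x)"
      using h by (intro norm_triangle_mono norm_sg_le) auto
    finally show "norm (k - sg u x) \<le> K_S u * norm (sg (u - h) x - sg u x) + norm (sg h (sg u x) - sg u x)" .
  qed
  ultimately have "norm (k - sg u x) \<le> 0" by (rule tendsto_lowerbound) simp
  moreover have "V b = k" using k[of b] ab by (simp add: u_def)
  ultimately show ?thesis by (simp add: V_def u_def)
qed (auto simp: sg_def)

lemma Asg_sg: "0 < t \<Longrightarrow> 0 \<le> s \<Longrightarrow> Asg t (sg s x) = Asg (t + s) x"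
  using sg_semigroup[of t s x] A_sg[of t "sg s x"] A_sg[of "t + s" x] by simp

lemma Asg_sg_commute: "0 < t \<Longrightarrow> 0 \<le> s \<Longrightarrow> Asg t (sg s x) = sg s (Asg t x)"
proof (cases "s = 0")
  case False
  assume "0 < t" "0 \<le> s"
  with False have "sg s (Asg t x) = A (sg s (sg t x))"
    using A_sg_commute[of s "sg t x"] by (simp add: sg_in_D A_sg)
  also have "\<dots> = Asg t (sg s x)"
    using \<open>0 < t\<close> \<open>0 \<le> s\<close> by (simp add: sg_semigroup add.commute flip: A_sg)
  finally show ?thesis ..
qed (simp add: sg_def)

section \<open>Convolutions with the semigroup\<close>

definition conv :: "real \<Rightarrow> (real \<Rightarrow> 'a) \<Rightarrow> 'a" where
  "conv t q = integral {0..t} (\<lambda>\<xi>. sg (t - \<xi>) (q \<xi>))"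

text \<open>For \<open>b = t\<close> continuity may fail at the endpoint, where the semigroup
  reaches time 0 without strong continuity; on the half-open interval the integrand is continuous
  and bounded.\<close>

lemma sg_conv_integrable:
  assumes q: "continuous_on {a..b} q" and bt: "b \<le> t"
  shows "(\<lambda>\<xi>. sg (t - \<xi>) (q \<xi>)) integrable_on {a..b}"
proof -
  obtain B where B: "\<And>\<xi>. \<xi> \<in> {a..b} \<Longrightarrow> norm (q \<xi>) \<le> B"
    using compact_imp_bounded[OF compact_continuous_image[OF q compact_Icc]] unfolding bounded_iff by blast
  have "continuous_on {a..<b} (\<lambda>\<xi>. blinfun_apply (Blinfun (sg (t - \<xi>))) (q \<xi>))"
    by (intro continuous_intros continuous_on_compose2[OF continuous_on_Blinfun_sg] continuous_on_subset[OF q])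
       (use bt in auto)
  then have "continuous_on {a..<b} (\<lambda>\<xi>. sg (t - \<xi>) (q \<xi>))"
    by (rule continuous_on_eq) (use bt in \<open>auto simp: blinfun_apply_sg\<close>)
  then show ?thesis
  proof (rule integrable_bounded_continuous_left)
    fix \<xi> assume \<xi>: "\<xi> \<in> {a..<b}"
    have K: "0 \<le> K_S (t - a)" by (simp add: K_S_def)
    have "norm (sg (t - \<xi>) (q \<xi>)) \<le> K_S (t - a) * norm (q \<xi>)" using \<xi> bt by (intro norm_sg_le) auto
    also have "\<dots> \<le> K_S (t - a) * B" using B[of \<xi>] \<xi> K by (intro mult_left_mono) auto
    finally show "norm (sg (t - \<xi>) (q \<xi>)) \<le> K_S (t - a) * B" .
  qed
qed

lemma K_S_ge: "1 \<le> K_S t"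
  by (simp add: K_S_def)

lemma norm_conv_le:
  assumes q: "continuous_on {0..t} q" "\<And>\<xi>. \<xi> \<in> {0..t} \<Longrightarrow> norm (q \<xi>) \<le> e" and t: "0 \<le> t" "t \<le> T"
  shows "norm (conv t q) \<le> K_S T * t * e"
proof -
  have "norm (conv t q) \<le> integral {0..t} (\<lambda>\<xi>. K_S T * e)"
    unfolding conv_def
  proof (rule integral_norm_bound_integral[OF sg_conv_integrable[OF q(1) order_refl]])
    fix \<xi> assume \<xi>: "\<xi> \<in> {0..t}"
    have "norm (sg (t - \<xi>) (q \<xi>)) \<le> K_S T * norm (q \<xi>)" using \<xi> t by (intro norm_sg_le) auto
    also have "\<dots> \<le> K_S T * e" using q(2)[OF \<xi>] K_S_ge[of T] by (intro mult_left_mono) auto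
    finally show "norm (sg (t - \<xi>) (q \<xi>)) \<le> K_S T * e" .
  qed auto
  also have "\<dots> = K_S T * t * e" using t by simp
  finally show ?thesis .
qed

lemma has_integral_reciprocal:
  fixes s t :: real
  assumes "0 < s" "0 \<le> t"
  shows "((\<lambda>\<xi>. 1 / (s + (t - \<xi>))) has_integral ln (1 + t / s)) {0..t}"
proof -
  have "((\<lambda>\<xi>. 1 / (s + (t - \<xi>))) has_integral (- ln (s + (t - t)) - - ln (s + (t - 0)))) {0..t}"
    by (rule fundamental_theorem_of_calculus[OF assms(2)], unfold has_real_derivative_iff_has_vector_derivative[symmetric])
       (use assms in \<open>auto intro!: derivative_eq_intros\<close>)
  moreover have "- ln (s + (t - t)) - - ln (s + (t - 0)) = ln (1 + t / s)"
  proof -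
    have "1 + t / s = (s + t) / s" using assms by (simp add: field_simps)
    then show ?thesis using assms by (simp add: ln_div)
  qed
  ultimately show ?thesis by simp
qed

definition K_B :: "real \<Rightarrow> real" where
  "K_B T = exp (T * (\<bar>\<omega>\<bar> + 2 * r)) * K_A * (1 / - cos \<eta> + r * T)"

lemma K_B_nonneg: "0 \<le> T \<Longrightarrow> 0 \<le> K_B T"
  unfolding K_B_def K_A_def
  using M_pos r less_imp_le[OF divide_pos_pos[OF zero_less_one \<kappa>_pos]]
  by (intro mult_nonneg_nonneg add_nonneg_nonneg) auto

lemma norm_Asg_le': "0 < t \<Longrightarrow> t \<le> T \<Longrightarrow> norm (Asg t x) \<le> K_B T / t * norm x"
  using norm_Asg_le unfolding K_B_def .

text \<open>\<open>Asg s\<close> is bounded for \<open>s > 0\<close>, so it passes under the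
  integral and merges with \<open>S(t - \<xi>)\<close> to the time \<open>s + (t - \<xi>)\<close>.
  The bound by the reciprocal of this time integrates to a logarithm: one integration turns the
  singularity \<open>1 / s\<close> into a logarithmic one.\<close>

lemma norm_Asg_conv_le:
  assumes q: "continuous_on {0..t} q" "\<And>\<xi>. \<xi> \<in> {0..t} \<Longrightarrow> norm (q \<xi>) \<le> e"
    and s: "0 < s" and t: "0 \<le> t" "s + t \<le> T"
  shows "norm (Asg s (conv t q)) \<le> K_B T * e * ln (1 + t / s)"
proof -
  note int = sg_conv_integrable[OF q(1) order_refl]
  have int': "(\<lambda>\<xi>. Asg s (sg (t - \<xi>) (q \<xi>))) integrable_on {0..t}"
    using integrable_linear[OF int bounded_linear_Asg[OF s]] by (simp add: o_def)
  have eq: "Asg s (conv t q) = integral {0..t} (\<lambda>\<xi>. Asg s (sg (t - \<xi>) (q \<xi>)))"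
    unfolding conv_def using integral_linear[OF int bounded_linear_Asg[OF s]] by (simp add: o_def)
  have "norm (Asg s (conv t q)) \<le> integral {0..t} (\<lambda>\<xi>. K_B T * e * (1 / (s + (t - \<xi>))))"
    unfolding eq
  proof (rule integral_norm_bound_integral[OF int'])
    show "(\<lambda>\<xi>. K_B T * e * (1 / (s + (t - \<xi>)))) integrable_on {0..t}"
      by (intro integrable_on_mult_right has_integral_integrable[OF has_integral_reciprocal] s t)
    fix \<xi> assume \<xi>: "\<xi> \<in> {0..t}"
    have "norm (Asg s (sg (t - \<xi>) (q \<xi>))) \<le> K_B T / (s + (t - \<xi>)) * norm (q \<xi>)"
      using \<xi> s t norm_Asg_le'[of "s + (t - \<xi>)" T "q \<xi>"] by (simp add: Asg_sg)
    also have "\<dots> \<le> K_B T / (s + (t - \<xi>)) * e"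
      using q(2)[OF \<xi>] \<xi> s t K_B_nonneg[of T] by (intro mult_left_mono) auto
    finally show "norm (Asg s (sg (t - \<xi>) (q \<xi>))) \<le> K_B T * e * (1 / (s + (t - \<xi>)))" by simp
  qed
  also have "\<dots> = K_B T * e * ln (1 + t / s)"
    by (rule integral_unique[OF has_integral_mult_right[OF has_integral_reciprocal[OF s t(1)]]])
  finally show ?thesis .
qed

lemma conv_split:
  assumes q: "continuous_on {0..a + b} q" and "0 \<le> a" "0 \<le> b"
  shows "conv (a + b) q = sg b (conv a q) + conv b (\<lambda>\<xi>. q (a + \<xi>))"
proof -
  have qa: "continuous_on {0..a} q"
    by (rule continuous_on_subset[OF q]) (use assms(2,3) in simp)
  have qb: "continuous_on {a..a + b} q"
    by (rule continuous_on_subset[OF q]) (use assms(2,3) in simp)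
  let ?f = "\<lambda>\<xi>. sg (a + b - \<xi>) (q \<xi>)"
  have "conv (a + b) q = integral {0..a} ?f + integral {a..a + b} ?f"
    unfolding conv_def
    by (rule Henstock_Kurzweil_Integration.integral_combine[OF _ _ sg_conv_integrable[OF q order_refl], symmetric])
       (use assms(2,3) in auto)
  also have "integral {0..a} ?f = integral {0..a} (\<lambda>\<xi>. sg b (sg (a - \<xi>) (q \<xi>)))"
    by (rule integral_cong) (use assms(3) in \<open>simp add: sg_semigroup algebra_simps\<close>)
  also have "\<dots> = sg b (conv a q)"
    unfolding conv_def using integral_linear[OF sg_conv_integrable[OF qa order_refl] bounded_linear_sg[OF assms(3)]] by (simp add: o_def)
  also have "integral {a..a + b} ?f = conv b (\<lambda>\<xi>. q (a + \<xi>))"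
  proof -
    have "(?f has_integral integral {a..a + b} ?f) {a..a + b}"
      by (intro integrable_integral sg_conv_integrable qb order_refl)
    then have "(?f has_integral integral {a..a + b} ?f) (cbox a (a + b))" by (simp only: cbox_interval)
    from has_integral_affinity[OF this, of 1 a]
    have "((\<lambda>\<xi>. sg (a + b - (\<xi> + a)) (q (\<xi> + a))) has_integral integral {a..a + b} ?f) {0..b}"
      by simp
    moreover have "a + b - (\<xi> + a) = b - \<xi>" for \<xi> by simp
    ultimately show ?thesis unfolding conv_def by (simp only: integral_unique add.commute[of _ a])
  qed
  finally show ?thesis .
qed

lemma conv_add:
  assumes "continuous_on {0..t} p" "continuous_on {0..t} q" "0 \<le> t"
  shows "conv t (\<lambda>\<xi>. p \<xi> + q \<xi>) = conv t p + conv t q"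
proof -
  have "conv t (\<lambda>\<xi>. p \<xi> + q \<xi>) = integral {0..t} (\<lambda>\<xi>. sg (t - \<xi>) (p \<xi>) + sg (t - \<xi>) (q \<xi>))"
    unfolding conv_def by (rule integral_cong) (simp add: sg_add)
  also have "\<dots> = conv t p + conv t q"
    unfolding conv_def by (intro Henstock_Kurzweil_Integration.integral_add sg_conv_integrable assms order_refl)
  finally show ?thesis .
qed

lemma conv_scaleC:
  assumes "continuous_on {0..t} q" "0 \<le> t"
  shows "conv t (\<lambda>\<xi>. a *\<^sub>C q \<xi>) = a *\<^sub>C conv t q"
proof -
  have "conv t (\<lambda>\<xi>. a *\<^sub>C q \<xi>) = integral {0..t} (\<lambda>\<xi>. a *\<^sub>C sg (t - \<xi>) (q \<xi>))"
    unfolding conv_def by (rule integral_cong) (simp add: sg_scaleC)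
  also have "\<dots> = a *\<^sub>C conv t q"
    unfolding conv_def using integral_linear[OF sg_conv_integrable[OF assms(1) order_refl] bounded_linear_scaleC]
    by (simp add: o_def)
  finally show ?thesis .
qed

end

section \<open>Linear independence of the phi functions\<close>

text \<open>Integration by parts in \<open>\<xi>\<close>, with \<open>F\<close> collecting the
  boundary terms. For \<open>k = 0\<close> the power \<open>\<xi> ^ k\<close> is constantly 1, also
  at \<open>\<xi> = 0\<close>, so it contributes no derivative and the lower boundary term supplies
  \<open>exp z = phi 0 z\<close>.\<close>

lemma phi_Suc:
  "z * phi (Suc k) z = phi k z - 1 / fact k"
proof -
  define F where "F \<xi> = - (exp (of_real (1 - \<xi>) * z) * of_real (\<xi> ^ k / fact k))" for \<xi> :: real
  define f where "f k \<xi> = exp (of_real (1 - \<xi>) * z) * of_real (\<xi> ^ (k - 1) / fact (k - 1))" for k and \<xi> :: real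
  have int: "f k integrable_on {0..1}" for k
    unfolding f_def by (intro integrable_continuous_interval continuous_intros) auto
  have phi: "phi (Suc k) z = integral {0..1} (f (Suc k))" for k
    by (simp add: phi_def f_def[abs_def])
  have deriv: "(F has_vector_derivative (z * f (Suc k) \<xi> - (if k = 0 then 0 else f k \<xi>))) (at \<xi> within {0..1})" for \<xi>
  proof -
    have e: "((\<lambda>\<xi>. exp (of_real (1 - \<xi>) * z)) has_vector_derivative - z * exp (of_real (1 - \<xi>) * z)) (at \<xi> within {0..1})"
    proof -
      have "((\<lambda>\<xi>. of_real (1 - \<xi>) * z) has_vector_derivative - z) (at \<xi> within {0..1})"
        by (auto intro!: derivative_eq_intros simp: has_vector_derivative_def scaleR_conv_of_real)
      from field_vector_diff_chain_within[OF this, of exp "exp (of_real (1 - \<xi>) * z)"]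
      show ?thesis by (simp add: o_def DERIV_exp has_field_derivative_at_within)
    qed
    have p: "((\<lambda>\<xi>. complex_of_real (\<xi> ^ k / fact k)) has_vector_derivative
        of_real (if k = 0 then 0 else \<xi> ^ (k - 1) / fact (k - 1))) (at \<xi> within {0..1})"
    proof (rule has_vector_derivative_of_real)
      show "((\<lambda>\<xi>. \<xi> ^ k / fact k) has_real_derivative (if k = 0 then 0 else \<xi> ^ (k - 1) / fact (k - 1))) (at \<xi> within {0..1})"
        using DERIV_cdivide[OF DERIV_pow[of k \<xi> "{0..1}"], of "fact k"]
        by (cases k) (simp_all del: of_nat_Suc)
    qed
    show ?thesis
      unfolding F_def f_def
      by (rule has_vector_derivative_eq_rhs[OF has_vector_derivative_minus[OF has_vector_derivative_mult[OF e p]]])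
         (auto simp: algebra_simps)
  qed
  have "((\<lambda>\<xi>. z * f (Suc k) \<xi> - (if k = 0 then 0 else f k \<xi>)) has_integral (F 1 - F 0)) {0..1}"
    by (rule fundamental_theorem_of_calculus[OF _ deriv]) auto
  moreover have "((\<lambda>\<xi>. z * f (Suc k) \<xi> - (if k = 0 then 0 else f k \<xi>)) has_integral
      (z * phi (Suc k) z - (if k = 0 then 0 else phi k z))) {0..1}"
  proof (rule has_integral_diff)
    show "((\<lambda>\<xi>. z * f (Suc k) \<xi>) has_integral (z * phi (Suc k) z)) {0..1}"
      unfolding phi by (intro has_integral_mult_right integrable_integral int)
    show "((\<lambda>\<xi>. if k = 0 then 0 else f k \<xi>) has_integral (if k = 0 then 0 else phi k z)) {0..1}"
      using integrable_integral[OF int[of k]] phi[of "k - 1"] by (cases k) auto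
  qed
  ultimately have "z * phi (Suc k) z - (if k = 0 then 0 else phi k z) = F 1 - F 0"
    by (rule has_integral_unique[symmetric])
  then show ?thesis by (cases k) (auto simp: F_def phi_def algebra_simps)
qed

lemma power_mult_phi: "z ^ k * phi k z = exp z - (\<Sum>j<k. z ^ j / fact j)"
proof (induction k)
  case (Suc k)
  have "z ^ Suc k * phi (Suc k) z = z ^ k * (z * phi (Suc k) z)" by simp
  also have "\<dots> = exp z - (\<Sum>j<Suc k. z ^ j / fact j)"
    using Suc by (simp add: phi_Suc algebra_simps)
  finally show ?case .
qed (simp add: phi_def)

text \<open>By the periodicity of \<open>exp\<close>, the relation persists as a polynomial identity with
  \<open>e\<^sup>z\<close> frozen at any value.\<close>

lemma exp_poly_independent:
  fixes Q R :: "complex poly"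
  assumes eq: "\<And>z. poly Q z * exp z = poly R z"
  shows "Q = 0"
proof -
  have *: "smult (exp z) Q = R" for z
  proof (rule ccontr)
    assume ne: "smult (exp z) Q \<noteq> R"
    define g where "g m = z + of_nat m * (2 * of_real pi * \<i>)" for m :: nat
    have "exp (g m) = exp z" for m
      unfolding exp_eq g_def by (intro exI[of _ "int m"]) simp
    then have "poly (smult (exp z) Q - R) (g m) = 0" for m
      using eq[of "g m"] by (simp add: mult.commute)
    then have "range g \<subseteq> {w. poly (smult (exp z) Q - R) w = 0}" by auto
    moreover have "finite {w. poly (smult (exp z) Q - R) w = 0}"
      using ne by (intro poly_roots_finite) simp
    ultimately have "finite (range g)" by (rule finite_subset)
    moreover have "inj g" by (auto simp: inj_def g_def)
    ultimately show False using finite_imageD infinite_UNIV_nat by blast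
  qed
  \<comment> \<open>The exponential takes the values 1 and -1 at these points, so both
    \<open>Q\<close> and \<open>- Q\<close> equal \<open>R\<close>.\<close>
  have "Q = - Q" using *[of 0] *[of "of_real pi * \<i>"] by simp
  then show ?thesis by simp
qed

text \<open>Multiplied by \<open>z ^ N\<close>, the relation becomes \<open>Q * exp z = R\<close>
  with polynomials by \<open>power_mult_phi\<close>. The coefficients \<open>a k\<close> occupy the
  distinct degrees \<open>N - k\<close> of \<open>Q\<close>, so \<open>Q = 0\<close> determines all
  of them.\<close>

lemma phi_independent:
  assumes eq: "\<And>z. (\<Sum>k<N. a k * phi k z) = 0" and k: "k < N"
  shows "a k = 0"
proof -
  define Q where "Q = (\<Sum>k<N. monom (a k) (N - k))"
  define R where "R = (\<Sum>k<N. \<Sum>j<k. monom (a k / fact j) (N - k + j))"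
  have "poly Q z * exp z = poly R z" for z
  proof -
    have "poly R z = (\<Sum>k<N. a k * z ^ (N - k) * (\<Sum>j<k. z ^ j / fact j))"
      unfolding R_def poly_sum poly_monom power_add sum_distrib_left by (intro sum.cong refl) simp
    moreover have "poly Q z * exp z = (\<Sum>k<N. a k * z ^ (N - k) * exp z)"
      by (simp add: Q_def poly_sum poly_monom sum_distrib_right)
    ultimately have "poly Q z * exp z - poly R z = (\<Sum>k<N. a k * z ^ (N - k) * (exp z - (\<Sum>j<k. z ^ j / fact j)))"
      by (simp add: right_diff_distrib sum_subtractf)
    also have "\<dots> = (\<Sum>k<N. z ^ N * (a k * phi k z))"
    proof (rule sum.cong[OF refl])
      fix k assume k: "k \<in> {..<N}"
      have "z ^ N = z ^ (N - k) * z ^ k" using k by (simp flip: power_add)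
      then show "a k * z ^ (N - k) * (exp z - (\<Sum>j<k. z ^ j / fact j)) = z ^ N * (a k * phi k z)"
        by (simp flip: power_mult_phi)
    qed
    also have "\<dots> = 0" using eq[of z] by (simp flip: sum_distrib_left)
    finally show ?thesis by simp
  qed
  then have "Q = 0" by (rule exp_poly_independent)
  then have "0 = coeff Q (N - k)" by simp
  also have "\<dots> = (\<Sum>k'<N. if k' = k then a k' else 0)"
    unfolding Q_def coeff_sum using k by (intro sum.cong) auto
  also have "\<dots> = a k" using k by simp
  finally show ?thesis by simp
qed

lemma weight_padded:
  assumes "length \<beta> \<le> N"
  shows "weight \<beta> z = (\<Sum>k<N. (if k < length \<beta> then \<beta> ! k else 0) * phi k z)"
  unfolding weight_def using assms by (intro sum.mono_neutral_cong_left) auto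

text \<open>Covers both conditions on the weights: constant nodes 1 with \<open>m = 1\<close>, and
  the actual nodes with \<open>m = 2\<close>. Padding the coefficient lists with zeros to a common
  length \<open>N\<close> makes independence applicable.\<close>

lemma weight_coefficients:
  assumes eq: "\<And>z. (\<Sum>i = 1..s. weight (b i) z * of_real (c i)) = phi m z"
    and N: "\<And>i. i \<in> {1..s} \<Longrightarrow> length (b i) \<le> N" "m < N" and k: "k < N"
  shows "(\<Sum>i = 1..s. (if k < length (b i) then b i ! k else 0) * of_real (c i)) = (if k = m then 1 else (0::complex))"
proof -
  define \<beta> where "\<beta> i k = (if k < length (b i) then b i ! k else 0)" for i k
  have "(\<Sum>k<N. ((\<Sum>i = 1..s. \<beta> i k * of_real (c i)) - (if k = m then 1 else 0)) * phi k z) = 0" for z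
  proof -
    have "(\<Sum>i = 1..s. weight (b i) z * of_real (c i)) = (\<Sum>i = 1..s. \<Sum>k<N. \<beta> i k * of_real (c i) * phi k z)"
      by (intro sum.cong refl, subst weight_padded[OF N(1)]) (simp_all add: \<beta>_def sum_distrib_left sum_distrib_right mult_ac)
    also have "\<dots> = (\<Sum>k<N. (\<Sum>i = 1..s. \<beta> i k * of_real (c i)) * phi k z)"
      by (subst sum.swap) (simp add: sum_distrib_right)
    finally have "(\<Sum>k<N. (\<Sum>i = 1..s. \<beta> i k * of_real (c i)) * phi k z) = phi m z" by (simp add: eq)
    moreover have "(\<Sum>k<N. (if k = m then 1 else 0) * phi k z) = (\<Sum>k<N. if k = m then phi k z else 0)"
      by (intro sum.cong) auto
    ultimately show ?thesis using N(2) by (simp add: left_diff_distrib sum_subtractf)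
  qed
  from phi_independent[where a = "\<lambda>k. (\<Sum>i = 1..s. \<beta> i k * of_real (c i)) - (if k = m then 1 else 0)", OF this k]
  show ?thesis by (simp add: \<beta>_def)
qed

section \<open>A weighted norm on the unit interval\<close>

text \<open>The majorant is split at \<open>t = \<tau>\<close>. Below, the logarithm is bounded by a
  small power of \<open>\<tau> / t\<close>, which keeps the product integrable at 0 as
  \<open>\<alpha> < 1\<close>. Above, \<open>ln (1 + x) \<le> x\<close> leaves
  \<open>t powr (- \<alpha> - 1)\<close>, integrable at infinity as \<open>\<alpha> > 0\<close>.
  Both parts are multiples of \<open>\<tau> powr (1 - \<alpha>)\<close>. Integrating the majorant
  over the whole half line spares a distinction between \<open>\<tau> < 1\<close> and
  \<open>\<tau> \<ge> 1\<close>.\<close>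

lemma Lp01_log_weight:
  assumes \<alpha>: "0 < \<alpha>" "\<alpha> < 1" and \<tau>: "0 < \<tau>" and E: "0 \<le> E"
    and v: "continuous_on {0<..<1} v"
    and bd: "\<And>t. t \<in> {0<..<1} \<Longrightarrow> 0 \<le> v t \<and> v t \<le> E * (t powr (- \<alpha>) * ln (1 + \<tau> / t))"
  shows "v \<in> Lp01 1" "Lp01_norm 1 v \<le> E * ((8 / (1 - \<alpha>)\<^sup>2 * 2 powr ((1 - \<alpha>) / 2) + 1 / \<alpha>) * \<tau> powr (1 - \<alpha>))"
proof -
  \<comment> \<open>Half of the available exponent \<open>1 - \<alpha>\<close> is spent on the
    logarithm, the other half on integrability at 0.\<close>
  define \<beta> where "\<beta> = (1 - \<alpha>) / 2"
  have \<beta>: "0 < \<beta>" "\<beta> < 1" "1 - \<alpha> - \<beta> = \<beta>" using \<alpha> by (auto simp: \<beta>_def field_simps)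
  define h1 where "h1 t = 2 * 2 powr \<beta> / \<beta> * \<tau> powr \<beta> * t powr (- \<alpha> - \<beta>)" for t
  define h2 where "h2 t = \<tau> * t powr (- \<alpha> - 1)" for t
  \<comment> \<open>At \<open>t = \<tau>\<close> both terms count, which only enlarges the
    majorant.\<close>
  define h where "h t = (if t \<in> {0..\<tau>} then h1 t else 0) + (if t \<in> {\<tau>..} then h2 t else 0)" for t
  define I where "I = (8 / (1 - \<alpha>)\<^sup>2 * 2 powr ((1 - \<alpha>) / 2) + 1 / \<alpha>) * \<tau> powr (1 - \<alpha>)"
  have h_int: "(h has_integral I) {0..}"
  proof -
    have "((\<lambda>t. h1 t) has_integral (2 * 2 powr \<beta> / \<beta> * \<tau> powr \<beta> * (\<tau> powr (- \<alpha> - \<beta> + 1) / (- \<alpha> - \<beta> + 1)))) {0..\<tau>}"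
      unfolding h1_def by (intro has_integral_mult_right has_integral_powr_from_0) (use \<alpha> \<beta> \<tau> in auto)
    also have "- \<alpha> - \<beta> + 1 = \<beta>" using \<beta> by simp
    also have "2 * 2 powr \<beta> / \<beta> * \<tau> powr \<beta> * (\<tau> powr \<beta> / \<beta>) = 8 / (1 - \<alpha>)\<^sup>2 * 2 powr \<beta> * \<tau> powr (1 - \<alpha>)"
    proof -
      have "\<tau> powr \<beta> * \<tau> powr \<beta> = \<tau> powr (1 - \<alpha>)" by (simp add: \<beta>_def flip: powr_add)
      moreover have "2 / (\<beta> * \<beta>) = 8 / (1 - \<alpha>)\<^sup>2" by (simp add: \<beta>_def power2_eq_square)
      ultimately show ?thesis
        by (simp flip: \<open>\<tau> powr \<beta> * \<tau> powr \<beta> = \<tau> powr (1 - \<alpha>)\<close> \<open>2 / (\<beta> * \<beta>) = 8 / (1 - \<alpha>)\<^sup>2\<close>)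
    qed
    finally have 1: "(h1 has_integral (8 / (1 - \<alpha>)\<^sup>2 * 2 powr \<beta> * \<tau> powr (1 - \<alpha>))) {0..\<tau>}" .
    have "((\<lambda>t. h2 t) has_integral (\<tau> * (- (\<tau> powr (- \<alpha> - 1 + 1)) / (- \<alpha> - 1 + 1)))) {\<tau>..}"
      unfolding h2_def by (intro has_integral_mult_right has_integral_powr_to_inf) (use \<alpha> \<tau> in auto)
    also have "\<tau> * (- (\<tau> powr (- \<alpha> - 1 + 1)) / (- \<alpha> - 1 + 1)) = 1 / \<alpha> * \<tau> powr (1 - \<alpha>)"
      using \<tau> by (simp add: powr_diff powr_minus field_simps)
    finally have 2: "(h2 has_integral (1 / \<alpha> * \<tau> powr (1 - \<alpha>))) {\<tau>..}" .
    have "(h has_integral (8 / (1 - \<alpha>)\<^sup>2 * 2 powr \<beta> * \<tau> powr (1 - \<alpha>) + 1 / \<alpha> * \<tau> powr (1 - \<alpha>))) {0..}"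
      unfolding h_def
      by (intro has_integral_add; subst has_integral_restrict) (use 1 2 \<tau> in auto)
    then show ?thesis by (simp add: I_def \<beta>_def algebra_simps)
  qed
  have h_nonneg: "0 \<le> h t" for t
    using \<beta> \<tau> by (simp add: h_def h1_def h2_def)
  have S: "{0<..<1::real} \<in> sets lebesgue" by simp
  have h_abs: "h absolutely_integrable_on {0..}"
    using h_int h_nonneg by (intro nonnegative_absolutely_integrable_1) auto
  then have h_abs': "h absolutely_integrable_on {0<..<1}"
    by (rule set_integrable_subset) auto
  have hL: "integrable (lebesgue_on {0<..<1}) h"
    by (rule absolutely_integrable_imp_integrable[OF h_abs' S])
  have "integral {0<..<1} h \<le> integral {0..} h"
    using h_int h_nonneg h_abs' by (intro integral_subset_le) (auto simp: absolutely_integrable_on_def)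
  then have hI: "integral\<^sup>L (lebesgue_on {0<..<1}) h \<le> I"
    using lebesgue_integral_eq_integral[OF hL S] integral_unique[OF h_int] by simp
  have weight: "t powr (- \<alpha>) * ln (1 + \<tau> / t) \<le> h t" if t: "0 < t" for t
  proof (cases "t \<le> \<tau>")
    case True
    have "ln (1 + \<tau> / t) \<le> (1 + \<tau> / t) powr \<beta> / \<beta>" using t \<tau> \<beta> by (intro ln_powr_bound) auto
    also have "\<dots> \<le> (2 * (\<tau> / t)) powr \<beta> / \<beta>"
      using t True \<beta> by (intro divide_right_mono powr_mono2) (auto simp: field_simps)
    also have "\<dots> \<le> 2 * ((2 * (\<tau> / t)) powr \<beta> / \<beta>)"
      using divide_nonneg_pos[OF powr_ge_zero \<beta>(1), of "2 * (\<tau> / t)" \<beta>] by linarith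
    also have "\<dots> = 2 * 2 powr \<beta> / \<beta> * \<tau> powr \<beta> * t powr (- \<beta>)"
      using t \<tau> by (simp add: powr_mult powr_divide powr_minus divide_simps)
    finally have "t powr (- \<alpha>) * ln (1 + \<tau> / t) \<le> t powr (- \<alpha>) * (2 * 2 powr \<beta> / \<beta> * \<tau> powr \<beta> * t powr (- \<beta>))"
      by (intro mult_left_mono) auto
    also have "\<dots> = h1 t" by (simp add: h1_def powr_diff powr_minus divide_simps)
    also have "\<dots> \<le> h t" using True t \<tau> by (simp add: h_def h2_def)
    finally show ?thesis .
  next
    case False
    have "ln (1 + \<tau> / t) \<le> \<tau> / t" using t \<tau> by (intro ln_add_one_self_le_self) auto
    then have "t powr (- \<alpha>) * ln (1 + \<tau> / t) \<le> t powr (- \<alpha>) * (\<tau> / t)" by (intro mult_left_mono) auto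
    also have "\<dots> = h t" using False t by (simp add: h_def h2_def powr_diff)
    finally show ?thesis .
  qed
  have vm: "v \<in> borel_measurable (lebesgue_on {0<..<1})"
    by (rule continuous_imp_measurable_on_sets_lebesgue[OF v S])
  have v_le: "\<bar>v t\<bar> \<le> E * h t" if "t \<in> {0<..<1}" for t
    using bd[OF that] mult_left_mono[OF weight E, of t] that by auto
  have EhL: "integrable (lebesgue_on {0<..<1}) (\<lambda>t. E * h t)" using hL by simp
  have vL: "integrable (lebesgue_on {0<..<1}) v"
    by (rule Bochner_Integration.integrable_bound[OF EhL vm])
       (use v_le in \<open>auto intro!: AE_I2 simp: order_trans[OF _ abs_ge_self]\<close>)
  then have vaL: "integrable (lebesgue_on {0<..<1}) (\<lambda>t. \<bar>v t\<bar>)" by simp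
  show "v \<in> Lp01 1" using vm vaL by (simp add: Lp01_def)
  have "integral\<^sup>L (lebesgue_on {0<..<1}) (\<lambda>t. \<bar>v t\<bar>) \<le> integral\<^sup>L (lebesgue_on {0<..<1}) (\<lambda>t. E * h t)"
    using v_le by (intro integral_mono[OF vaL EhL]) auto
  also have "\<dots> \<le> E * I" using hI E by (simp add: mult_left_mono)
  finally have "integral\<^sup>L (lebesgue_on {0<..<1}) (\<lambda>t. \<bar>v t\<bar>) \<le> E * I" .
  moreover have "0 \<le> integral\<^sup>L (lebesgue_on {0<..<1}) (\<lambda>t. \<bar>v t\<bar>)" by (intro integral_nonneg_AE) auto
  ultimately show "Lp01_norm 1 v \<le> E * ((8 / (1 - \<alpha>)\<^sup>2 * 2 powr ((1 - \<alpha>) / 2) + 1 / \<alpha>) * \<tau> powr (1 - \<alpha>))"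
    by (simp add: Lp01_norm_def I_def)
qed

section \<open>The local error\<close>

locale sectorial_choice = sectorial_contour +
  assumes choice: "(SOME p. admissible_contour D A p) = (\<omega>, r, \<eta>)"
begin

lemma analytic_semigroup_eq: "analytic_semigroup D A t x = sg t x"
  by (simp add: analytic_semigroup_def choice sg_def dunford_integral_def hankel_def hankel_ray_def
      hankel_arc_def exp_shift_def res_def Let_def)

lemma mild_solution_eq: "mild_solution D A g u t = sg t u + conv t g"
  by (simp add: mild_solution_def conv_def analytic_semigroup_eq)

section \<open>The operators phi_k(tA)\<close>

lemma phi_op_0: "phi_op D A 0 t x = sg t x"
  by (simp add: phi_op_def analytic_semigroup_eq)

text \<open>Rescaling the unit interval to \<open>{0..t}\<close> turns
  \<open>t * phi_(k+1)(tA) x\<close> into a convolution with a monomial, so that every estimate for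
  \<open>conv\<close> applies to the method as well as to the exact solution.\<close>

lemma phi_op_Suc_integrable:
  assumes t: "0 < t"
  shows "(\<lambda>\<xi>. (\<xi> ^ k / fact k) *\<^sub>R sg ((1 - \<xi>) * t) x) integrable_on {0..1}"
    and "t *\<^sub>R phi_op D A (Suc k) t x = conv t (\<lambda>\<xi>. ((\<xi> / t) ^ k / fact k) *\<^sub>R x)"
proof -
  let ?g = "\<lambda>\<xi>. sg (t - \<xi>) (((\<xi> / t) ^ k / fact k) *\<^sub>R x)"
  have "(?g has_integral conv t (\<lambda>\<xi>. ((\<xi> / t) ^ k / fact k) *\<^sub>R x)) {0..t}"
    unfolding conv_def by (intro integrable_integral sg_conv_integrable continuous_intros) (use t in auto)
  from has_integral_stretch_real[OF this, of t]
  have "((\<lambda>\<xi>. ?g (t * \<xi>)) has_integral (1 / t) *\<^sub>R conv t (\<lambda>\<xi>. ((\<xi> / t) ^ k / fact k) *\<^sub>R x)) {0..1}"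
    using t by simp
  moreover have "?g (t * \<xi>) = (\<xi> ^ k / fact k) *\<^sub>R sg ((1 - \<xi>) * t) x" if "\<xi> \<in> {0..1}" for \<xi>
  proof -
    have "t - t * \<xi> = (1 - \<xi>) * t" by (simp add: algebra_simps)
    moreover have "0 \<le> (1 - \<xi>) * t" using that t by simp
    ultimately show ?thesis
      using t linear_scale[OF bounded_linear.linear[OF bounded_linear_sg[of "(1 - \<xi>) * t"]]] by simp
  qed
  ultimately have *: "((\<lambda>\<xi>. (\<xi> ^ k / fact k) *\<^sub>R sg ((1 - \<xi>) * t) x) has_integral
      (1 / t) *\<^sub>R conv t (\<lambda>\<xi>. ((\<xi> / t) ^ k / fact k) *\<^sub>R x)) {0..1}"
    by (rule has_integral_eq[rotated])
  then show "(\<lambda>\<xi>. (\<xi> ^ k / fact k) *\<^sub>R sg ((1 - \<xi>) * t) x) integrable_on {0..1}" by blast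
  show "t *\<^sub>R phi_op D A (Suc k) t x = conv t (\<lambda>\<xi>. ((\<xi> / t) ^ k / fact k) *\<^sub>R x)"
    using integral_unique[OF *] t by (simp add: phi_op_def analytic_semigroup_eq)
qed

lemma phi_op_add:
  assumes t: "0 < t"
  shows "phi_op D A k t (x + y) = phi_op D A k t x + phi_op D A k t y"
proof (cases k)
  case 0 then show ?thesis using t by (simp add: phi_op_0 sg_add)
next
  case (Suc m)
  have c: "continuous_on {0..t} (\<lambda>\<xi>. ((\<xi> / t) ^ m / fact m) *\<^sub>R z)" for z :: 'a
    using t by (intro continuous_intros) auto
  have "t *\<^sub>R phi_op D A k t (x + y) = t *\<^sub>R (phi_op D A k t x + phi_op D A k t y)"
    using conv_add[OF c[of x] c[of y]] t unfolding Suc scaleR_add_right phi_op_Suc_integrable(2)[OF t] by simp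
  then show ?thesis using t by simp
qed

lemma phi_op_scaleC:
  assumes t: "0 < t"
  shows "phi_op D A k t (a *\<^sub>C x) = a *\<^sub>C phi_op D A k t x"
proof (cases k)
  case 0 then show ?thesis using t by (simp add: phi_op_0 sg_scaleC)
next
  case (Suc m)
  have c: "continuous_on {0..t} (\<lambda>\<xi>. ((\<xi> / t) ^ m / fact m) *\<^sub>R z)" for z :: 'a
    using t by (intro continuous_intros) auto
  have "t *\<^sub>R phi_op D A k t (a *\<^sub>C x) = t *\<^sub>R (a *\<^sub>C phi_op D A k t x)"
    using conv_scaleC[OF c[of x], of a] t unfolding Suc scaleC_scaleR_commute[symmetric] phi_op_Suc_integrable(2)[OF t]
    by (simp add: scaleC_scaleR_commute)
  then show ?thesis using t by simp
qed

lemma norm_ratio_le: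
  assumes "\<xi> \<in> {0..t}" "0 < t"
  shows "norm (((\<xi> / t) ^ k / fact k) *\<^sub>R x) \<le> norm x"
proof -
  have "(\<xi> / t) ^ k / fact k \<le> 1 / 1"
    using assms by (intro frac_le power_le_one) (auto simp: fact_ge_1)
  then show ?thesis using assms mult_right_mono[of "(\<xi> / t) ^ k / fact k" 1 "norm x"] by simp
qed

lemma norm_phi_op_le:
  assumes t: "0 < t" "t \<le> T"
  shows "norm (phi_op D A k t x) \<le> K_S T * norm x"
proof (cases k)
  case 0 then show ?thesis using t by (simp add: phi_op_0 norm_sg_le)
next
  case (Suc m)
  have "norm (t *\<^sub>R phi_op D A k t x) \<le> K_S T * t * norm x"
    unfolding Suc phi_op_Suc_integrable(2)[OF t(1)]
    by (rule norm_conv_le) (use t norm_ratio_le in \<open>auto intro!: continuous_intros\<close>)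
  then show ?thesis using t by (simp add: mult_ac)
qed

lemma Asg_scaleC: "0 < t \<Longrightarrow> Asg t (a *\<^sub>C x) = a *\<^sub>C Asg t x"
  by (simp add: sg_scaleC A_scaleC sg_in_D flip: A_sg)

text \<open>For \<open>k = 0\<close> there is no integration to weaken the singularity, but
  \<open>t / (s + t) \<le> ln (1 + t / s)\<close> puts this case under the same bound as the
  convolutions.\<close>

lemma norm_Asg_phi_op_le:
  assumes s: "0 < s" and t: "0 < t" "s + t \<le> T"
  shows "norm (Asg s (t *\<^sub>R phi_op D A k t x)) \<le> K_B T * norm x * ln (1 + t / s)"
proof (cases k)
  case 0
  have K: "0 \<le> K_B T" using s t by (intro K_B_nonneg) auto
  have "norm (Asg s (t *\<^sub>R phi_op D A k t x)) = t * norm (Asg (s + t) x)"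
    using s t linear_scale[OF bounded_linear.linear[OF bounded_linear_Asg[OF s]]] by (simp add: 0 phi_op_0 Asg_sg)
  also have "\<dots> \<le> t * (K_B T / (s + t) * norm x)"
    using s t by (intro mult_left_mono norm_Asg_le') auto
  also have "\<dots> = K_B T * norm x * (t / (s + t))" by simp
  also have "\<dots> \<le> K_B T * norm x * ln (1 + t / s)"
  proof (intro mult_left_mono)
    have "ln (s / (s + t)) \<le> s / (s + t) - 1" using s t by (intro ln_le_minus_one) auto
    moreover have "s / (s + t) - 1 = - (t / (s + t))" using s t by (simp add: field_simps)
    moreover have "ln (s / (s + t)) = - ln (1 + t / s)"
    proof -
      have "1 + t / s = (s + t) / s" using s by (simp add: field_simps)
      then show ?thesis using s t by (simp add: ln_div)
    qed
    ultimately show "t / (s + t) \<le> ln (1 + t / s)" by linarith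
  qed (use K in auto)
  finally show ?thesis .
next
  case (Suc m)
  show ?thesis
    unfolding Suc phi_op_Suc_integrable(2)[OF t(1)]
    by (rule norm_Asg_conv_le) (use s t norm_ratio_le in \<open>auto intro!: continuous_intros\<close>)
qed

text \<open>Time is measured from the beginning of the step, and the defect depends only on the
  right-hand side \<open>q\<close> there. It is additive in \<open>q\<close>, so the affine Taylor
  polynomial can be split off.\<close>

definition local_error :: "nat \<Rightarrow> (nat \<Rightarrow> real) \<Rightarrow> (nat \<Rightarrow> complex list) \<Rightarrow> real \<Rightarrow> (real \<Rightarrow> 'a) \<Rightarrow> 'a" where
  "local_error s c b \<tau> q = \<tau> *\<^sub>R (\<Sum>i = 1..s. weight_op D A (b i) \<tau> (q (c i * \<tau>))) - conv \<tau> q"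

lemma local_error_add:
  assumes "0 < \<tau>" "continuous_on {0..\<tau>} p" "continuous_on {0..\<tau>} q"
  shows "local_error s c b \<tau> (\<lambda>\<xi>. p \<xi> + q \<xi>) = local_error s c b \<tau> p + local_error s c b \<tau> q"
  using assms
  by (simp add: local_error_def conv_add weight_op_def phi_op_add scaleC_add_right sum.distrib scaleR_add_right)

definition weight_sum :: "nat \<Rightarrow> (nat \<Rightarrow> complex list) \<Rightarrow> real" where
  "weight_sum s b = (\<Sum>i = 1..s. \<Sum>k<length (b i). cmod (b i ! k))"

section \<open>Bounds for the defect of one step\<close>

context
  fixes s :: nat and c :: "nat \<Rightarrow> real" and b :: "nat \<Rightarrow> complex list" and \<tau> e T :: real and q :: "real \<Rightarrow> 'a"
  assumes c: "\<And>i. i \<in> {1..s} \<Longrightarrow> c i \<in> {0..1}" and \<tau>: "0 < \<tau>" "\<tau> \<le> T"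
    and q: "continuous_on {0..\<tau>} q" "\<And>\<xi>. \<xi> \<in> {0..\<tau>} \<Longrightarrow> norm (q \<xi>) \<le> e"
begin

lemma q_node: "i \<in> {1..s} \<Longrightarrow> norm (q (c i * \<tau>)) \<le> e"
  using c[of i] \<tau> by (intro q(2)) (auto simp: mult_le_cancel_right1)

lemma norm_local_error_le: "norm (local_error s c b \<tau> q) \<le> (weight_sum s b + 1) * (K_S T * \<tau> * e)"
proof -
  have "norm (\<tau> *\<^sub>R (\<Sum>i = 1..s. weight_op D A (b i) \<tau> (q (c i * \<tau>)))) \<le> \<tau> * (\<Sum>i = 1..s. \<Sum>k<length (b i). cmod (b i ! k) * (K_S T * e))"
    unfolding norm_scaleR weight_op_def
  proof (intro mult_mono order_trans[OF norm_sum] sum_mono)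
    fix i k assume i: "i \<in> {1..s}"
    have "norm (phi_op D A k \<tau> (q (c i * \<tau>))) \<le> K_S T * norm (q (c i * \<tau>))" by (rule norm_phi_op_le[OF \<tau>])
    also have "\<dots> \<le> K_S T * e" using q_node[OF i] K_S_ge[of T] by (intro mult_left_mono) auto
    finally show "norm (b i ! k *\<^sub>C phi_op D A k \<tau> (q (c i * \<tau>))) \<le> cmod (b i ! k) * (K_S T * e)"
      by (simp add: norm_scaleC mult_left_mono)
  qed (use \<tau> in auto)
  also have "\<dots> = weight_sum s b * (K_S T * \<tau> * e)"
    by (simp add: weight_sum_def sum_distrib_right sum_distrib_left mult_ac)
  finally have "norm (local_error s c b \<tau> q) \<le> weight_sum s b * (K_S T * \<tau> * e) + K_S T * \<tau> * e"
    unfolding local_error_def using \<tau>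
    by (intro order_trans[OF norm_triangle_ineq4] add_mono norm_conv_le[OF q]) auto
  then show ?thesis by (simp add: algebra_simps)
qed

text \<open>The constant is taken at \<open>T + 1\<close> because the times
  \<open>t + \<tau>\<close> with \<open>t \<le> 1\<close> and \<open>\<tau> \<le> T\<close>
  occur.\<close>

lemma norm_Asg_local_error_le:
  assumes t: "0 < t" "t \<le> 1"
  shows "norm (Asg t (local_error s c b \<tau> q)) \<le> (weight_sum s b + 1) * (K_B (T + 1) * e * ln (1 + \<tau> / t))"
proof -
  interpret B: bounded_linear "Asg t" by (rule bounded_linear_Asg[OF t(1)])
  have K: "0 \<le> K_B (T + 1)" using \<tau> by (intro K_B_nonneg) auto
  have ln: "0 \<le> ln (1 + \<tau> / t)" using t \<tau> by (intro ln_ge_zero) auto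
  have eq: "Asg t (\<tau> *\<^sub>R (\<Sum>i = 1..s. weight_op D A (b i) \<tau> (q (c i * \<tau>))))
      = (\<Sum>i = 1..s. \<Sum>k<length (b i). b i ! k *\<^sub>C Asg t (\<tau> *\<^sub>R phi_op D A k \<tau> (q (c i * \<tau>))))"
    by (simp add: weight_op_def B.scaleR B.sum Asg_scaleC[OF t(1)] scaleR_sum_right scaleC_scaleR_commute)
  have "norm (Asg t (\<tau> *\<^sub>R (\<Sum>i = 1..s. weight_op D A (b i) \<tau> (q (c i * \<tau>)))))
      \<le> (\<Sum>i = 1..s. \<Sum>k<length (b i). cmod (b i ! k) * (K_B (T + 1) * e * ln (1 + \<tau> / t)))"
    unfolding eq
  proof (intro order_trans[OF norm_sum] sum_mono)
    fix i k assume i: "i \<in> {1..s}"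
    have "norm (Asg t (\<tau> *\<^sub>R phi_op D A k \<tau> (q (c i * \<tau>)))) \<le> K_B (T + 1) * norm (q (c i * \<tau>)) * ln (1 + \<tau> / t)"
      using t \<tau> by (intro norm_Asg_phi_op_le) auto
    also have "\<dots> \<le> K_B (T + 1) * e * ln (1 + \<tau> / t)"
      using q_node[OF i] K ln by (intro mult_left_mono mult_right_mono) auto
    finally show "norm (b i ! k *\<^sub>C Asg t (\<tau> *\<^sub>R phi_op D A k \<tau> (q (c i * \<tau>)))) \<le> cmod (b i ! k) * (K_B (T + 1) * e * ln (1 + \<tau> / t))"
      by (simp add: norm_scaleC mult_left_mono)
  qed
  also have "\<dots> = weight_sum s b * (K_B (T + 1) * e * ln (1 + \<tau> / t))"
    by (simp add: weight_sum_def sum_distrib_right)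
  finally have 1: "norm (Asg t (\<tau> *\<^sub>R (\<Sum>i = 1..s. weight_op D A (b i) \<tau> (q (c i * \<tau>)))))
      \<le> weight_sum s b * (K_B (T + 1) * e * ln (1 + \<tau> / t))" .
  have 2: "norm (Asg t (conv \<tau> q)) \<le> K_B (T + 1) * e * ln (1 + \<tau> / t)"
    using t \<tau> by (intro norm_Asg_conv_le[OF q]) auto
  show ?thesis
    using order_trans[OF norm_triangle_ineq4 add_mono[OF 1 2]]
    unfolding local_error_def B.diff by (simp only: ring_distribs mult_1_left)
qed

end

text \<open>By \<open>weight_coefficients\<close> the scalar conditions hold coefficient by
  coefficient, hence also for operators. The quadrature thus produces
  \<open>\<tau> * phi_1(\<tau>A) x\<close> and \<open>\<tau> * phi_2(\<tau>A) (\<tau> * y)\<close>,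
  which are the convolutions with \<open>x\<close> and with
  \<open>\<xi> *\<^sub>R y\<close>.\<close>

lemma local_error_affine:
  assumes w1: "\<And>z. (\<Sum>i = 1..s. weight (b i) z) = phi 1 z"
    and w2: "\<And>z. (\<Sum>i = 1..s. weight (b i) z * of_real (c i)) = phi 2 z"
    and \<tau>: "0 < \<tau>"
  shows "local_error s c b \<tau> (\<lambda>\<xi>. x + \<xi> *\<^sub>R y) = 0"
proof -
  \<comment> \<open>The summand 3 makes room for the indices 1 and 2 even if all lists are
    shorter.\<close>
  define N where "N = Max (insert 0 ((\<lambda>i. length (b i)) ` {1..s})) + 3"
  have "length (b i) \<le> Max (insert 0 ((\<lambda>i. length (b i)) ` {1..s}))" if "i \<in> {1..s}" for i
    using that by (intro Max_ge) auto
  then have N: "length (b i) \<le> N" if "i \<in> {1..s}" for i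
    using that unfolding N_def by (meson le_add1 order_trans)
  have N': "1 < N" "2 < N" by (auto simp: N_def)
  define \<beta> where "\<beta> i k = (if k < length (b i) then b i ! k else 0)" for i k
  have s1: "(\<Sum>i = 1..s. \<beta> i k) = (if k = 1 then 1 else 0)" if "k < N" for k
    using weight_coefficients[of b "\<lambda>i. 1" s 1 N k] w1 N N' that by (simp add: \<beta>_def)
  have s2: "(\<Sum>i = 1..s. \<beta> i k * of_real (c i)) = (if k = 2 then 1 else 0)" if "k < N" for k
    using weight_coefficients[of b c s 2 N k] w2 N N' that by (simp add: \<beta>_def)
  let ?\<Phi> = "phi_op D A"
  have W: "weight_op D A (b i) \<tau> z = (\<Sum>k<N. \<beta> i k *\<^sub>C ?\<Phi> k \<tau> z)" if "i \<in> {1..s}" for i z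
    unfolding weight_op_def using N[OF that]
    by (intro sum.mono_neutral_cong_left) (auto simp: \<beta>_def)
  have "(\<Sum>i = 1..s. weight_op D A (b i) \<tau> (x + (c i * \<tau>) *\<^sub>R y))
     = (\<Sum>i = 1..s. \<Sum>k<N. \<beta> i k *\<^sub>C ?\<Phi> k \<tau> x + (\<beta> i k * of_real (c i)) *\<^sub>C ?\<Phi> k \<tau> (\<tau> *\<^sub>R y))"
  proof (intro sum.cong refl)
    fix i assume i: "i \<in> {1..s}"
    have "?\<Phi> k \<tau> (x + (c i * \<tau>) *\<^sub>R y) = ?\<Phi> k \<tau> x + of_real (c i) *\<^sub>C ?\<Phi> k \<tau> (\<tau> *\<^sub>R y)" for k
      unfolding phi_op_add[OF \<tau>] phi_op_scaleC[OF \<tau>, symmetric] by (simp add: scaleC_of_real)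
    then show "weight_op D A (b i) \<tau> (x + (c i * \<tau>) *\<^sub>R y)
        = (\<Sum>k<N. \<beta> i k *\<^sub>C ?\<Phi> k \<tau> x + (\<beta> i k * of_real (c i)) *\<^sub>C ?\<Phi> k \<tau> (\<tau> *\<^sub>R y))"
      by (simp add: W[OF i] scaleC_add_right scaleC_scaleC)
  qed
  also have "\<dots> = (\<Sum>k<N. (\<Sum>i = 1..s. \<beta> i k) *\<^sub>C ?\<Phi> k \<tau> x + (\<Sum>i = 1..s. \<beta> i k * of_real (c i)) *\<^sub>C ?\<Phi> k \<tau> (\<tau> *\<^sub>R y))"
    by (subst sum.swap) (simp add: sum.distrib scaleC_sum_left)
  also have "\<dots> = (\<Sum>k<N. (if k = 1 then ?\<Phi> k \<tau> x else 0) + (if k = 2 then ?\<Phi> k \<tau> (\<tau> *\<^sub>R y) else 0))"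
  proof (intro sum.cong refl)
    fix k assume "k \<in> {..<N}"
    then have k: "k < N" by simp
    show "(\<Sum>i = 1..s. \<beta> i k) *\<^sub>C ?\<Phi> k \<tau> x + (\<Sum>i = 1..s. \<beta> i k * of_real (c i)) *\<^sub>C ?\<Phi> k \<tau> (\<tau> *\<^sub>R y)
        = (if k = 1 then ?\<Phi> k \<tau> x else 0) + (if k = 2 then ?\<Phi> k \<tau> (\<tau> *\<^sub>R y) else 0)"
      unfolding s1[OF k] s2[OF k] by simp
  qed
  also have "\<dots> = ?\<Phi> 1 \<tau> x + ?\<Phi> 2 \<tau> (\<tau> *\<^sub>R y)"
    using N' by (simp add: sum.distrib)
  finally have "\<tau> *\<^sub>R (\<Sum>i = 1..s. weight_op D A (b i) \<tau> (x + (c i * \<tau>) *\<^sub>R y))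
      = \<tau> *\<^sub>R ?\<Phi> (Suc 0) \<tau> x + \<tau> *\<^sub>R ?\<Phi> (Suc 1) \<tau> (\<tau> *\<^sub>R y)"
    by (simp add: scaleR_add_right numeral_2_eq_2)
  also have "\<dots> = conv \<tau> (\<lambda>\<xi>. x) + conv \<tau> (\<lambda>\<xi>. \<xi> *\<^sub>R y)"
    using \<tau> by (simp only: phi_op_Suc_integrable(2)[OF \<tau>]) simp
  also have "\<dots> = conv \<tau> (\<lambda>\<xi>. x + \<xi> *\<^sub>R y)"
    using \<tau> by (intro conv_add[symmetric] continuous_intros) auto
  finally show ?thesis by (simp add: local_error_def)
qed

text \<open>The defect of step \<open>k\<close> is carried forward by the \<open>n - 1 - k\<close>
  steps that follow it; the subtraction never truncates, since \<open>k < n\<close>. The mild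
  solution restarts at each grid point by \<open>conv_split\<close> and the semigroup law.\<close>

lemma global_error:
  assumes \<tau>: "0 < \<tau>" and g: "continuous_on {0..T} g" and n: "real n * \<tau> \<le> T"
  shows "exp_rk D A s c b g u \<tau> n - mild_solution D A g u (real n * \<tau>)
     = (\<Sum>k<n. sg (real (n - 1 - k) * \<tau>) (local_error s c b \<tau> (\<lambda>\<xi>. g (real k * \<tau> + \<xi>))))"
  using n
proof (induction n)
  case 0
  show ?case by (simp add: mild_solution_eq sg_def conv_def)
next
  case (Suc n)
  let ?\<delta> = "\<lambda>k. local_error s c b \<tau> (\<lambda>\<xi>. g (real k * \<tau> + \<xi>))"
  have n: "real n * \<tau> \<le> T" using Suc.prems \<tau> by (simp add: algebra_simps)
  have n0: "0 \<le> real n * \<tau>" using \<tau> by simp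
  have eq: "real (Suc n) * \<tau> = real n * \<tau> + \<tau>" by (simp add: algebra_simps)
  interpret S: bounded_linear "sg \<tau>" by (rule bounded_linear_sg) (use \<tau> in simp)
  have "conv (real n * \<tau> + \<tau>) g = sg \<tau> (conv (real n * \<tau>) g) + conv \<tau> (\<lambda>\<xi>. g (real n * \<tau> + \<xi>))"
  proof (rule conv_split[OF _ n0])
    show "continuous_on {0..real n * \<tau> + \<tau>} g"
      by (rule continuous_on_subset[OF g]) (use Suc.prems eq in simp)
  qed (use \<tau> in simp)
  moreover have "sg (real n * \<tau> + \<tau>) u = sg \<tau> (sg (real n * \<tau>) u)"
    using n0 \<tau> by (simp add: sg_semigroup add.commute)
  ultimately have "mild_solution D A g u (real (Suc n) * \<tau>)
      = sg \<tau> (mild_solution D A g u (real n * \<tau>)) + conv \<tau> (\<lambda>\<xi>. g (real n * \<tau> + \<xi>))"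
    unfolding mild_solution_eq eq by (simp add: S.add)
  then have "exp_rk D A s c b g u \<tau> (Suc n) - mild_solution D A g u (real (Suc n) * \<tau>)
      = sg \<tau> (exp_rk D A s c b g u \<tau> n - mild_solution D A g u (real n * \<tau>)) + ?\<delta> n"
    by (simp add: S.diff local_error_def analytic_semigroup_eq)
  also have "\<dots> = (\<Sum>k<n. sg \<tau> (sg (real (n - 1 - k) * \<tau>) (?\<delta> k))) + ?\<delta> n"
    using Suc.IH[OF n] by (simp add: S.sum)
  also have "(\<Sum>k<n. sg \<tau> (sg (real (n - 1 - k) * \<tau>) (?\<delta> k))) = (\<Sum>k<n. sg (real (Suc n - 1 - k) * \<tau>) (?\<delta> k))"
  proof (intro sum.cong refl)
    fix k assume "k \<in> {..<n}"
    then have "\<tau> + real (n - 1 - k) * \<tau> = real (Suc n - 1 - k) * \<tau>"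
      by (simp add: of_nat_diff algebra_simps)
    then show "sg \<tau> (sg (real (n - 1 - k) * \<tau>) (?\<delta> k)) = sg (real (Suc n - 1 - k) * \<tau>) (?\<delta> k)"
      using \<tau> by (simp add: sg_semigroup)
  qed
  also have "\<dots> + ?\<delta> n = (\<Sum>k<Suc n. sg (real (Suc n - 1 - k) * \<tau>) (?\<delta> k))"
    by (simp add: sg_def)
  finally show ?case .
qed

end

section \<open>The global error\<close>

lemma norm_diff_le_vector_derivative:
  fixes f :: "real \<Rightarrow> 'a::real_normed_vector"
  assumes "\<And>x. x \<in> {a..b} \<Longrightarrow> (f has_vector_derivative f' x) (at x within {a..b})"
    and "\<And>x. x \<in> {a..b} \<Longrightarrow> norm (f' x) \<le> B" and "x \<in> {a..b}" "y \<in> {a..b}"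
  shows "norm (f x - f y) \<le> B * \<bar>x - y\<bar>"
proof -
  have "norm (f x - f y) \<le> B * norm (x - y)"
  proof (rule differentiable_bound[of "{a..b}" f "\<lambda>x h. h *\<^sub>R f' x"])
    fix x assume x: "x \<in> {a..b}"
    show "(f has_derivative (\<lambda>h. h *\<^sub>R f' x)) (at x within {a..b})"
      using assms(1)[OF x] by (simp add: has_vector_derivative_def)
    show "onorm (\<lambda>h. h *\<^sub>R f' x) \<le> B"
    proof (rule onorm_le)
      show "norm (h *\<^sub>R f' x) \<le> B * norm h" for h
        using mult_left_mono[OF assms(2)[OF x], of "\<bar>h\<bar>"] by (simp add: mult.commute)
    qed
  qed (use assms in auto)
  then show ?thesis by simp
qed

text \<open>On a step starting at \<open>t = k * \<tau> > 0\<close> the bound \<open>B / t\<close>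
  for \<open>g''\<close> lets \<open>g'\<close> vary by at most \<open>B / k\<close>, so the
  remainder is at most \<open>B * \<tau> / k\<close>. On the first step that bound is singular;
  there the increment of \<open>g\<close> and the linear term are each bounded by
  \<open>B * \<tau>\<close> through \<open>g'\<close>, whence the factor 2.\<close>

lemma taylor_remainder_le:
  fixes g :: "real \<Rightarrow> 'a::real_normed_vector"
  assumes g: "\<And>t. t \<in> {0..T} \<Longrightarrow> (g has_vector_derivative g' t) (at t within {0..T})"
    and g': "\<And>t. t \<in> {0<..T} \<Longrightarrow> (g' has_vector_derivative g'' t) (at t within {0..T})"
    and B: "\<And>t. t \<in> {0..T} \<Longrightarrow> norm (g' t) \<le> B" "\<And>t. t \<in> {0<..T} \<Longrightarrow> norm (g'' t) \<le> B / t"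
    and \<tau>: "0 < \<tau>" and k: "real k * \<tau> + \<tau> \<le> T" and \<xi>: "\<xi> \<in> {0..\<tau>}"
  shows "norm (g (real k * \<tau> + \<xi>) - (g (real k * \<tau>) + \<xi> *\<^sub>R g' (real k * \<tau>))) \<le> 2 * B * \<tau> / max 1 (real k)"
proof (cases "k = 0")
  case True
  have T: "\<tau> \<le> T" using k True by simp
  have B0: "0 \<le> B" using order_trans[OF norm_ge_zero B(1)[of 0]] \<tau> T by auto
  have 1: "norm (g \<xi> - g 0) \<le> B * \<bar>\<xi> - 0\<bar>"
    by (rule norm_diff_le_vector_derivative[OF g B(1)]) (use \<xi> T in auto)
  have 2: "norm (\<xi> *\<^sub>R g' 0) \<le> B * \<xi>"
    using mult_left_mono[OF B(1)[of 0], of \<xi>] \<xi> T \<tau> by (simp add: mult.commute)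
  have "norm ((g \<xi> - g 0) - \<xi> *\<^sub>R g' 0) \<le> B * \<xi> + B * \<xi>"
    using \<xi> order_trans[OF norm_triangle_ineq4 add_mono[OF 1 2]] by simp
  also have "\<dots> \<le> 2 * B * \<tau>" using mult_left_mono[of \<xi> \<tau> B] \<xi> B0 by auto
  finally show ?thesis using True by (simp add: algebra_simps)
next
  case False
  define t where "t = real k * \<tau>"
  have t: "0 < t" "t + \<tau> \<le> T" using False \<tau> k by (auto simp: t_def)
  have B0: "0 \<le> B" using order_trans[OF norm_ge_zero B(1)[of t]] t \<tau> by auto
  have sub: "{t..t + \<tau>} \<subseteq> {0..T}" using t by auto
  have d': "norm (g' x - g' t) \<le> B / real k" if x: "x \<in> {t..t + \<tau>}" for x
  proof -
    have "norm (g' x - g' t) \<le> B / t * \<bar>x - t\<bar>"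
    proof (rule norm_diff_le_vector_derivative[of t "t + \<tau>" g' g''])
      fix y assume y: "y \<in> {t..t + \<tau>}"
      then show "(g' has_vector_derivative g'' y) (at y within {t..t + \<tau>})"
        using t by (intro has_vector_derivative_within_subset[OF g' sub]) auto
      have "norm (g'' y) \<le> B / y" using y t by (intro B(2)) auto
      also have "\<dots> \<le> B / t" using y t B0 by (intro divide_left_mono) auto
      finally show "norm (g'' y) \<le> B / t" .
    qed (use x \<tau> in auto)
    also have "\<dots> \<le> B / t * \<tau>" using x t B0 by (intro mult_left_mono) auto
    also have "\<dots> = B / real k" using \<tau> by (simp add: t_def)
    finally show ?thesis .
  qed
  \<comment> \<open>The linear part is removed so that the derivative of \<open>h\<close> is the
    increment of \<open>g'\<close>, which \<open>d'\<close> has just bounded.\<close>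
  define h where "h x = g x - (x - t) *\<^sub>R g' t" for x
  have "norm (h (t + \<xi>) - h t) \<le> B / real k * \<bar>t + \<xi> - t\<bar>"
  proof (rule norm_diff_le_vector_derivative[of t "t + \<tau>" h "\<lambda>x. g' x - g' t"])
    fix x assume x: "x \<in> {t..t + \<tau>}"
    have "(g has_vector_derivative g' x) (at x within {t..t + \<tau>})"
      using x sub by (intro has_vector_derivative_within_subset[OF g sub]) auto
    then show "(h has_vector_derivative g' x - g' t) (at x within {t..t + \<tau>})"
      unfolding h_def by (auto intro!: derivative_eq_intros simp: has_vector_derivative_def algebra_simps)
    show "norm (g' x - g' t) \<le> B / real k" by (rule d'[OF x])
  qed (use \<xi> in auto)
  also have "\<dots> \<le> B / real k * \<tau>" using \<xi> B0 by (intro mult_left_mono) auto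
  also have "\<dots> \<le> 2 * B * \<tau> / max 1 (real k)" using False B0 \<tau> by (simp add: divide_right_mono max_def)
  finally show ?thesis by (simp add: h_def t_def algebra_simps)
qed

text \<open>The constant 2 is the contribution of \<open>k = 0\<close> and \<open>k = 1\<close>;
  each later term is at most an increment of the logarithm.\<close>

lemma sum_inverse_le_ln:
  "1 \<le> n \<Longrightarrow> (\<Sum>k<Suc n. 1 / max 1 (real k)) \<le> 2 + ln (real n)"
proof (induction n rule: dec_induct)
  case (step n)
  have "ln (real n / real (Suc n)) \<le> real n / real (Suc n) - 1" using step by (intro ln_le_minus_one) auto
  moreover have "ln (real n / real (Suc n)) = ln (real n) - ln (real (Suc n))"
    using step by (simp add: ln_div del: of_nat_Suc)
  moreover have "real n / real (Suc n) - 1 = - (1 / real (Suc n))" by (simp add: field_simps)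
  ultimately have "1 / real (Suc n) \<le> ln (real (Suc n)) - ln (real n)" by linarith
  then show ?case using step.IH by (simp add: max_def)
qed simp

text \<open>Here the step size enters the logarithm: \<open>n \<le> T / \<tau>\<close> gives
  \<open>ln n \<le> ln T - ln \<tau>\<close>. The product form separates a constant depending on
  \<open>T\<close> from the factor of the theorem.\<close>

lemma sum_inverse_steps_le:
  assumes \<tau>: "0 < \<tau>" and n: "real n * \<tau> \<le> T" "1 \<le> n"
  shows "(\<Sum>k<n. 1 / max 1 (real k)) \<le> (2 + \<bar>ln T\<bar>) * (\<bar>ln \<tau>\<bar> + 1)"
proof -
  have "0 < real n * \<tau>" using n \<tau> by simp
  then have T: "0 < T" using n by linarith
  have "real n \<le> T / \<tau>" using n \<tau> by (simp add: pos_le_divide_eq)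
  then have "ln (real n) \<le> ln (T / \<tau>)" using n T \<tau> by simp
  also have "\<dots> = ln T - ln \<tau>" using T \<tau> by (simp add: ln_div)
  finally have ln: "ln (real n) \<le> \<bar>ln T\<bar> + \<bar>ln \<tau>\<bar>" by linarith
  have "(\<Sum>k<n. 1 / max 1 (real k)) \<le> (\<Sum>k<Suc n. 1 / max 1 (real k))" by simp
  also have "\<dots> \<le> 2 + ln (real n)" by (rule sum_inverse_le_ln[OF n(2)])
  also have "\<dots> \<le> 2 + \<bar>ln T\<bar> + \<bar>ln \<tau>\<bar>" using ln by simp
  also have "\<dots> \<le> (2 + \<bar>ln T\<bar>) * (\<bar>ln \<tau>\<bar> + 1)"
  proof -
    have "\<bar>ln \<tau>\<bar> \<le> (2 + \<bar>ln T\<bar>) * \<bar>ln \<tau>\<bar>" using mult_right_mono[of 1 "2 + \<bar>ln T\<bar>" "\<bar>ln \<tau>\<bar>"] by simp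
    then show ?thesis by (simp add: algebra_simps)
  qed
  finally show ?thesis .
qed

section \<open>From bounds in X to the intermediate norm\<close>

context sectorial_choice
begin

text \<open>For \<open>p = 1\<close> the weight exponent \<open>1 - \<alpha> - 1 / p\<close> is
  \<open>- \<alpha>\<close>, so the logarithmic bound is exactly what \<open>Lp01_log_weight\<close>
  integrates.\<close>

lemma interp_estimate:
  assumes \<alpha>: "0 < \<alpha>" "\<alpha> < 1" and \<tau>: "0 < \<tau>" and E: "0 \<le> E"
    and bd: "\<And>t. t \<in> {0<..<1} \<Longrightarrow> norm (Asg t x) \<le> E * ln (1 + \<tau> / t)"
  shows "x \<in> interp_space D A \<alpha> 1"
    and "interp_norm D A \<alpha> 1 x \<le> norm x + E * ((8 / (1 - \<alpha>)\<^sup>2 * 2 powr ((1 - \<alpha>) / 2) + 1 / \<alpha>) * \<tau> powr (1 - \<alpha>))"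
proof -
  have eq: "interp_fun D A \<alpha> 1 x t = t powr (- \<alpha>) * norm (Asg t x)" if "t \<in> {0<..<1}" for t
    using that by (simp add: interp_fun_def analytic_semigroup_eq A_sg)
  have "continuous_on {0<..<1} (\<lambda>t. t powr (- \<alpha>) * norm (Asg t x))"
    by (intro continuous_intros continuous_on_subset[OF continuous_on_Asg]) auto
  then have c: "continuous_on {0<..<1} (interp_fun D A \<alpha> 1 x)"
    by (rule continuous_on_eq) (simp add: eq)
  have v: "0 \<le> interp_fun D A \<alpha> 1 x t \<and> interp_fun D A \<alpha> 1 x t \<le> E * (t powr (- \<alpha>) * ln (1 + \<tau> / t))"
    if "t \<in> {0<..<1}" for t
    using mult_left_mono[OF bd[OF that], of "t powr (- \<alpha>)"] by (simp add: eq[OF that] mult_ac)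
  note L = Lp01_log_weight[OF \<alpha> \<tau> E c v]
  show "x \<in> interp_space D A \<alpha> 1" using L(1) by (simp add: interp_space_def)
  show "interp_norm D A \<alpha> 1 x \<le> norm x + E * ((8 / (1 - \<alpha>)\<^sup>2 * 2 powr ((1 - \<alpha>) / 2) + 1 / \<alpha>) * \<tau> powr (1 - \<alpha>))"
    using L(2) by (simp add: interp_norm_def)
qed

text \<open>\<open>C\<close> is fixed before \<open>x\<close>, \<open>\<tau>\<close> and
  \<open>E\<close>. For \<open>\<alpha> > 0\<close> it comes from the embedding of the interpolation
  space with \<open>p = 1\<close>; the summand \<open>T powr \<alpha>\<close> converts the bound
  \<open>\<tau> * E\<close> for \<open>norm x\<close> into one with
  \<open>\<tau> powr (1 - \<alpha>)\<close>, using \<open>\<tau> \<le> T\<close>. For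
  \<open>\<alpha> = 0\<close> the norm bound is the claim itself.\<close>

lemma intermediate_estimate:
  assumes Y: "intermediate_space D A \<alpha> Y N" and \<alpha>: "0 \<le> \<alpha>" "\<alpha> < 1" and T: "0 < T"
  obtains C where "0 \<le> C" "\<And>x \<tau> E. 0 < \<tau> \<Longrightarrow> \<tau> \<le> T \<Longrightarrow> 0 \<le> E \<Longrightarrow> norm x \<le> \<tau> * E \<Longrightarrow>
     (\<And>t. t \<in> {0<..<1} \<Longrightarrow> norm (Asg t x) \<le> E * ln (1 + \<tau> / t)) \<Longrightarrow> x \<in> Y \<and> N x \<le> C * E * \<tau> powr (1 - \<alpha>)"
proof (cases "\<alpha> = 0")
  case True
  show thesis
  proof (rule that[of 1])
    show "x \<in> Y \<and> N x \<le> 1 * E * \<tau> powr (1 - \<alpha>)" if "0 < \<tau>" "norm x \<le> \<tau> * E" for x \<tau> E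
      using Y that by (simp add: True intermediate_space_def mult.commute)
  qed simp
next
  case False
  then have \<alpha>0: "0 < \<alpha>" using \<alpha> by simp
  obtain K where K: "interp_space D A \<alpha> 1 \<subseteq> Y" "\<And>x. x \<in> interp_space D A \<alpha> 1 \<Longrightarrow> N x \<le> K * interp_norm D A \<alpha> 1 x"
    using Y False by (auto simp: intermediate_space_def continuously_embedded_def)
  define L where "L = 8 / (1 - \<alpha>)\<^sup>2 * 2 powr ((1 - \<alpha>) / 2) + 1 / \<alpha>"
  have L: "0 \<le> L" using \<alpha>0 by (simp add: L_def)
  show thesis
  proof (rule that[of "\<bar>K\<bar> * (T powr \<alpha> + L)"])
    fix x \<tau> E
    assume \<tau>: "0 < \<tau>" "\<tau> \<le> T" and E: "0 \<le> E" and x: "norm x \<le> \<tau> * E"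
      and bd: "\<And>t. t \<in> {0<..<1} \<Longrightarrow> norm (Asg t x) \<le> E * ln (1 + \<tau> / t)"
    note I = interp_estimate[OF \<alpha>0 \<alpha>(2) \<tau>(1) E bd, folded L_def]
    have "\<tau> = \<tau> powr \<alpha> * \<tau> powr (1 - \<alpha>)" using \<tau> by (simp flip: powr_add)
    also have "\<dots> \<le> T powr \<alpha> * \<tau> powr (1 - \<alpha>)" using \<tau> \<alpha>0 by (intro mult_right_mono powr_mono2) auto
    finally have "\<tau> * E \<le> (T powr \<alpha> * \<tau> powr (1 - \<alpha>)) * E" using E by (rule mult_right_mono)
    then have n: "interp_norm D A \<alpha> 1 x \<le> (T powr \<alpha> + L) * E * \<tau> powr (1 - \<alpha>)"
      using I(2) x by (simp add: algebra_simps)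
    have n0: "0 \<le> interp_norm D A \<alpha> 1 x"
      unfolding interp_norm_def Lp01_norm_def by simp
    have "N x \<le> K * interp_norm D A \<alpha> 1 x" by (rule K(2)[OF I(1)])
    also have "\<dots> \<le> \<bar>K\<bar> * interp_norm D A \<alpha> 1 x" using n0 by (intro mult_right_mono) auto
    also have "\<dots> \<le> \<bar>K\<bar> * ((T powr \<alpha> + L) * E * \<tau> powr (1 - \<alpha>))" using n by (intro mult_left_mono) auto
    finally show "x \<in> Y \<and> N x \<le> \<bar>K\<bar> * (T powr \<alpha> + L) * E * \<tau> powr (1 - \<alpha>)"
      using I(1) K(1) by (auto simp: mult_ac)
  qed (use L in auto)
qed

text \<open>A common \<open>E\<close> for both bounds is what \<open>intermediate_estimate\<close>
  asks for, hence the sum \<open>K_S T + K_B (T + 1)\<close>. The other factor \<open>K_S T\<close>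
  comes from propagating each defect to the final time; \<open>Asg t\<close> commutes with that
  propagation.\<close>

lemma global_error_bounds:
  fixes g :: "real \<Rightarrow> 'a"
  assumes c: "\<And>i. i \<in> {1..s} \<Longrightarrow> c i \<in> {0..1}"
    and w1: "\<And>z. (\<Sum>i = 1..s. weight (b i) z) = phi 1 z"
    and w2: "\<And>z. (\<Sum>i = 1..s. weight (b i) z * of_real (c i)) = phi 2 z"
    and g: "\<And>t. t \<in> {0..T} \<Longrightarrow> (g has_vector_derivative g' t) (at t within {0..T})"
    and g': "\<And>t. t \<in> {0<..T} \<Longrightarrow> (g' has_vector_derivative g'' t) (at t within {0..T})"
    and B: "0 \<le> B" "\<And>t. t \<in> {0..T} \<Longrightarrow> norm (g' t) \<le> B" "\<And>t. t \<in> {0<..T} \<Longrightarrow> norm (g'' t) \<le> B / t"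
    and \<tau>: "0 < \<tau>" and n: "real n * \<tau> \<le> T" "1 \<le> n"
    and E: "E = (2 * B * \<tau>) * (K_S T * (weight_sum s b + 1) * (K_S T + K_B (T + 1)) * ((2 + \<bar>ln T\<bar>) * (\<bar>ln \<tau>\<bar> + 1)))"
    and x: "x = exp_rk D A s c b g u \<tau> n - mild_solution D A g u (real n * \<tau>)"
  shows "norm x \<le> \<tau> * E" and "\<And>t. t \<in> {0<..<1} \<Longrightarrow> norm (Asg t x) \<le> E * ln (1 + \<tau> / t)"
proof -
  have "1 * \<tau> \<le> real n * \<tau>" using n \<tau> by (intro mult_right_mono) auto
  then have \<tau>T: "\<tau> \<le> T" using n by linarith
  define W where "W = weight_sum s b + 1"
  have W: "0 \<le> W" by (auto simp: W_def weight_sum_def intro!: sum_nonneg add_nonneg_nonneg)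
  have KS: "0 \<le> K_S T" using K_S_ge[of T] by linarith
  have KB: "0 \<le> K_B (T + 1)" using \<tau> \<tau>T by (intro K_B_nonneg) auto
  define \<delta> where "\<delta> k = local_error s c b \<tau> (\<lambda>\<xi>. g (real k * \<tau> + \<xi>))" for k
  define e where "e k = 2 * B * \<tau> / max 1 (real k)" for k :: nat
  have gc: "continuous_on {0..T} g"
    by (rule continuous_on_vector_derivative[OF g])
  have \<delta>: "norm (\<delta> k) \<le> W * (K_S T * \<tau> * e k)"
    "\<And>t. 0 < t \<Longrightarrow> t \<le> 1 \<Longrightarrow> norm (Asg t (\<delta> k)) \<le> W * (K_B (T + 1) * e k * ln (1 + \<tau> / t))"
    if k: "k < n" for k
  proof -
    have "real (k + 1) * \<tau> \<le> real n * \<tau>" using k \<tau> by (intro mult_right_mono) auto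
    then have kT: "real k * \<tau> + \<tau> \<le> T" using n by (simp add: algebra_simps)
    define p where "p \<xi> = g (real k * \<tau>) + \<xi> *\<^sub>R g' (real k * \<tau>)" for \<xi>
    define q where "q \<xi> = g (real k * \<tau> + \<xi>) - p \<xi>" for \<xi>
    have pc: "continuous_on {0..\<tau>} p" unfolding p_def by (intro continuous_intros)
    have "0 \<le> real k * \<tau>" using \<tau> by simp
    then have qc: "continuous_on {0..\<tau>} q" unfolding q_def
      by (intro continuous_intros pc continuous_on_compose2[OF gc]) (use kT in auto)
    have "\<delta> k = local_error s c b \<tau> (\<lambda>\<xi>. p \<xi> + q \<xi>)" by (simp add: \<delta>_def q_def)
    also have "\<dots> = local_error s c b \<tau> q"
      using local_error_add[OF \<tau> pc qc] local_error_affine[OF w1 w2 \<tau>] by (simp add: p_def[abs_def])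
    finally have \<delta>q: "\<delta> k = local_error s c b \<tau> q" .
    have qe: "norm (q \<xi>) \<le> e k" if "\<xi> \<in> {0..\<tau>}" for \<xi>
      unfolding q_def p_def e_def by (rule taylor_remainder_le[OF g g' B(2,3) \<tau> kT that])
    show "norm (\<delta> k) \<le> W * (K_S T * \<tau> * e k)"
      unfolding \<delta>q W_def by (rule norm_local_error_le[OF c \<tau> \<tau>T qc qe])
    show "norm (Asg t (\<delta> k)) \<le> W * (K_B (T + 1) * e k * ln (1 + \<tau> / t))" if "0 < t" "t \<le> 1" for t
      unfolding \<delta>q W_def by (rule norm_Asg_local_error_le[OF c \<tau> \<tau>T qc qe that])
  qed
  have x': "x = (\<Sum>k<n. sg (real (n - 1 - k) * \<tau>) (\<delta> k))"
    unfolding x \<delta>_def by (rule global_error[OF \<tau> gc n(1)])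
  have time: "0 \<le> real (n - 1 - k) * \<tau>" "real (n - 1 - k) * \<tau> \<le> T" for k
  proof -
    have "real (n - 1 - k) * \<tau> \<le> real n * \<tau>" using \<tau> by (intro mult_right_mono) auto
    then show "real (n - 1 - k) * \<tau> \<le> T" using n by linarith
    show "0 \<le> real (n - 1 - k) * \<tau>" using \<tau> by simp
  qed
  have e: "(\<Sum>k<n. e k) \<le> (2 * B * \<tau>) * ((2 + \<bar>ln T\<bar>) * (\<bar>ln \<tau>\<bar> + 1))"
  proof -
    have "(\<Sum>k<n. e k) = (2 * B * \<tau>) * (\<Sum>k<n. 1 / max 1 (real k))" by (simp add: e_def sum_distrib_left)
    also have "\<dots> \<le> (2 * B * \<tau>) * ((2 + \<bar>ln T\<bar>) * (\<bar>ln \<tau>\<bar> + 1))"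
      using B \<tau> by (intro mult_left_mono sum_inverse_steps_le n) auto
    finally show ?thesis .
  qed
  have e0: "0 \<le> (\<Sum>k<n. e k)" using B \<tau> by (intro sum_nonneg) (auto simp: e_def)
  have E': "K_S T * W * (K_S T + K_B (T + 1)) * (\<Sum>k<n. e k) \<le> E"
  proof -
    have "E = K_S T * W * (K_S T + K_B (T + 1)) * ((2 * B * \<tau>) * ((2 + \<bar>ln T\<bar>) * (\<bar>ln \<tau>\<bar> + 1)))"
      by (simp only: E W_def mult_ac)
    then show ?thesis using KS KB W by (simp only:) (intro mult_left_mono[OF e] mult_nonneg_nonneg; simp)
  qed
  have "norm x \<le> (\<Sum>k<n. K_S T * (W * (K_S T * \<tau> * e k)))"
    unfolding x'
  proof (intro order_trans[OF norm_sum] sum_mono)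
    fix k assume "k \<in> {..<n}"
    then have "K_S T * norm (\<delta> k) \<le> K_S T * (W * (K_S T * \<tau> * e k))" using KS by (intro mult_left_mono \<delta>) auto
    then show "norm (sg (real (n - 1 - k) * \<tau>) (\<delta> k)) \<le> K_S T * (W * (K_S T * \<tau> * e k))"
      by (rule order_trans[OF norm_sg_le[OF time]])
  qed
  also have "\<dots> = \<tau> * (K_S T * W * K_S T * (\<Sum>k<n. e k))" by (simp add: sum_distrib_left sum_distrib_right mult_ac)
  also have "\<dots> \<le> \<tau> * (K_S T * W * (K_S T + K_B (T + 1)) * (\<Sum>k<n. e k))"
    using \<tau> KS KB W e0 by (intro mult_left_mono mult_right_mono) auto
  also have "\<dots> \<le> \<tau> * E" using E' \<tau> by (intro mult_left_mono) auto
  finally show "norm x \<le> \<tau> * E" .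
  fix t :: real assume "t \<in> {0<..<1}"
  then have t: "0 < t" "t \<le> 1" by auto
  have ln: "0 \<le> ln (1 + \<tau> / t)" using t \<tau> by (intro ln_ge_zero) auto
  interpret B: bounded_linear "Asg t" by (rule bounded_linear_Asg[OF t(1)])
  have "norm (Asg t x) \<le> (\<Sum>k<n. K_S T * (W * (K_B (T + 1) * e k * ln (1 + \<tau> / t))))"
    unfolding x' B.sum
  proof (intro order_trans[OF norm_sum] sum_mono)
    fix k assume "k \<in> {..<n}"
    then have "K_S T * norm (Asg t (\<delta> k)) \<le> K_S T * (W * (K_B (T + 1) * e k * ln (1 + \<tau> / t)))"
      using KS t by (intro mult_left_mono \<delta>) auto
    then show "norm (Asg t (sg (real (n - 1 - k) * \<tau>) (\<delta> k))) \<le> K_S T * (W * (K_B (T + 1) * e k * ln (1 + \<tau> / t)))"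
      unfolding Asg_sg_commute[OF t(1) time(1)] by (rule order_trans[OF norm_sg_le[OF time]])
  qed
  also have "\<dots> = (K_S T * W * K_B (T + 1) * (\<Sum>k<n. e k)) * ln (1 + \<tau> / t)"
    by (simp add: sum_distrib_left sum_distrib_right mult_ac)
  also have "\<dots> \<le> (K_S T * W * (K_S T + K_B (T + 1)) * (\<Sum>k<n. e k)) * ln (1 + \<tau> / t)"
    using ln KS KB W e0 by (intro mult_left_mono mult_right_mono) auto
  also have "\<dots> \<le> E * ln (1 + \<tau> / t)" using E' ln by (intro mult_right_mono) auto
  finally show "norm (Asg t x) \<le> E * ln (1 + \<tau> / t)" .
qed

end

theorem theorem3p2:
  fixes D :: "'a::complex_banach set" and A :: "'a \<Rightarrow> 'a"
    and \<alpha> :: real and X\<alpha> :: "'a set" and norm\<alpha> :: "'a \<Rightarrow> real"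
    and T B2 :: real
    and s :: nat and c :: "nat \<Rightarrow> real" and b :: "nat \<Rightarrow> complex list"
  assumes "sectorial D A"
    and "0 \<le> \<alpha>" and "\<alpha> < 1"
    and "intermediate_space D A \<alpha> X\<alpha> norm\<alpha>"
    and "T > 0"
    and "\<forall>i\<in>{1..s}. c i \<in> {0..1}"
    and "\<forall>z. (\<Sum>i = 1..s. weight (b i) z) = phi 1 z"
    and "\<forall>z. (\<Sum>i = 1..s. weight (b i) z * of_real (c i)) = phi 2 z"
  shows "\<exists>C. \<forall>(g :: real \<Rightarrow> 'a) g' g'' u0 \<tau> (n :: nat).
    (\<forall>t\<in>{0..T}. (g has_vector_derivative g' t) (at t within {0..T})) \<longrightarrow>
    (\<forall>t\<in>{0<..T}. (g' has_vector_derivative g'' t) (at t within {0..T})) \<longrightarrow>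
    (\<forall>t\<in>{0..T}. norm (g t) \<le> B2 \<and> norm (g' t) \<le> B2) \<longrightarrow>
    (\<forall>t\<in>{0<..T}. norm (g'' t) \<le> B2 / t) \<longrightarrow>
    u0 \<in> X\<alpha> \<longrightarrow> 0 < \<tau> \<longrightarrow> real n * \<tau> \<le> T \<longrightarrow>
    exp_rk D A s c b g u0 \<tau> n - mild_solution D A g u0 (real n * \<tau>) \<in> X\<alpha> \<and>
    norm\<alpha> (exp_rk D A s c b g u0 \<tau> n - mild_solution D A g u0 (real n * \<tau>))
      \<le> C * \<tau> powr (2 - \<alpha>) * (\<bar>ln \<tau>\<bar> + 1)"
proof -
  obtain \<omega>' \<theta>' M' where s': "sectorial_with D A \<omega>' \<theta>' M'" using assms(1) by (auto simp: sectorial_def)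
  then obtain \<eta>' where "pi / 2 < \<eta>'" "\<eta>' < \<theta>'" using dense[of "pi / 2" \<theta>'] by (auto simp: sectorial_with_def)
  \<comment> \<open>Any radius would do: existence of one admissible contour guarantees that the
    contour selected by \<open>SOME\<close> is admissible.\<close>
  with s' have "admissible_contour D A (\<omega>', 1, \<eta>')" unfolding admissible_contour_def by auto
  then have adm: "admissible_contour D A (SOME p. admissible_contour D A p)" by (rule someI)
  obtain \<omega> r \<eta> where choice: "(SOME p. admissible_contour D A p) = (\<omega>, r, \<eta>)" by (metis prod_cases3)
  obtain \<theta> M where "sectorial_with D A \<omega> \<theta> M" "0 < r" "pi / 2 < \<eta>" "\<eta> < \<theta>"
    using adm[unfolded choice] by (auto simp: admissible_contour_def)
  then interpret sectorial_choice D A \<omega> \<theta> M r \<eta>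
    using choice by unfold_locales auto
  obtain C0 where C0: "0 \<le> C0" "\<And>x \<tau> E. 0 < \<tau> \<Longrightarrow> \<tau> \<le> T \<Longrightarrow> 0 \<le> E \<Longrightarrow> norm x \<le> \<tau> * E \<Longrightarrow>
     (\<And>t. t \<in> {0<..<1} \<Longrightarrow> norm (Asg t x) \<le> E * ln (1 + \<tau> / t)) \<Longrightarrow> x \<in> X\<alpha> \<and> norm\<alpha> x \<le> C0 * E * \<tau> powr (1 - \<alpha>)"
    using intermediate_estimate[OF assms(4,2,3,5)] by blast
  define F where "F = K_S T * (weight_sum s b + 1) * (K_S T + K_B (T + 1)) * (2 + \<bar>ln T\<bar>)"
  have F: "0 \<le> F"
    unfolding F_def weight_sum_def using K_S_ge[of T] K_B_nonneg[of "T + 1"] assms(5)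
    by (intro mult_nonneg_nonneg add_nonneg_nonneg sum_nonneg) auto
  show ?thesis
  \<comment> \<open>The absolute value makes the constant nonnegative before any \<open>g\<close> is
    given.\<close>
  proof (intro exI[of _ "C0 * (2 * \<bar>B2\<bar> * F)"] allI impI)
    fix g :: "real \<Rightarrow> 'a" and g' g'' u0 \<tau> and n :: nat
    assume g: "\<forall>t\<in>{0..T}. (g has_vector_derivative g' t) (at t within {0..T})"
      and g': "\<forall>t\<in>{0<..T}. (g' has_vector_derivative g'' t) (at t within {0..T})"
      and B: "\<forall>t\<in>{0..T}. norm (g t) \<le> B2 \<and> norm (g' t) \<le> B2" "\<forall>t\<in>{0<..T}. norm (g'' t) \<le> B2 / t"
      and \<tau>: "0 < \<tau>" and n: "real n * \<tau> \<le> T"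
    define x where "x = exp_rk D A s c b g u0 \<tau> n - mild_solution D A g u0 (real n * \<tau>)"
    show "x \<in> X\<alpha> \<and> norm\<alpha> x \<le> C0 * (2 * \<bar>B2\<bar> * F) * \<tau> powr (2 - \<alpha>) * (\<bar>ln \<tau>\<bar> + 1)"
    proof (cases "n = 0")
      case True
      then have "x = 0" by (simp add: x_def mild_solution_eq sg_def conv_def)
      \<comment> \<open>For \<open>n = 0\<close> nothing forces \<open>\<tau> \<le> T\<close>, so
        the estimate is applied to the zero vector with step \<open>T\<close> and
        \<open>E = 0\<close>.\<close>
      then have "x \<in> X\<alpha> \<and> norm\<alpha> x \<le> C0 * 0 * T powr (1 - \<alpha>)"
        using assms(5) linear_0[OF bounded_linear.linear[OF bounded_linear_Asg]] by (intro C0(2)) auto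
      moreover have "0 \<le> C0 * (2 * \<bar>B2\<bar> * F) * \<tau> powr (2 - \<alpha>) * (\<bar>ln \<tau>\<bar> + 1)"
        using C0(1) F by (intro mult_nonneg_nonneg) auto
      ultimately show ?thesis by (auto intro: order_trans)
    next
      case False
      then have n1: "1 \<le> n" by simp
      have "1 * \<tau> \<le> real n * \<tau>" using n1 \<tau> by (intro mult_right_mono) auto
      then have \<tau>T: "\<tau> \<le> T" using n by linarith
      have "norm (g 0) \<le> B2" using B(1) assms(5) by auto
      then have B0: "0 \<le> B2" using norm_ge_zero order_trans by blast
      define E where "E = (2 * B2 * \<tau>) * (K_S T * (weight_sum s b + 1) * (K_S T + K_B (T + 1)) * ((2 + \<bar>ln T\<bar>) * (\<bar>ln \<tau>\<bar> + 1)))"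
      have E: "E = 2 * B2 * F * \<tau> * (\<bar>ln \<tau>\<bar> + 1)" by (simp add: E_def F_def)
      have E0: "0 \<le> E" unfolding E using B0 F \<tau> by (intro mult_nonneg_nonneg) auto
      have *: "norm x \<le> \<tau> * E" "\<And>t. t \<in> {0<..<1} \<Longrightarrow> norm (Asg t x) \<le> E * ln (1 + \<tau> / t)"
        using global_error_bounds[of s c b T g g' g'' B2 \<tau> n E x u0] assms(6-8) g g' B B0 \<tau> n n1 E_def x_def by auto
      have "x \<in> X\<alpha> \<and> norm\<alpha> x \<le> C0 * E * \<tau> powr (1 - \<alpha>)"
        by (rule C0(2)[OF \<tau> \<tau>T E0 *])
      moreover have "\<tau> * \<tau> powr (1 - \<alpha>) = \<tau> powr (2 - \<alpha>)"
        using \<tau> powr_add[of \<tau> 1 "1 - \<alpha>"] by simp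
      then have "C0 * E * \<tau> powr (1 - \<alpha>) = C0 * (2 * \<bar>B2\<bar> * F) * \<tau> powr (2 - \<alpha>) * (\<bar>ln \<tau>\<bar> + 1)"
        using B0 by (simp add: E mult_ac flip: \<open>\<tau> * \<tau> powr (1 - \<alpha>) = \<tau> powr (2 - \<alpha>)\<close>)
      ultimately show ?thesis by simp
    qed
  qed
qed

end
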